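(* Let $H \le G$ be a closed subgroup of a (topologically) finitely generated profinite group $G$. The following statements are equivalent. (a) The group $G$ is FAb relative to $H$. (b) The functor $\mathrm{Ind}_H^G$ preserves strong admissibility, i.e. for every strongly admissible smooth representation $\sigma$ of $H$ the induced representation $\mathrm{Ind}_H^G(\sigma)$ is strongly admissible. (c) The induced representation $\mathrm{Ind}_H^G(\mathbb{1}_H)$ of the trivial one-dimensional representation $\mathbb{1}_H$ of $H$ is strongly admissible.
   Context: All representations are over $\mathbb{C}$. A representation of a profinite group $G$ is smooth if every vector has open stabiliser; smooth representations are semisimple and smooth irreducible representations are finite-dimensional. $\mathrm{Irr}(G)$ is the set of isomorphism classes of smooth irreducible representations and $m(\pi,\rho)$ is the multiplicity of $\pi\in\mathrm{Irr}(G)$ in $\rho$. A smooth representation $\rho$ is admissible if $m(\pi,\rho)<\infty$ for all $\pi \in \mathrm{Irr}(G)$, and strongly admissible if it is admissible and for every $d\in\mathbb{N}$ the number $R_d(\rho)=\sum_{\pi\in\mathrm{Irr}(G),\,\dim\pi\le d} m(\pi,\rho)$ is finite. For a closed subgroup $H\le G$ and a smooth representation $(\sigma,W)$ of $H$, $\mathrm{Ind}_H^G(\sigma)$ is the space of locally constant functions $f\colon G\to W$ with $f(hx)=\sigma(h)f(x)$ for all $h\in H$, $x\in G$, on which $G$ acts by right translation $(g.f)(x)=f(xg)$. $G$ is FAb relative to a closed subgroup $H$ if for every open subgroup $K\le G$ the abelian quotient $K/(H\cap K)[K,K]$ is finite, where $[K,K]$ denotes the (closed) commutator subgroup. *)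

theory Defs
  imports "HOL-Analysis.Analysis" "HOL-Algebra.Algebra" "HOL-Library.Function_Algebras"
begin

section \<open>Profinite groups\<close>

locale topological_group = group G for G (structure) +
  fixes T :: "'a topology"
  assumes topspace_eq: "topspace T = carrier G"
    and continuous_mult: "continuous_map (prod_topology T T) T (\<lambda>(x, y). x \<otimes> y)"
    and continuous_inv: "continuous_map T T (\<lambda>x. inv x)"

locale profinite_group = topological_group +
  assumes compact: "compact_space T"
    and Hausdorff: "Hausdorff_space T"
    and totally_disconnected: "\<And>C. connectedin T C \<Longrightarrow> \<exists>x. C \<subseteq> {x}"

definition topologically_fg :: "('g, 'm) monoid_scheme \<Rightarrow> 'g topology \<Rightarrow> bool" where
  "topologically_fg G T \<longleftrightarrow>
     (\<exists>S. finite S \<and> S \<subseteq> carrier G \<and> T closure_of (generate G S) = carrier G)"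

definition closed_subgroup :: "'g set \<Rightarrow> ('g, 'm) monoid_scheme \<Rightarrow> 'g topology \<Rightarrow> bool" where
  "closed_subgroup H G T \<longleftrightarrow> subgroup H G \<and> closedin T H"

definition open_subgroup :: "'g set \<Rightarrow> ('g, 'm) monoid_scheme \<Rightarrow> 'g topology \<Rightarrow> bool" where
  "open_subgroup K G T \<longleftrightarrow> subgroup K G \<and> openin T K"

definition closed_commutator_subgroup ::
    "('g, 'm) monoid_scheme \<Rightarrow> 'g topology \<Rightarrow> 'g set \<Rightarrow> 'g set" where
  "closed_commutator_subgroup G T K = T closure_of (derived G K)"

definition FAb_relative :: "('g, 'm) monoid_scheme \<Rightarrow> 'g topology \<Rightarrow> 'g set \<Rightarrow> bool" where
  "FAb_relative G T H \<longleftrightarrow>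
     (\<forall>K. open_subgroup K G T \<longrightarrow>
        finite (carrier (G\<lparr>carrier := K\<rparr> Mod
          ((H \<inter> K) <#>\<^bsub>G\<^esub> closed_commutator_subgroup G T K))))"


section \<open>Representations on complex vector spaces\<close>

text \<open>
  The representation space is a subspace \<open>rep_space \<rho>\<close> of a type carrying a complex vector space
  structure \<open>rep_scale \<rho>\<close>; the values of \<open>rep_act \<rho> g\<close> outside \<open>rep_space \<rho>\<close>, or for \<open>g\<close>
  outside the group, are irrelevant.  Every complex vector space is such a subspace (of its own
  type), and zero and one-dimensional spaces occur as subspaces of any type carrying a nonzero
  complex vector space.  A closed subgroup \<open>H\<close> is regarded as a group by way of
  \<open>G\<lparr>carrier := H\<rparr>\<close> and \<open>subtopology T H\<close>.
\<close>

record ('g, 'v) rep =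
  rep_scale :: "complex \<Rightarrow> 'v \<Rightarrow> 'v"
  rep_space :: "'v set"
  rep_act :: "'g \<Rightarrow> 'v \<Rightarrow> 'v"

definition representation ::
    "('g, 'm) monoid_scheme \<Rightarrow> ('g, 'v::ab_group_add) rep \<Rightarrow> bool" where
  "representation G \<rho> \<longleftrightarrow>
     vector_space (rep_scale \<rho>) \<and> module.subspace (rep_scale \<rho>) (rep_space \<rho>) \<and>
     (\<forall>g\<in>carrier G. \<forall>v\<in>rep_space \<rho>. rep_act \<rho> g v \<in> rep_space \<rho>) \<and>
     (\<forall>g\<in>carrier G. \<forall>v\<in>rep_space \<rho>. \<forall>w\<in>rep_space \<rho>.
        rep_act \<rho> g (v + w) = rep_act \<rho> g v + rep_act \<rho> g w) \<and>
     (\<forall>g\<in>carrier G. \<forall>c. \<forall>v\<in>rep_space \<rho>.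
        rep_act \<rho> g (rep_scale \<rho> c v) = rep_scale \<rho> c (rep_act \<rho> g v)) \<and>
     (\<forall>v\<in>rep_space \<rho>. rep_act \<rho> \<one>\<^bsub>G\<^esub> v = v) \<and>
     (\<forall>g\<in>carrier G. \<forall>h\<in>carrier G. \<forall>v\<in>rep_space \<rho>.
        rep_act \<rho> (g \<otimes>\<^bsub>G\<^esub> h) v = rep_act \<rho> g (rep_act \<rho> h v))"

definition smooth ::
    "('g, 'm) monoid_scheme \<Rightarrow> 'g topology \<Rightarrow> ('g, 'v::ab_group_add) rep \<Rightarrow> bool" where
  "smooth G T \<rho> \<longleftrightarrow> representation G \<rho> \<and>
     (\<forall>v\<in>rep_space \<rho>. openin T {g \<in> carrier G. rep_act \<rho> g v = v})"

definition irreducible_rep ::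
    "('g, 'm) monoid_scheme \<Rightarrow> ('g, 'v::ab_group_add) rep \<Rightarrow> bool" where
  "irreducible_rep G \<rho> \<longleftrightarrow> representation G \<rho> \<and> rep_space \<rho> \<noteq> {0} \<and>
     (\<forall>U. module.subspace (rep_scale \<rho>) U \<and> U \<subseteq> rep_space \<rho> \<and>
          (\<forall>g\<in>carrier G. \<forall>u\<in>U. rep_act \<rho> g u \<in> U) \<longrightarrow> U = {0} \<or> U = rep_space \<rho>)"

text \<open>
  Equivariant linear maps, extended by \<open>0\<close> off \<open>rep_space \<rho>\<close>, so that they form a vector space
  under the pointwise operations.
\<close>

definition hom_rep :: "('g, 'm) monoid_scheme \<Rightarrow> ('g, 'v::ab_group_add) rep \<Rightarrow>
    ('g, 'w::ab_group_add) rep \<Rightarrow> ('v \<Rightarrow> 'w) set" where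
  "hom_rep G \<rho> \<sigma> = {f.
     (\<forall>v\<in>rep_space \<rho>. f v \<in> rep_space \<sigma>) \<and> (\<forall>v. v \<notin> rep_space \<rho> \<longrightarrow> f v = 0) \<and>
     (\<forall>v\<in>rep_space \<rho>. \<forall>w\<in>rep_space \<rho>. f (v + w) = f v + f w) \<and>
     (\<forall>c. \<forall>v\<in>rep_space \<rho>. f (rep_scale \<rho> c v) = rep_scale \<sigma> c (f v)) \<and>
     (\<forall>g\<in>carrier G. \<forall>v\<in>rep_space \<rho>. f (rep_act \<rho> g v) = rep_act \<sigma> g (f v))}"

definition iso_rep :: "('g, 'm) monoid_scheme \<Rightarrow> ('g, 'v::ab_group_add) rep \<Rightarrow>
    ('g, 'w::ab_group_add) rep \<Rightarrow> bool" where
  "iso_rep G \<rho> \<sigma> \<longleftrightarrow> (\<exists>f\<in>hom_rep G \<rho> \<sigma>. bij_betw f (rep_space \<rho>) (rep_space \<sigma>))"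

definition pointwise_scale :: "(complex \<Rightarrow> 'w \<Rightarrow> 'w) \<Rightarrow> complex \<Rightarrow> ('a \<Rightarrow> 'w) \<Rightarrow> 'a \<Rightarrow> 'w" where
  "pointwise_scale s c f = (\<lambda>x. s c (f x))"

text \<open>The library's \<open>dim\<close> is \<open>0\<close> on infinite-dimensional spaces; here these get dimension \<open>\<infinity>\<close>.\<close>

definition edim :: "(complex \<Rightarrow> 'v::ab_group_add \<Rightarrow> 'v) \<Rightarrow> 'v set \<Rightarrow> enat" where
  "edim s V = (if \<exists>B. finite B \<and> V \<subseteq> module.span s B then enat (vector_space.dim s V) else \<infinity>)"

definition degree_rep :: "('g, 'v::ab_group_add) rep \<Rightarrow> enat" where
  "degree_rep \<rho> = edim (rep_scale \<rho>) (rep_space \<rho>)"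

definition multiplicity_rep :: "('g, 'm) monoid_scheme \<Rightarrow> ('g, 'v::ab_group_add) rep \<Rightarrow>
    ('g, 'w::ab_group_add) rep \<Rightarrow> enat" where
  "multiplicity_rep G \<pi> \<rho> = edim (pointwise_scale (rep_scale \<rho>)) (hom_rep G \<pi> \<rho>)"

text \<open>
  Smooth irreducible representations of a profinite group are finite-dimensional, so each of them
  is isomorphic to one on a subspace of \<^typ>\<open>nat \<Rightarrow> complex\<close>.
\<close>

definition smooth_irreps ::
    "('g, 'm) monoid_scheme \<Rightarrow> 'g topology \<Rightarrow> ('g, nat \<Rightarrow> complex) rep set" where
  "smooth_irreps G T = {\<pi>. smooth G T \<pi> \<and> irreducible_rep G \<pi>}"

definition Irr ::
    "('g, 'm) monoid_scheme \<Rightarrow> 'g topology \<Rightarrow> ('g, nat \<Rightarrow> complex) rep set set" where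
  "Irr G T = smooth_irreps G T //
     {(\<pi>, \<pi>'). \<pi> \<in> smooth_irreps G T \<and> \<pi>' \<in> smooth_irreps G T \<and> iso_rep G \<pi> \<pi>'}"

definition representative :: "('g, 'v) rep set \<Rightarrow> ('g, 'v) rep" where
  "representative c = (SOME \<pi>. \<pi> \<in> c)"

definition admissible ::
    "('g, 'm) monoid_scheme \<Rightarrow> 'g topology \<Rightarrow> ('g, 'w::ab_group_add) rep \<Rightarrow> bool" where
  "admissible G T \<rho> \<longleftrightarrow> smooth G T \<rho> \<and>
     (\<forall>c\<in>Irr G T. multiplicity_rep G (representative c) \<rho> < \<infinity>)"

text \<open>A sum of extended natural numbers, possibly with infinitely many nonzero terms.\<close>

definition R_count ::
    "('g, 'm) monoid_scheme \<Rightarrow> 'g topology \<Rightarrow> nat \<Rightarrow> ('g, 'w::ab_group_add) rep \<Rightarrow> enat" where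
  "R_count G T d \<rho> =
     (\<Sum>\<^sub>\<infinity>c\<in>{c \<in> Irr G T. degree_rep (representative c) \<le> enat d}.
        multiplicity_rep G (representative c) \<rho>)"

definition strongly_admissible ::
    "('g, 'm) monoid_scheme \<Rightarrow> 'g topology \<Rightarrow> ('g, 'w::ab_group_add) rep \<Rightarrow> bool" where
  "strongly_admissible G T \<rho> \<longleftrightarrow> admissible G T \<rho> \<and> (\<forall>d. R_count G T d \<rho> < \<infinity>)"


section \<open>Induction\<close>

text \<open>Functions on the group are extended by \<open>0\<close> off \<open>carrier G\<close>.\<close>

definition locally_constant_on ::
    "('g, 'm) monoid_scheme \<Rightarrow> 'g topology \<Rightarrow> ('g \<Rightarrow> 'w) \<Rightarrow> bool" where
  "locally_constant_on G T f \<longleftrightarrow>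
     (\<forall>x\<in>carrier G. \<exists>U. openin T U \<and> x \<in> U \<and> (\<forall>y\<in>U. f y = f x))"

definition Ind :: "('g, 'm) monoid_scheme \<Rightarrow> 'g topology \<Rightarrow> 'g set \<Rightarrow>
    ('g, 'w::ab_group_add) rep \<Rightarrow> ('g, 'g \<Rightarrow> 'w) rep" where
  "Ind G T H \<sigma> =
     \<lparr>rep_scale = pointwise_scale (rep_scale \<sigma>),
      rep_space = {f. (\<forall>x\<in>carrier G. f x \<in> rep_space \<sigma>) \<and> (\<forall>x. x \<notin> carrier G \<longrightarrow> f x = 0) \<and>
                  locally_constant_on G T f \<and>
                  (\<forall>h\<in>H. \<forall>x\<in>carrier G. f (h \<otimes>\<^bsub>G\<^esub> x) = rep_act \<sigma> h (f x))},
      rep_act = (\<lambda>g f x. if x \<in> carrier G then f (x \<otimes>\<^bsub>G\<^esub> g) else 0)\<rparr>"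

definition trivial_rep :: "('g, complex) rep" where
  "trivial_rep = \<lparr>rep_scale = (*), rep_space = UNIV, rep_act = (\<lambda>g v. v)\<rparr>"

end

theory Submission
  imports Defs
begin

text \<open>
  By Frobenius reciprocity, \<open>R\<^sub>d(Ind \<sigma>)\<close> is the sum of \<open>dim Hom\<^sub>H(\<pi>, \<sigma>)\<close> over the irreducible \<open>\<pi>\<close> of
  degree at most \<open>d\<close>.  By Jordan's theorem on finite linear groups, and since \<open>G\<close> has only finitely
  many open subgroups of bounded index, a single open subgroup \<open>K\<close> acts through abelian groups on
  all these \<open>\<pi>\<close>.  If \<open>Hom\<^sub>H(\<pi>, \<sigma>) \<noteq> 0\<close>, then \<open>\<pi>\<close> shares with \<open>\<sigma>\<close> one of finitely many irreducible
  constituents over \<open>H\<close>, hence contains one of finitely many characters of \<open>H \<inter> K\<close>, and so a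
  character of \<open>K\<close> that extends it.  Two such extensions differ by a character of
  \<open>K / (H \<inter> K)[K, K]\<close>; if this quotient is finite, only finitely many characters of \<open>K\<close>, and
  hence only finitely many \<open>\<pi>\<close>, occur.

  Conversely, a character \<open>\<theta>\<close> of \<open>K\<close> that is trivial on \<open>H \<inter> K\<close> gives the function
  \<open>h k \<mapsto> \<theta> k\<close> on \<open>H K\<close>, which lies in the representation induced from the trivial one and generates
  a subrepresentation of dimension at most the index of \<open>K\<close>.  So strong admissibility leaves only
  finitely many such \<open>\<theta>\<close>, and these separate the points of \<open>K / (H \<inter> K)[K, K]\<close>.
\<close>

section \<open>Profinite groups\<close>

text \<open>Representations of bounded degree can have images of unbounded order, so in general no
  open subgroup acts trivially on all of them. Jordan's bound depends on the degree alone and offers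
  instead one open \<open>K\<close> acting by commuting operators. The weights of \<open>K\<close>
  then stand in for the representations: an irreducible one with weight \<open>\<theta>\<close>
  embeds into \<open>Ind G T K (char_rep \<theta>)\<close>, which is finite-dimensional, so a single
  weight belongs to finitely many classes only. The linear algebra rests on one consequence of
  smoothness: a finite-dimensional smooth representation has only finitely many operators.
  Eigenvectors then come from finite Fourier sums, invariant inner products and complements from
  averaging, and Jordan's theorem from a sequence of commutators that must repeat. Statement (b)
  speaks of representations on one fixed type \<open>'w\<close>, statement (c) of the complex
  numbers. Both lead back to (a) through \<open>line_rep\<close>, the trivial representation on a
  line in an arbitrary complex vector space.\<close>

lemma (in group) rcoset_eq_iff:
  assumes "subgroup U G" "x \<in> carrier G" "y \<in> carrier G"
  shows "U #> x = U #> y \<longleftrightarrow> x \<otimes> inv y \<in> U"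
  by (metis assms group.repr_independence is_group rcos_self subgroup.rcos_module)

context topological_group
begin

lemma continuous_left_mult:
  assumes "g \<in> carrier G"
  shows "continuous_map T T (\<lambda>x. g \<otimes> x)"
proof -
  have "continuous_map T (prod_topology T T) (\<lambda>x. (g, x))"
    using assms topspace_eq by (intro continuous_map_pairedI) auto
  from continuous_map_compose[OF this continuous_mult] show ?thesis
    by (simp add: o_def)
qed

lemma continuous_right_mult:
  assumes "g \<in> carrier G"
  shows "continuous_map T T (\<lambda>x. x \<otimes> g)"
proof -
  have "continuous_map T (prod_topology T T) (\<lambda>x. (x, g))"
    using assms topspace_eq by (intro continuous_map_pairedI) auto
  from continuous_map_compose[OF this continuous_mult] show ?thesis
    by (simp add: o_def)
qed

lemma openin_left_preimage:
  "g \<in> carrier G \<Longrightarrow> openin T W \<Longrightarrow> openin T {x \<in> carrier G. g \<otimes> x \<in> W}"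
  using openin_continuous_map_preimage[OF continuous_left_mult] topspace_eq by auto

lemma openin_right_preimage:
  "g \<in> carrier G \<Longrightarrow> openin T W \<Longrightarrow> openin T {x \<in> carrier G. x \<otimes> g \<in> W}"
  using openin_continuous_map_preimage[OF continuous_right_mult] topspace_eq by auto

lemma openin_carrier: "openin T W \<Longrightarrow> W \<subseteq> carrier G"
  using openin_subset topspace_eq by auto

text \<open>Translating \<open>W\<close> by \<open>x\<close> gives a neighbourhood of
  \<open>x\<close> inside \<open>U\<close>, so one neighbourhood of the identity suffices.\<close>

lemma open_subgroupI:
  assumes U: "subgroup U G" and W: "openin T W" "\<one> \<in> W" "W \<subseteq> U"
  shows "open_subgroup U G T"
proof -
  have "\<exists>A. openin T A \<and> x \<in> A \<and> A \<subseteq> U" if "x \<in> U" for x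
  proof (intro exI conjI)
    have x: "x \<in> carrier G"
      using subgroup.mem_carrier[OF U that] .
    show "openin T {y \<in> carrier G. inv x \<otimes> y \<in> W}"
      using openin_left_preimage W(1) x by simp
    show "x \<in> {y \<in> carrier G. inv x \<otimes> y \<in> W}"
      using W x by simp
    show "{y \<in> carrier G. inv x \<otimes> y \<in> W} \<subseteq> U"
    proof clarify
      fix y assume y: "y \<in> carrier G" "inv x \<otimes> y \<in> W"
      then have "x \<otimes> (inv x \<otimes> y) \<in> U"
        using U W(3) that by (meson subgroup.m_closed subsetD)
      then show "y \<in> U"
        using x y by (simp add: m_assoc[symmetric])
    qed
  qed
  then have "openin T U"
    by (metis openin_subopen)
  then show ?thesis
    using U by (simp add: open_subgroup_def)
qed

lemma openin_rcoset:
  assumes "open_subgroup U G T" "x \<in> carrier G"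
  shows "openin T (U #> x)"
proof -
  have U: "subgroup U G" "openin T U"
    using assms by (auto simp: open_subgroup_def)
  have "U #> x = {y \<in> carrier G. y \<otimes> inv x \<in> U}"
    using subgroup.rcos_module[OF U(1) is_group assms(2)]
      subgroup.elemrcos_carrier[OF U(1) is_group assms(2)] by blast
  then show ?thesis
    using openin_right_preimage[of "inv x" U] U assms by simp
qed

text \<open>The complement is a union of cosets, each of them open.\<close>

lemma closedin_open_subgroup:
  assumes "open_subgroup U G T"
  shows "closedin T U"
proof -
  have U: "subgroup U G"
    using assms by (auto simp: open_subgroup_def)
  have "carrier G - U = \<Union>{U #> x |x. x \<in> carrier G - U}"
  proof (intro equalityI subsetI)
    fix y assume "y \<in> \<Union>{U #> x |x. x \<in> carrier G - U}"
    then obtain x where x: "x \<in> carrier G" "x \<notin> U" "y \<in> U #> x"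
      by blast
    then have y: "y \<in> carrier G" "U #> x = U #> y"
      using U subgroup.elemrcos_carrier[OF U is_group] repr_independence by auto
    moreover have "y \<notin> U"
      using x y U by (metis coset_join2 rcos_self)
    ultimately show "y \<in> carrier G - U"
      by simp
  qed (use rcos_self U in auto)
  moreover have "openin T (\<Union>{U #> x |x. x \<in> carrier G - U})"
    using openin_rcoset[OF assms] by (intro openin_Union) auto
  ultimately show ?thesis
    unfolding closedin_def topspace_eq using subgroup.subset[OF U] by metis
qed

end

section \<open>Compactness and total disconnectedness\<close>

context profinite_group
begin

text \<open>Cosets are open and pairwise disjoint, so a finite subcover of the carrier must contain
  every one of them.\<close>

lemma finite_rcosets_open_subgroup:
  assumes "open_subgroup U G T"
  shows "finite (rcosets U)"
proof -
  have U: "subgroup U G"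
    using assms by (auto simp: open_subgroup_def)
  have "\<forall>C\<in>rcosets U. openin T C"
    using openin_rcoset[OF assms] by (auto simp: RCOSETS_def)
  moreover have "topspace T \<subseteq> \<Union>(rcosets U)"
    using rcosets_part_G[OF U] topspace_eq by simp
  ultimately obtain F where F: "finite F" "F \<subseteq> rcosets U" "carrier G \<subseteq> \<Union>F"
    using compact topspace_eq unfolding compact_space_alt by metis
  have "rcosets U \<subseteq> F"
  proof
    fix C assume C: "C \<in> rcosets U"
    then obtain x where x: "x \<in> carrier G" "C = U #> x"
      by (auto simp: RCOSETS_def)
    then obtain D where D: "D \<in> F" "x \<in> D"
      using F(3) by auto
    then obtain y where "y \<in> carrier G" "D = U #> y"
      using F(2) by (auto simp: RCOSETS_def)
    then have "D = C"
      using x D U repr_independence by metis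
    then show "C \<in> F"
      using D by simp
  qed
  then show ?thesis
    using F finite_subset by auto
qed

text \<open>A tube argument: local constancy on a compact group is uniform.\<close>

lemma open_stabilizer_locally_constant:
  assumes "locally_constant_on G T f"
  shows "open_subgroup {g \<in> carrier G. \<forall>x\<in>carrier G. f (x \<otimes> g) = f x} G T"
proof -
  let ?S = "{g \<in> carrier G. \<forall>x\<in>carrier G. f (x \<otimes> g) = f x}"
  have "\<exists>A B. openin T A \<and> openin T B \<and> x \<in> A \<and> \<one> \<in> B \<and>
      (\<forall>a\<in>A. \<forall>b\<in>B. f (a \<otimes> b) = f x)" if x: "x \<in> carrier G" for x
  proof -
    obtain W where W: "openin T W" "x \<in> W" "\<forall>y\<in>W. f y = f x"
      using assms x by (auto simp: locally_constant_on_def)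
    let ?P = "{p \<in> topspace (prod_topology T T). (\<lambda>(x, y). x \<otimes> y) p \<in> W}"
    have "openin (prod_topology T T) ?P"
      using openin_continuous_map_preimage[OF continuous_mult W(1)] .
    moreover have "(x, \<one>) \<in> ?P"
      using x W(2) topspace_eq by simp
    ultimately obtain A B where AB: "openin T A" "openin T B" "x \<in> A" "\<one> \<in> B" "A \<times> B \<subseteq> ?P"
      unfolding openin_prod_topology_alt by meson
    have "f (a \<otimes> b) = f x" if "a \<in> A" "b \<in> B" for a b
    proof -
      have "(a, b) \<in> ?P"
        using AB(5) that by blast
      then show ?thesis
        using W(3) by auto
    qed
    then show ?thesis
      using AB by blast
  qed
  then obtain A B where AB: "\<And>x. x \<in> carrier G \<Longrightarrow> openin T (A x) \<and> openin T (B x) \<and> x \<in> A x \<and> \<one> \<in> B x \<and>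
      (\<forall>a\<in>A x. \<forall>b\<in>B x. f (a \<otimes> b) = f x)"
    by metis
  have "\<forall>W\<in>A ` carrier G. openin T W" "topspace T \<subseteq> \<Union>(A ` carrier G)"
    using AB topspace_eq by auto
  then obtain F where F: "finite F" "F \<subseteq> A ` carrier G" "carrier G \<subseteq> \<Union>F"
    using compact topspace_eq unfolding compact_space_alt by metis
  then obtain Y where Y: "finite Y" "Y \<subseteq> carrier G" "F = A ` Y"
    by (meson finite_subset_image)
  \<comment> \<open>Any \<open>y\<close> lies in \<open>A x\<close> for one of the finitely many
    centres \<open>x\<close>, and for \<open>g\<close> in this set both \<open>y \<otimes> g\<close>
    and \<open>y \<otimes> \<one>\<close> then have the value \<open>f x\<close>.\<close>
  let ?W = "carrier G \<inter> (\<Inter>x\<in>Y. B x)"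
  have "openin T ?W"
  proof (cases "Y = {}")
    case True
    then show ?thesis using topspace_eq openin_topspace[of T] by simp
  next
    case False
    then have "openin T (\<Inter>(B ` Y))"
      using Y AB by (intro openin_Inter) auto
    then show ?thesis
      using topspace_eq openin_topspace[of T] by (metis openin_Int)
  qed
  moreover have "\<one> \<in> ?W"
    using Y AB by auto
  moreover have "?W \<subseteq> ?S"
  proof clarify
    fix g y assume g: "g \<in> carrier G" "g \<in> (\<Inter>x\<in>Y. B x)" and y: "y \<in> carrier G"
    obtain x where x: "x \<in> Y" "y \<in> A x"
      using F(3) Y(3) y by auto
    then have x': "x \<in> carrier G"
      using Y(2) by auto
    then have "f (y \<otimes> g) = f x" "f (y \<otimes> \<one>) = f x"
      using AB[OF x'] g x by blast+
    then show "f (y \<otimes> g) = f y"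
      using y by simp
  qed
  moreover have "subgroup ?S G"
  proof
    fix a b assume ab: "a \<in> ?S" "b \<in> ?S"
    have "f (x \<otimes> (a \<otimes> b)) = f x" if "x \<in> carrier G" for x
    proof -
      have "f (x \<otimes> (a \<otimes> b)) = f ((x \<otimes> a) \<otimes> b)"
        using ab that by (simp add: m_assoc)
      then show ?thesis
        using ab that by simp
    qed
    then show "a \<otimes> b \<in> ?S"
      using ab by simp
  next
    fix a assume a: "a \<in> ?S"
    have "f (x \<otimes> inv a) = f x" if "x \<in> carrier G" for x
    proof -
      have "f ((x \<otimes> inv a) \<otimes> a) = f (x \<otimes> inv a)"
        using a that by auto
      then show ?thesis
        using a that by (simp add: m_assoc)
    qed
    then show "inv a \<in> ?S"
      using a by simp
  qed auto
  ultimately show ?thesis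
    using open_subgroupI by blast
qed

text \<open>In a compact Hausdorff space the quasi-components are the connected components, here
  single points, so a clopen set separates \<open>x\<close> from each point outside
  \<open>W\<close>. Finitely many of these sets suffice, the complement of \<open>W\<close> being
  compact.\<close>

lemma clopen_neighbourhood:
  assumes W: "openin T W" and x: "x \<in> W"
  obtains V where "openin T V" "closedin T V" "x \<in> V" "V \<subseteq> W"
proof -
  have xG: "x \<in> carrier G"
    using W x openin_carrier by auto
  have sep: "\<exists>C. openin T C \<and> closedin T C \<and> x \<in> C \<and> y \<notin> C" if "y \<in> carrier G - W" for y
  proof -
    have "\<not> connected_component_of T x y"
    proof
      assume "connected_component_of T x y"
      then obtain C where "connectedin T C" "x \<in> C" "y \<in> C"
        unfolding connected_component_of_def by blast
      then have "x = y"
        using totally_disconnected by blast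
      then show False
        using that x by auto
    qed
    then have "\<not> quasi_component_of T x y"
      using quasi_eq_connected_component_of[of T x] compact Hausdorff by simp
    then show ?thesis
      using xG that topspace_eq by (auto simp: quasi_component_of)
  qed
  then obtain C where C: "\<And>y. y \<in> carrier G - W \<Longrightarrow> openin T (C y) \<and> closedin T (C y) \<and> x \<in> C y \<and> y \<notin> C y"
    by metis
  have "compactin T (carrier G - W)"
    using closedin_compact_space[OF compact, of "carrier G - W"] W topspace_eq
    by (metis closedin_diff closedin_topspace)
  moreover have "\<forall>D\<in>(\<lambda>y. carrier G - C y) ` (carrier G - W). openin T D"
    using C topspace_eq by (metis (no_types, lifting) imageE openin_diff openin_topspace)
  moreover have "carrier G - W \<subseteq> \<Union>((\<lambda>y. carrier G - C y) ` (carrier G - W))"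
    using C by auto
  ultimately obtain F where F: "finite F" "F \<subseteq> (\<lambda>y. carrier G - C y) ` (carrier G - W)"
      "carrier G - W \<subseteq> \<Union>F"
    unfolding compactin_def by meson
  then obtain Y where Y: "finite Y" "Y \<subseteq> carrier G - W" "F = (\<lambda>y. carrier G - C y) ` Y"
    by (meson finite_subset_image)
  let ?V = "\<Inter>(insert (carrier G) (C ` Y))"
  have "openin T (carrier G)" "closedin T (carrier G)"
    using openin_topspace[of T] closedin_topspace[of T] topspace_eq by simp_all
  then have D: "openin T D \<and> closedin T D" if "D \<in> insert (carrier G) (C ` Y)" for D
    using that Y(2) C by blast
  have "openin T ?V"
    by (rule openin_Inter) (use D Y(1) in auto)
  moreover have "closedin T ?V"
    by (rule closedin_Inter) (use D in auto)
  moreover have "x \<in> ?V"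
    using C Y xG by auto
  moreover have "?V \<subseteq> W"
    using F(3) Y by auto
  ultimately show ?thesis
    using that by blast
qed

text \<open>The indicator function of a clopen \<open>V\<close> inside \<open>W\<close> is locally
  constant. Its stabiliser under right translation is open, and elements of it cannot move
  \<open>x\<close> out of \<open>V\<close>.\<close>

lemma open_subgroup_translate_subset:
  assumes W: "openin T W" and x: "x \<in> W"
  obtains U where "open_subgroup U G T" "\<And>u. u \<in> U \<Longrightarrow> x \<otimes> u \<in> W"
proof -
  obtain V where V: "openin T V" "closedin T V" "x \<in> V" "V \<subseteq> W"
    using clopen_neighbourhood[OF W x] by blast
  have xG: "x \<in> carrier G"
    using W x openin_carrier by auto
  have "locally_constant_on G T (\<lambda>x. x \<in> V)"
    unfolding locally_constant_on_def
  proof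
    fix y assume y: "y \<in> carrier G"
    have "openin T (carrier G - V)"
      using V(2) topspace_eq by (metis openin_diff openin_topspace)
    then show "\<exists>U. openin T U \<and> y \<in> U \<and> (\<forall>z\<in>U. (z \<in> V) = (y \<in> V))"
      using V(1) y by (metis DiffE DiffI)
  qed
  then have "open_subgroup {g \<in> carrier G. \<forall>x\<in>carrier G. (x \<otimes> g \<in> V) = (x \<in> V)} G T"
    by (rule open_stabilizer_locally_constant)
  moreover have "x \<otimes> u \<in> W" if "u \<in> {g \<in> carrier G. \<forall>x\<in>carrier G. (x \<otimes> g \<in> V) = (x \<in> V)}" for u
    using that V xG by auto
  ultimately show ?thesis
    using that by blast
qed

text \<open>An open subgroup of index at most \<open>n\<close> is recovered from the permutation action of
  finitely many topological generators on its (numbered) cosets.\<close>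

lemma finite_open_subgroups_index_le:
  assumes "topologically_fg G T"
  shows "finite {U. open_subgroup U G T \<and> card (rcosets U) \<le> n}" (is "finite ?\<U>")
proof -
  obtain S0 where S0: "finite S0" "S0 \<subseteq> carrier G" "T closure_of (generate G S0) = carrier G"
    using assms by (auto simp: topologically_fg_def)
  define S where "S = S0 \<union> (\<lambda>x. inv x) ` S0"
  have S: "finite S" "S \<subseteq> carrier G"
    using S0 by (auto simp: S_def)
  have "\<forall>U\<in>?\<U>. \<exists>e. inj_on e (rcosets U) \<and> e ` (rcosets U) \<subseteq> {..<n}"
  proof
    fix U assume "U \<in> ?\<U>"
    then have "finite (rcosets U)" "card (rcosets U) \<le> card {..<n}"
      using finite_rcosets_open_subgroup by auto
    from card_le_inj[OF this(1) finite_lessThan this(2)]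
    show "\<exists>e. inj_on e (rcosets U) \<and> e ` (rcosets U) \<subseteq> {..<n}"
      by blast
  qed
  from bchoice[OF this] obtain e where e: "\<And>U. U \<in> ?\<U> \<Longrightarrow> inj_on (e U) (rcosets U)"
      "\<And>U. U \<in> ?\<U> \<Longrightarrow> e U ` (rcosets U) \<subseteq> {..<n}"
    by blast
  \<comment> \<open>The number of the trivial coset is recorded too, because an element lies in
    \<open>U\<close> exactly when it fixes that coset.\<close>
  define code where "code U = (e U U, {(s, e U C, e U (C #> s)) |s C. s \<in> S \<and> C \<in> rcosets U})" for U
  have rc: "C #> s \<in> rcosets U" if U: "U \<in> ?\<U>" and C: "C \<in> rcosets U" and s: "s \<in> carrier G" for U C s
  proof -
    obtain x where x: "x \<in> carrier G" "C = U #> x"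
      using C unfolding RCOSETS_def by blast
    then have "C #> s = U #> (x \<otimes> s)"
      using U s by (auto simp: open_subgroup_def coset_mult_assoc subgroup.subset)
    then show ?thesis
      using x U s rcosetsI by (auto simp: open_subgroup_def subgroup.subset)
  qed
  have rcc: "C \<subseteq> carrier G" if "U \<in> ?\<U>" "C \<in> rcosets U" for U C
    using that subgroup.rcosets_carrier[OF _ is_group, of U C] unfolding open_subgroup_def by blast
  have Urc: "U \<in> rcosets U" if "U \<in> ?\<U>" for U
    using that subgroup.subgroup_in_rcosets[OF _ is_group] by (auto simp: open_subgroup_def)
  have "code ` ?\<U> \<subseteq> {..<n} \<times> Pow (S \<times> {..<n} \<times> {..<n})"
  proof (intro image_subsetI)
    fix U assume U: "U \<in> ?\<U>"
    have *: "e U C < n" if "C \<in> rcosets U" for C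
      using e(2)[OF U] that by auto
    show "code U \<in> {..<n} \<times> Pow (S \<times> {..<n} \<times> {..<n})"
      using S(2) * rc[OF U] Urc[OF U] unfolding code_def by auto
  qed
  then have fin: "finite (code ` ?\<U>)"
    using S(1) by (meson finite_Pow_iff finite_SigmaI finite_lessThan finite_subset)
  have sub: "U \<subseteq> U'" if U: "U \<in> ?\<U>" and U': "U' \<in> ?\<U>" and eq: "code U = code U'" for U U'
  proof -
    have step: "e U (C #> s) = e U' (C' #> s)"
      if s: "s \<in> S" and C: "C \<in> rcosets U" "C' \<in> rcosets U'" "e U C = e U' C'" for s C C'
    proof -
      have "(s, e U C, e U (C #> s)) \<in> snd (code U)"
        using s C(1) unfolding code_def snd_conv by blast
      then have "(s, e U C, e U (C #> s)) \<in> snd (code U')"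
        using eq by simp
      then obtain D where D: "D \<in> rcosets U'" "e U C = e U' D" "e U (C #> s) = e U' (D #> s)"
        by (auto simp: code_def)
      then have "D = C'"
        using e(1)[OF U'] C by (metis inj_onD)
      then show ?thesis
        using D by simp
    qed
    have gen: "e U (C #> w) = e U' (C' #> w)"
      if "w \<in> generate G S0" "C \<in> rcosets U" "C' \<in> rcosets U'" "e U C = e U' C'" for w C C'
      using that
    proof (induction arbitrary: C C' rule: generate.induct)
      case one
      then show ?case
        using rcc[OF U] rcc[OF U'] by (simp add: coset_mult_one)
    next
      case (incl h)
      then show ?case using step by (auto simp: S_def)
    next
      case (inv h)
      then show ?case using step by (auto simp: S_def)
    next
      case (eng h1 h2)
      have h: "h1 \<in> carrier G" "h2 \<in> carrier G"
        using eng generate_in_carrier[OF S0(2)] by auto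
      have CG: "C \<subseteq> carrier G" "C' \<subseteq> carrier G"
        using rcc[OF U] rcc[OF U'] eng.prems by auto
      have "e U ((C #> h1) #> h2) = e U' ((C' #> h1) #> h2)"
        using eng h rc[OF U] rc[OF U'] by blast
      then show ?case
        using h CG by (simp add: coset_mult_assoc)
    qed
    have int: "U \<inter> generate G S0 \<subseteq> U'"
    proof clarify
      fix w assume w: "w \<in> U" "w \<in> generate G S0"
      have wG: "w \<in> carrier G"
        using w generate_in_carrier[OF S0(2)] by auto
      have "e U (U #> w) = e U' (U' #> w)"
        using gen[OF w(2)] Urc[OF U] Urc[OF U'] eq by (simp add: code_def)
      moreover have "U #> w = U"
        using w U coset_join2[OF wG] by (auto simp: open_subgroup_def)
      ultimately have "e U' (U' #> w) = e U' U'"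
        using eq by (simp add: code_def)
      then have "U' #> w = U'"
        using e(1)[OF U'] rc[OF U' Urc[OF U'] wG] Urc[OF U'] by (meson inj_onD)
      then show "w \<in> U'"
        using U' wG by (metis (mono_tags, lifting) mem_Collect_eq open_subgroup_def rcos_self)
    qed
    \<comment> \<open>Equal codes control only the dense subgroup \<open>generate G S0\<close>. Its
      intersection with the open \<open>U\<close> is dense in \<open>U\<close>, and
      \<open>U'\<close> is closed.\<close>
    have "U \<subseteq> U \<inter> T closure_of (generate G S0)"
      using U S0(3) subgroup.subset by (auto simp: open_subgroup_def)
    also have "\<dots> \<subseteq> T closure_of (U \<inter> generate G S0)"
      using U openin_Int_closure_of_subset by (auto simp: open_subgroup_def)
    also have "\<dots> \<subseteq> U'"
      using closure_of_minimal[OF int] closedin_open_subgroup U' by auto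
    finally show ?thesis .
  qed
  have "inj_on code ?\<U>"
    by (intro inj_onI equalityI sub) auto
  then show ?thesis
    using fin finite_imageD by blast
qed

lemma open_subgroup_Inter_index_le:
  assumes "topologically_fg G T"
  obtains K where "open_subgroup K G T"
    "\<And>U. open_subgroup U G T \<Longrightarrow> card (rcosets U) \<le> n \<Longrightarrow> K \<subseteq> U"
proof -
  \<comment> \<open>For \<open>n = 0\<close> the set of subgroups is empty; adding
    \<open>carrier G\<close> keeps its intersection from being the whole type.\<close>
  let ?F = "insert (carrier G) {U. open_subgroup U G T \<and> card (rcosets U) \<le> n}"
  have car: "open_subgroup (carrier G) G T"
    using subgroup_self topspace_eq openin_topspace by (metis open_subgroup_def)
  have "openin T (\<Inter>?F)"
    using finite_open_subgroups_index_le[OF assms] car by (intro openin_Inter) (auto simp: open_subgroup_def)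
  moreover have "subgroup (\<Inter>?F) G"
    using car by (intro subgroups_Inter) (auto simp: open_subgroup_def)
  ultimately have "open_subgroup (\<Inter>?F) G T"
    by (simp add: open_subgroup_def)
  then show ?thesis
    by (rule that) auto
qed

end

section \<open>Finite-dimensional representations\<close>

context vector_space
begin

text \<open>A basis of \<open>U\<close> stays independent after adding a vector of \<open>W\<close>
  outside \<open>U\<close>. The ambient space may be infinite-dimensional, so a finite spanning set
  is asked for \<open>W\<close> alone.\<close>

lemma fd_dim_psubset:
  assumes U: "subspace U" "U \<subset> W" and F: "finite F" "W \<subseteq> span F"
  shows "dim U < dim W"
proof -
  obtain A where A: "A \<subseteq> U" "independent A" "U \<subseteq> span A" "card A = dim U"
    using basis_exists by metis
  obtain D where D: "D \<subseteq> W" "independent D" "W \<subseteq> span D" "card D = dim W"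
    using basis_exists by metis
  obtain x where x: "x \<in> W" "x \<notin> U"
    using U by blast
  have "span A = U"
    using A U by (simp add: span_subspace)
  then have ind: "independent (insert x A)"
    using x A independent_insertI by simp
  have finD: "finite D"
    using independent_span_bound[OF F(1) D(2)] D(1) F(2) by blast
  have "insert x A \<subseteq> span D"
    using x A D U by blast
  then have "finite (insert x A)" "card (insert x A) \<le> card D"
    using independent_span_bound[OF finD ind] by auto
  moreover have "x \<notin> A"
    using A x by blast
  ultimately show ?thesis
    using A D by simp
qed

end

definition invariant_subspace ::
    "('g, 'm) monoid_scheme \<Rightarrow> ('g, 'v::ab_group_add) rep \<Rightarrow> 'v set \<Rightarrow> bool" where
  "invariant_subspace G \<rho> U \<longleftrightarrow> module.subspace (rep_scale \<rho>) U \<and> U \<subseteq> rep_space \<rho> \<and>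
     (\<forall>g\<in>carrier G. \<forall>u\<in>U. rep_act \<rho> g u \<in> U)"

locale lin_rep = group G for G :: "('g, 'm) monoid_scheme" (structure) +
  fixes \<rho> :: "('g, 'v::ab_group_add) rep"
  assumes rep: "representation G \<rho>"
begin

abbreviation "V \<equiv> rep_space \<rho>"
abbreviation "act \<equiv> rep_act \<rho>"
abbreviation scl (infixr "\<star>" 75) where "scl \<equiv> rep_scale \<rho>"

sublocale vs: vector_space "rep_scale \<rho>"
  using rep by (simp add: representation_def)

lemma subspace_V: "vs.subspace V"
  using rep by (simp add: representation_def)

lemma act_closed [simp]: "g \<in> carrier G \<Longrightarrow> v \<in> V \<Longrightarrow> act g v \<in> V"
  using rep by (simp add: representation_def)

lemma act_add [simp]: "g \<in> carrier G \<Longrightarrow> v \<in> V \<Longrightarrow> w \<in> V \<Longrightarrow> act g (v + w) = act g v + act g w"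
  using rep by (simp add: representation_def)

lemma act_scale [simp]: "g \<in> carrier G \<Longrightarrow> v \<in> V \<Longrightarrow> act g (c \<star> v) = c \<star> act g v"
  using rep by (simp add: representation_def)

lemma act_one [simp]: "v \<in> V \<Longrightarrow> act \<one> v = v"
  using rep by (simp add: representation_def)

lemma act_mult: "g \<in> carrier G \<Longrightarrow> h \<in> carrier G \<Longrightarrow> v \<in> V \<Longrightarrow> act (g \<otimes> h) v = act g (act h v)"
  using rep by (simp add: representation_def)

lemma V_zero [simp]: "0 \<in> V"
  and V_add [simp]: "v \<in> V \<Longrightarrow> w \<in> V \<Longrightarrow> v + w \<in> V"
  and V_diff [simp]: "v \<in> V \<Longrightarrow> w \<in> V \<Longrightarrow> v - w \<in> V"
  and V_scale [simp]: "v \<in> V \<Longrightarrow> c \<star> v \<in> V"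
  using subspace_V vs.subspace_0 vs.subspace_add vs.subspace_diff vs.subspace_scale by blast+

lemma V_sum [simp]: "(\<And>i. i \<in> I \<Longrightarrow> f i \<in> V) \<Longrightarrow> sum f I \<in> V"
  using subspace_V vs.subspace_sum by blast

lemma act_zero [simp]: "g \<in> carrier G \<Longrightarrow> act g 0 = 0"
  using act_scale[of g 0 0] by simp

lemma act_diff [simp]:
  assumes "g \<in> carrier G" "v \<in> V" "w \<in> V"
  shows "act g (v - w) = act g v - act g w"
  using act_add[of g "v - w" w] assms by (simp add: eq_diff_eq)

lemma act_sum:
  assumes "g \<in> carrier G" "finite I" "\<And>i. i \<in> I \<Longrightarrow> f i \<in> V"
  shows "act g (\<Sum>i\<in>I. f i) = (\<Sum>i\<in>I. act g (f i))"
  using assms(2,3) by (induction I rule: finite_induct) (use assms(1) in auto)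

lemma act_inv_act [simp]: "g \<in> carrier G \<Longrightarrow> v \<in> V \<Longrightarrow> act (inv g) (act g v) = v"
  by (simp flip: act_mult)

lemma act_act_inv [simp]: "g \<in> carrier G \<Longrightarrow> v \<in> V \<Longrightarrow> act g (act (inv g) v) = v"
  by (simp flip: act_mult)

lemma act_eq_iff: "g \<in> carrier G \<Longrightarrow> v \<in> V \<Longrightarrow> w \<in> V \<Longrightarrow> act g v = act g w \<longleftrightarrow> v = w"
  by (metis act_inv_act)

lemma invariant_subspace_V: "invariant_subspace G \<rho> V"
  using subspace_V by (simp add: invariant_subspace_def)

lemma lin_rep_subrep:
  assumes "invariant_subspace G \<rho> U"
  shows "lin_rep G (\<rho>\<lparr>rep_space := U\<rparr>)"
proof
  have U: "u \<in> V" if "u \<in> U" for u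
    using assms that by (auto simp: invariant_subspace_def)
  show "representation G (\<rho>\<lparr>rep_space := U\<rparr>)"
    unfolding representation_def using assms vs.vector_space_axioms
    by (auto simp: invariant_subspace_def act_mult U)
qed

lemma lin_rep_subgroup:
  assumes "subgroup A G"
  shows "lin_rep (G\<lparr>carrier := A\<rparr>) \<rho>"
proof -
  have "group (G\<lparr>carrier := A\<rparr>)"
    using assms subgroup_imp_group by auto
  moreover have "representation (G\<lparr>carrier := A\<rparr>) \<rho>"
    unfolding representation_def using vs.vector_space_axioms subspace_V subgroup.mem_carrier[OF assms]
    by (auto simp: act_mult)
  ultimately show ?thesis
    by (simp add: lin_rep_def lin_rep_axioms_def)
qed

text \<open>What commutes are the operators on \<open>V\<close>, not the group elements. The
  auxiliary claim passes from generators to generated elements in one argument, and is applied once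
  for each argument.\<close>

lemma generate_acts_commutatively:
  assumes S: "S \<subseteq> carrier G"
    and comm: "\<And>a b v. a \<in> S \<Longrightarrow> b \<in> S \<Longrightarrow> v \<in> V \<Longrightarrow> act a (act b v) = act b (act a v)"
    and a: "a \<in> generate G S" and b: "b \<in> generate G S" and v: "v \<in> V"
  shows "act a (act b v) = act b (act a v)"
proof -
  have *: "act x (act g v) = act g (act x v)"
    if x: "x \<in> carrier G" and comm: "\<And>s v. s \<in> S \<Longrightarrow> v \<in> V \<Longrightarrow> act x (act s v) = act s (act x v)"
      and g: "g \<in> generate G S" and "v \<in> V" for x g v
    using g \<open>v \<in> V\<close>
  proof (induction arbitrary: v rule: generate.induct)
    case (inv h)
    then have h: "h \<in> carrier G"
      using S by auto
    have "act h (act x (act (inv h) v)) = act h (act (inv h) (act x v))"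
      using comm[OF inv(1), of "act (inv h) v"] h x inv(2) by simp
    then have "act h (act x (act (inv h) v)) = act h (act (inv h) (act x v))"
      using h x inv(2) by simp
    then show ?case
      using h x inv(2) by (subst (asm) act_eq_iff) auto
  next
    case (eng h1 h2)
    then show ?case
      using generate_in_carrier[OF S] x by (simp add: act_mult)
  qed (use x comm in auto)
  have S_comm: "act s (act g v) = act g (act s v)" if "s \<in> S" "g \<in> generate G S" "v \<in> V" for s g v
    by (rule *) (use that S comm in auto)
  show ?thesis
    by (rule *) (simp_all add: a b v generate_in_carrier[OF S a] S_comm[OF _ a])
qed

end

lemma irreducible_rep_iff:
  "irreducible_rep G \<rho> \<longleftrightarrow> representation G \<rho> \<and> rep_space \<rho> \<noteq> {0} \<and>
     (\<forall>U. invariant_subspace G \<rho> U \<longrightarrow> U = {0} \<or> U = rep_space \<rho>)"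
  by (auto simp: irreducible_rep_def invariant_subspace_def)

text \<open>The operators are restricted to \<open>V\<close> because their values elsewhere are
  arbitrary and could make infinitely many of them differ.\<close>

locale fd_rep = lin_rep +
  assumes fin_dim: "\<exists>F. finite F \<and> V \<subseteq> vs.span F"
    and fin_im: "finite ((\<lambda>g. restrict (act g) V) ` carrier G)"
begin

lemma fd_rep_subrep:
  assumes "invariant_subspace G \<rho> U"
  shows "fd_rep G (\<rho>\<lparr>rep_space := U\<rparr>)"
proof -
  have U: "U \<subseteq> V"
    using assms by (simp add: invariant_subspace_def)
  have "(\<lambda>g. restrict (act g) U) ` carrier G = (\<lambda>f. restrict f U) ` (\<lambda>g. restrict (act g) V) ` carrier G"
    using U by (simp add: image_image Int_absorb2 Int_absorb1 restrict_restrict)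
  then have "finite ((\<lambda>g. restrict (act g) U) ` carrier G)"
    using fin_im by simp
  then show ?thesis
    using lin_rep_subrep[OF assms] fin_dim U by (auto simp: fd_rep_def fd_rep_axioms_def)
qed

lemma fd_rep_subgroup:
  assumes "subgroup A G"
  shows "fd_rep (G\<lparr>carrier := A\<rparr>) \<rho>"
proof -
  have "finite ((\<lambda>g. restrict (act g) V) ` A)"
    using fin_im subgroup.subset[OF assms] by (meson finite_subset image_mono)
  then show ?thesis
    using lin_rep_subgroup[OF assms] fin_dim by (simp add: fd_rep_def fd_rep_axioms_def)
qed

lemma dim_less:
  assumes "invariant_subspace G \<rho> U" "U \<subset> W" "W \<subseteq> V"
  shows "vs.dim U < vs.dim W"
proof -
  obtain F where "finite F" "V \<subseteq> vs.span F"
    using fin_dim by blast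
  then show ?thesis
    using assms vs.fd_dim_psubset[of U W F] by (auto simp: invariant_subspace_def)
qed

text \<open>A nonzero invariant subspace of least dimension is irreducible, by
  \<open>dim_less\<close>.\<close>

lemma irreducible_subrep_exists:
  assumes "V \<noteq> {0}"
  obtains W where "invariant_subspace G \<rho> W" "W \<noteq> {0}" "irreducible_rep G (\<rho>\<lparr>rep_space := W\<rparr>)"
proof -
  let ?P = "\<lambda>W. invariant_subspace G \<rho> W \<and> W \<noteq> {0}"
  obtain W where W: "?P W" and min: "\<And>U. ?P U \<Longrightarrow> vs.dim W \<le> vs.dim U"
    using exists_least_iff[of "\<lambda>n. \<exists>W. ?P W \<and> vs.dim W = n"] invariant_subspace_V assms
    by (metis not_le)
  have "irreducible_rep G (\<rho>\<lparr>rep_space := W\<rparr>)"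
    unfolding irreducible_rep_iff
  proof (intro conjI allI impI)
    show "representation G (\<rho>\<lparr>rep_space := W\<rparr>)"
      using lin_rep_subrep W lin_rep.rep by blast
    fix U assume "invariant_subspace G (\<rho>\<lparr>rep_space := W\<rparr>) U"
    then have U: "invariant_subspace G \<rho> U" "U \<subseteq> W"
      using W by (auto simp: invariant_subspace_def)
    show "U = {0} \<or> U = rep_space (\<rho>\<lparr>rep_space := W\<rparr>)"
    proof (rule ccontr)
      assume "\<not> ?thesis"
      then have "?P U" "U \<subset> W"
        using U by auto
      then show False
        using min[of U] dim_less[of U W] W by (auto simp: invariant_subspace_def)
    qed
  qed (use W in auto)
  then show ?thesis
    using that W by blast
qed

text \<open>By \<open>fin_im\<close> two powers of \<open>g\<close> give the same operator, and the
  smaller power cancels.\<close>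

lemma finite_order:
  assumes g: "g \<in> carrier G"
  obtains n where "n > 0" "\<And>v. v \<in> V \<Longrightarrow> act (g [^] (n::nat)) v = v"
proof -
  have "finite (range (\<lambda>k::nat. restrict (act (g [^] k)) V))"
    by (rule finite_subset[OF _ fin_im]) (use g in auto)
  then have "\<not> inj (\<lambda>k::nat. restrict (act (g [^] k)) V)"
    using finite_imageD by blast
  then obtain i j :: nat where ij: "i < j" "restrict (act (g [^] i)) V = restrict (act (g [^] j)) V"
    unfolding inj_def by (metis linorder_neqE_nat)
  have "act (g [^] (j - i)) v = v" if v: "v \<in> V" for v
  proof -
    have "act (g [^] i) (act (g [^] (j - i)) v) = act (g [^] j) v"
      using g v ij(1) by (simp flip: act_mult add: nat_pow_mult)
    also have "\<dots> = act (g [^] i) v"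
      using ij(2) v by (metis restrict_apply')
    finally show ?thesis
      using g v by (simp add: act_eq_iff)
  qed
  then show ?thesis
    using that[of "j - i"] ij(1) by simp
qed

text \<open>The spectral components of \<open>v\<close> under an operator of order \<open>n\<close> are discrete Fourier
  coefficients, and they add up to \<open>n\<close> times \<open>v\<close>.\<close>

lemma eigenvector_exists:
  assumes g: "g \<in> carrier G" and nz: "V \<noteq> {0}"
  obtains c v where "v \<in> V" "v \<noteq> 0" "act g v = c \<star> v"
proof -
  obtain n :: nat where n: "n > 0" "\<And>v. v \<in> V \<Longrightarrow> act (g [^] n) v = v"
    using finite_order[OF g] by blast
  obtain v where v: "v \<in> V" "v \<noteq> 0"
    using nz V_zero by blast
  \<comment> \<open>A primitive \<open>n\<close>-th root of unity; its primitivity is the fact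
    \<open>\<omega>k\<close>.\<close>
  define \<omega> where "\<omega> = exp (2 * of_real pi * \<i> * of_nat 1 / of_nat n)"
  have \<omega>n: "\<omega> ^ n = 1"
    unfolding \<omega>_def by (rule complex_root_unity) (use n in simp)
  have \<omega>0: "\<omega> \<noteq> 0"
    by (simp add: \<omega>_def)
  have \<omega>k: "\<omega> ^ k \<noteq> 1" if "0 < k" "k < n" for k
  proof
    assume "\<omega> ^ k = 1"
    then have "exp (2 * of_real pi * \<i> * of_nat k / of_nat n) = 1"
      by (simp add: \<omega>_def mult_ac flip: exp_of_nat_mult)
    then show False
      using complex_root_unity_eq_1[of n k] n that by (auto dest: dvd_imp_le)
  qed
  define w where "w j = (\<Sum>k<n. \<omega> ^ (j * k) \<star> act (g [^] k) v)" for j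
  have wV: "w j \<in> V" for j
    using g v by (simp add: w_def)
  have act_w: "act g (w j) = inverse (\<omega> ^ j) \<star> w j" for j
  proof -
    let ?f = "\<lambda>k. \<omega> ^ (j * k) \<star> act (g [^] k) v"
    have "act g (act (g [^] k) v) = act (g [^] Suc k) v" for k
      using g v nat_pow_Suc2[OF g, of k] act_mult[of g "g [^] k" v] by (simp del: nat_pow_Suc)
    then have "act g (w j) = (\<Sum>k<n. \<omega> ^ (j * k) \<star> act (g [^] Suc k) v)"
      unfolding w_def using g v by (simp add: act_sum del: nat_pow_Suc)
    also have "\<dots> = (\<Sum>k<n. inverse (\<omega> ^ j) \<star> ?f (Suc k))"
      using \<omega>0 by (intro sum.cong) (auto simp: power_add)
    also have "\<dots> = inverse (\<omega> ^ j) \<star> (\<Sum>k<n. ?f (Suc k))"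
      by (simp add: vs.scale_sum_right)
    \<comment> \<open>The shifted sum loses the term at 0 and gains the one at \<open>n\<close>;
      they agree because the \<open>n\<close>-th powers of \<open>\<omega>\<close> and of the
      operator are trivial.\<close>
    also have "(\<Sum>k<n. ?f (Suc k)) = w j"
    proof -
      have "(\<Sum>k<n. ?f (Suc k)) + ?f 0 = (\<Sum>k<n. ?f k) + ?f n"
        using sum.lessThan_Suc_shift[of ?f n] sum.lessThan_Suc[of ?f n] by (simp add: add.commute)
      moreover have "?f n = ?f 0"
        using n(2)[OF v(1)] \<omega>n v g by (simp add: power_mult mult.commute[of j])
      ultimately show ?thesis
        by (simp add: w_def)
    qed
    finally show ?thesis .
  qed
  \<comment> \<open>Interchanging the sums leaves geometric sums in \<open>\<omega> ^ k\<close>,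
    which vanish unless \<open>k = 0\<close>. The total is a nonzero multiple of \<open>v\<close>,
    so some \<open>w j\<close> is nonzero.\<close>
  have "(\<Sum>j<n. w j) = (\<Sum>k<n. (\<Sum>j<n. \<omega> ^ (j * k)) \<star> act (g [^] k) v)"
    unfolding w_def vs.scale_sum_left by (rule sum.swap)
  also have "\<dots> = (\<Sum>k<n. if k = 0 then of_nat n \<star> v else 0)"
  proof (rule sum.cong)
    fix k assume k: "k \<in> {..<n}"
    show "(\<Sum>j<n. \<omega> ^ (j * k)) \<star> act (g [^] k) v = (if k = 0 then of_nat n \<star> v else 0)"
    proof (cases "k = 0")
      case True
      then show ?thesis using v by simp
    next
      case False
      have "(\<Sum>j<n. \<omega> ^ (j * k)) = (\<Sum>j<n. (\<omega> ^ k) ^ j)"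
        by (simp add: mult.commute flip: power_mult)
      also have "\<dots> = ((\<omega> ^ k) ^ n - 1) / (\<omega> ^ k - 1)"
        by (rule geometric_sum) (use \<omega>k k False in auto)
      also have "(\<omega> ^ k) ^ n = 1"
        using \<omega>n by (metis mult.commute power_mult power_one)
      finally show ?thesis
        using False by simp
    qed
  qed simp
  also have "\<dots> = of_nat n \<star> v"
    using n(1) by simp
  finally have "(\<Sum>j<n. w j) \<noteq> 0"
    using v n by simp
  then obtain j where "w j \<noteq> 0"
    by (meson sum.neutral)
  then show ?thesis
    using that wV act_w by blast
qed

text \<open>Inside an irreducible \<open>W\<close>, an eigenspace of one operator is invariant
  because the operators commute, hence is all of \<open>W\<close>. So every operator is scalar on
  \<open>W\<close>, and any nonzero vector of \<open>W\<close> serves.\<close>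

lemma common_eigenvector:
  assumes comm: "\<And>a b v. a \<in> carrier G \<Longrightarrow> b \<in> carrier G \<Longrightarrow> v \<in> V \<Longrightarrow> act a (act b v) = act b (act a v)"
    and nz: "V \<noteq> {0}"
  obtains w where "w \<in> V" "w \<noteq> 0" "\<And>g. g \<in> carrier G \<Longrightarrow> \<exists>c. act g w = c \<star> w"
proof -
  obtain W where W: "invariant_subspace G \<rho> W" "W \<noteq> {0}" "irreducible_rep G (\<rho>\<lparr>rep_space := W\<rparr>)"
    using irreducible_subrep_exists[OF nz] by blast
  have WV: "v \<in> V" if "v \<in> W" for v
    using W that by (auto simp: invariant_subspace_def)
  have "\<exists>c. \<forall>v\<in>W. act g v = c \<star> v" if g: "g \<in> carrier G" for g
  proof -
    interpret W: fd_rep G "\<rho>\<lparr>rep_space := W\<rparr>"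
      by (rule fd_rep_subrep[OF W(1)])
    have "rep_space (\<rho>\<lparr>rep_space := W\<rparr>) \<noteq> {0}"
      using W(2) by simp
    then obtain c v where v: "v \<in> W" "v \<noteq> 0" "act g v = c \<star> v"
      by (rule W.eigenvector_exists[OF g]) auto
    let ?E = "{v \<in> W. act g v = c \<star> v}"
    have "invariant_subspace G (\<rho>\<lparr>rep_space := W\<rparr>) ?E"
      using W.V_zero W.V_add W.V_scale W.act_closed g comm[OF g] WV
      by (auto simp: invariant_subspace_def vs.subspace_def vs.scale_right_distrib vs.scale_left_commute)
    then have "?E = W"
      using W(3) v by (auto simp: irreducible_rep_iff)
    then show ?thesis
      by blast
  qed
  moreover obtain w where "w \<in> W" "w \<noteq> 0"
    using W vs.subspace_0 by (auto simp: invariant_subspace_def)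
  ultimately show ?thesis
    using that[of w] WV by blast
qed

end

section \<open>Invariant inner products\<close>

locale unitary_rep = fd_rep +
  fixes ip
  assumes ip_add_left: "u \<in> V \<Longrightarrow> v \<in> V \<Longrightarrow> w \<in> V \<Longrightarrow> ip (u + v) w = ip u w + ip v w"
    and ip_scale_left: "v \<in> V \<Longrightarrow> w \<in> V \<Longrightarrow> ip (c \<star> v) w = c * ip v w"
    and ip_cnj: "v \<in> V \<Longrightarrow> w \<in> V \<Longrightarrow> ip w v = cnj (ip v w)"
    and ip_pos: "v \<in> V \<Longrightarrow> v \<noteq> 0 \<Longrightarrow> 0 < Re (ip v v)"
    and ip_act [simp]: "g \<in> carrier G \<Longrightarrow> v \<in> V \<Longrightarrow> w \<in> V \<Longrightarrow> ip (act g v) (act g w) = ip v w"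
begin

text \<open>Estimates are made for squared norms, which keeps square roots and the triangle
  inequality out of them at the price of constant factors.\<close>

definition sqnorm where "sqnorm v = Re (ip v v)"

lemma ip_add_right:
  assumes "u \<in> V" "v \<in> V" "w \<in> V"
  shows "ip w (u + v) = ip w u + ip w v"
  using assms ip_cnj[of "u + v" w] ip_cnj[of u w] ip_cnj[of v w] by (simp add: ip_add_left)

lemma ip_scale_right:
  assumes "v \<in> V" "w \<in> V"
  shows "ip w (c \<star> v) = cnj c * ip w v"
  using assms ip_cnj[of "c \<star> v" w] ip_cnj[of v w] by (simp add: ip_scale_left)

lemma ip_zero_left [simp]: "v \<in> V \<Longrightarrow> ip 0 v = 0"
  using ip_scale_left[of 0 v 0] by simp

lemma ip_zero_right [simp]: "v \<in> V \<Longrightarrow> ip v 0 = 0"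
  using ip_scale_right[of 0 v 0] by simp

lemma ip_diff_left:
  "u \<in> V \<Longrightarrow> v \<in> V \<Longrightarrow> w \<in> V \<Longrightarrow> ip (u - v) w = ip u w - ip v w"
  using ip_add_left[of "u - v" v w] by simp

lemma ip_diff_right:
  "u \<in> V \<Longrightarrow> v \<in> V \<Longrightarrow> w \<in> V \<Longrightarrow> ip w (u - v) = ip w u - ip w v"
  using ip_add_right[of "u - v" v w] by simp

lemma ip_sum_left:
  assumes "finite I" "\<And>i. i \<in> I \<Longrightarrow> f i \<in> V" "w \<in> V"
  shows "ip (\<Sum>i\<in>I. f i) w = (\<Sum>i\<in>I. ip (f i) w)"
  using assms(1,2) by (induction I rule: finite_induct) (use assms(3) in \<open>auto simp: ip_add_left\<close>)

lemma ip_sum_right: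
  assumes "finite I" "\<And>i. i \<in> I \<Longrightarrow> f i \<in> V" "w \<in> V"
  shows "ip w (\<Sum>i\<in>I. f i) = (\<Sum>i\<in>I. ip w (f i))"
  using assms(1,2) by (induction I rule: finite_induct) (use assms(3) in \<open>auto simp: ip_add_right\<close>)

lemma ip_self: "v \<in> V \<Longrightarrow> ip v v = of_real (sqnorm v)"
  using ip_cnj[of v v] by (simp add: sqnorm_def complex_eq_iff)

lemma sqnorm_zero [simp]: "sqnorm 0 = 0"
  by (simp add: sqnorm_def)

lemma sqnorm_nonneg [simp]: "v \<in> V \<Longrightarrow> 0 \<le> sqnorm v"
  using ip_pos[of v] by (cases "v = 0") (auto simp: sqnorm_def)

lemma sqnorm_eq_0_iff [simp]: "v \<in> V \<Longrightarrow> sqnorm v = 0 \<longleftrightarrow> v = 0"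
  using ip_pos[of v] by (cases "v = 0") (auto simp: sqnorm_def)

lemma sqnorm_scale: "v \<in> V \<Longrightarrow> sqnorm (c \<star> v) = (cmod c)\<^sup>2 * sqnorm v"
  using ip_self[of v]
  by (simp add: sqnorm_def ip_scale_left ip_scale_right mult.assoc[symmetric] cmod_power2 flip: power2_eq_square)

lemma sqnorm_act [simp]: "g \<in> carrier G \<Longrightarrow> v \<in> V \<Longrightarrow> sqnorm (act g v) = sqnorm v"
  by (simp add: sqnorm_def)

lemma sqnorm_add:
  "v \<in> V \<Longrightarrow> w \<in> V \<Longrightarrow> sqnorm (v + w) = sqnorm v + sqnorm w + 2 * Re (ip v w)"
  using ip_cnj[of v w] by (simp add: sqnorm_def ip_add_left ip_add_right)

lemma sqnorm_diff:
  "v \<in> V \<Longrightarrow> w \<in> V \<Longrightarrow> sqnorm (v - w) = sqnorm v + sqnorm w - 2 * Re (ip v w)"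
  using ip_cnj[of v w] by (simp add: sqnorm_def ip_diff_left ip_diff_right)

text \<open>The nonnegativity of \<open>sqnorm (v - w)\<close>, in a form that takes the place of
  the Cauchy-Schwarz inequality.\<close>

lemma Re_ip_le: "v \<in> V \<Longrightarrow> w \<in> V \<Longrightarrow> 2 * Re (ip v w) \<le> sqnorm v + sqnorm w"
  using sqnorm_diff[of v w] sqnorm_nonneg[of "v - w"] by simp

text \<open>The parallelogram law with the term \<open>sqnorm (v + w)\<close> dropped.\<close>

lemma sqnorm_diff_le: "v \<in> V \<Longrightarrow> w \<in> V \<Longrightarrow> sqnorm (v - w) \<le> 2 * sqnorm v + 2 * sqnorm w"
  using sqnorm_diff[of v w] sqnorm_add[of v w] sqnorm_nonneg[of "v + w"] by simp

text \<open>Expanding the square and bounding each of the cross terms by \<open>Re_ip_le\<close>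
  counts every \<open>sqnorm (f i)\<close> once for each index in both arguments.\<close>

lemma sqnorm_sum_le:
  assumes "finite I" "\<And>i. i \<in> I \<Longrightarrow> f i \<in> V"
  shows "sqnorm (\<Sum>i\<in>I. f i) \<le> card I * (\<Sum>i\<in>I. sqnorm (f i))"
proof -
  have "2 * sqnorm (\<Sum>i\<in>I. f i) = (\<Sum>i\<in>I. \<Sum>j\<in>I. 2 * Re (ip (f i) (f j)))"
    using assms by (simp add: sqnorm_def ip_sum_left ip_sum_right sum_distrib_left) (rule sum.swap)
  also have "\<dots> \<le> (\<Sum>i\<in>I. \<Sum>j\<in>I. sqnorm (f i) + sqnorm (f j))"
    using assms Re_ip_le by (intro sum_mono) auto
  also have "\<dots> = 2 * (card I * (\<Sum>i\<in>I. sqnorm (f i)))"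
    by (simp add: sum.distrib sum_distrib_left)
  finally show ?thesis by simp
qed

text \<open>\<open>Re_ip_le\<close> is applied after multiplying \<open>v\<close> by 1, -1, i and
  -i, which turns the real part into plus or minus the real or the imaginary part.\<close>

lemma Re_Im_ip_le_1:
  assumes "v \<in> V" "w \<in> V" "sqnorm v = 1" "sqnorm w = 1"
  shows "\<bar>Re (ip v w)\<bar> \<le> 1" "\<bar>Im (ip v w)\<bar> \<le> 1"
proof -
  have *: "2 * Re (c * ip v w) \<le> 2" if "cmod c = 1" for c
    using Re_ip_le[of "c \<star> v" w] assms that by (simp add: ip_scale_left sqnorm_scale)
  show "\<bar>Re (ip v w)\<bar> \<le> 1" "\<bar>Im (ip v w)\<bar> \<le> 1"
    using *[of 1] *[of "-1"] *[of \<i>] *[of "- \<i>"] by auto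
qed

definition orthonormal where
  "orthonormal E \<longleftrightarrow> E \<subseteq> V \<and> finite E \<and> (\<forall>e\<in>E. \<forall>f\<in>E. ip e f = (if e = f then 1 else 0))"

lemma orthonormal_ip_sum:
  assumes "orthonormal E" "f \<in> E"
  shows "ip (\<Sum>e\<in>E. c e \<star> e) f = c f"
proof -
  have E: "finite E" "\<And>e. e \<in> E \<Longrightarrow> e \<in> V"
    using assms by (auto simp: orthonormal_def)
  then have "ip (\<Sum>e\<in>E. c e \<star> e) f = (\<Sum>e\<in>E. c e * ip e f)"
    using assms by (simp add: ip_sum_left ip_scale_left)
  also have "\<dots> = (\<Sum>e\<in>E. if e = f then c e else 0)"
    using assms by (intro sum.cong) (auto simp: orthonormal_def)
  finally show ?thesis
    using E assms by simp
qed

lemma orthonormal_independent: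
  assumes "orthonormal E"
  shows "vs.independent E"
proof -
  have "finite E"
    using assms by (simp add: orthonormal_def)
  moreover have "c f = 0" if "(\<Sum>e\<in>E. c e \<star> e) = 0" "f \<in> E" for c f
  proof -
    have "f \<in> V"
      using assms that by (auto simp: orthonormal_def)
    then show ?thesis
      using orthonormal_ip_sum[OF assms that(2), of c] that(1) by simp
  qed
  ultimately show ?thesis
    by (intro vs.independent_if_scalars_zero) auto
qed

lemma orthonormal_card_le:
  assumes "orthonormal E" "finite F" "V \<subseteq> vs.span F"
  shows "card E \<le> card F"
  using vs.independent_span_bound[OF assms(2) orthonormal_independent[OF assms(1)]] assms
  by (auto simp: orthonormal_def)

text \<open>An orthonormal subset of \<open>U\<close> of greatest size works: the normalised residue
  of a vector that it fails to expand would enlarge it. Sizes are bounded by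
  \<open>orthonormal_card_le\<close>.\<close>

lemma orthonormal_basis_exists:
  assumes U: "vs.subspace U" "U \<subseteq> V"
  obtains E where "orthonormal E" "E \<subseteq> U" "\<And>u. u \<in> U \<Longrightarrow> u = (\<Sum>e\<in>E. ip u e \<star> e)"
proof -
  obtain F where F: "finite F" "V \<subseteq> vs.span F"
    using fin_dim by blast
  let ?P = "\<lambda>E. orthonormal E \<and> E \<subseteq> U"
  have "?P {}" "\<forall>E. ?P E \<longrightarrow> card E < Suc (card F)"
    using orthonormal_card_le[OF _ F] by (auto simp: orthonormal_def less_Suc_eq_le)
  then obtain E where E: "?P E" and max: "\<And>D. ?P D \<Longrightarrow> card D \<le> card E"
    using ex_has_greatest_nat[of ?P "{}" card "Suc (card F)"] by blast
  have EV: "finite E" "\<And>e. e \<in> E \<Longrightarrow> e \<in> V"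
    using E by (auto simp: orthonormal_def)
  have "u = (\<Sum>e\<in>E. ip u e \<star> e)" if u: "u \<in> U" for u
  proof (rule ccontr)
    assume neq: "u \<noteq> (\<Sum>e\<in>E. ip u e \<star> e)"
    define w where "w = u - (\<Sum>e\<in>E. ip u e \<star> e)"
    have wU: "w \<in> U"
      unfolding w_def using E U u by (intro vs.subspace_diff vs.subspace_sum vs.subspace_scale) auto
    then have w: "w \<in> V" "w \<noteq> 0"
      using U neq by (auto simp: w_def)
    have orth: "ip w e = 0" if "e \<in> E" for e
      using that EV u U orthonormal_ip_sum[of E e "ip u"] E by (auto simp: w_def ip_diff_left)
    define f where "f = of_real (inverse (sqrt (sqnorm w))) \<star> w"
    have f: "f \<in> V" "f \<in> U"
      using w wU U vs.subspace_scale by (auto simp: f_def)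
    have "sqnorm w > 0"
      using w sqnorm_nonneg[of w] sqnorm_eq_0_iff[of w] by linarith
    then have "sqnorm f = 1"
      using w by (simp add: f_def sqnorm_scale norm_inverse power_inverse)
    then have ff: "ip f f = 1"
      using ip_self f by simp
    have fe: "ip f e = 0" "ip e f = 0" if "e \<in> E" for e
      using that orth[OF that] w EV ip_cnj[of f e] f by (auto simp: f_def ip_scale_left)
    have "f \<notin> E"
      using fe(1) ff by force
    moreover have "?P (insert f E)"
      using E f ff fe by (auto simp: orthonormal_def)
    ultimately show False
      using max[of "insert f E"] EV by simp
  qed
  then show ?thesis
    using that E by blast
qed

lemma sqnorm_orthonormal:
  assumes "orthonormal E" "u = (\<Sum>e\<in>E. ip u e \<star> e)"
  shows "sqnorm u = (\<Sum>e\<in>E. (cmod (ip u e))\<^sup>2)"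
proof -
  have E: "finite E" "\<And>e. e \<in> E \<Longrightarrow> e \<in> V"
    using assms by (auto simp: orthonormal_def)
  then have u: "u \<in> V"
    by (subst assms(2)) auto
  have "ip u u = ip u (\<Sum>e\<in>E. ip u e \<star> e)"
    using assms(2) by simp
  also have "\<dots> = (\<Sum>e\<in>E. cnj (ip u e) * ip u e)"
    using E u by (simp add: ip_sum_right ip_scale_right)
  also have "\<dots> = of_real (\<Sum>e\<in>E. (cmod (ip u e))\<^sup>2)"
    unfolding of_real_sum complex_norm_square by (simp add: mult.commute)
  finally show ?thesis
    by (simp add: sqnorm_def)
qed

end

context fd_rep
begin

text \<open>A coordinate inner product is summed over the finite set \<open>\<Gamma>\<close> of
  operators instead of the group, which may be infinite.\<close>

lemma invariant_inner_product_exists: "\<exists>ip. unitary_rep G \<rho> ip"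
proof -
  obtain F where F: "finite F" "V \<subseteq> vs.span F"
    using fin_dim by blast
  obtain B where B: "B \<subseteq> V" "vs.independent B" "V \<subseteq> vs.span B"
    using vs.basis_exists by metis
  have finB: "finite B"
    using vs.independent_span_bound[OF F(1) B(2)] B(1) F(2) by blast
  define co where "co = vs.representation B"
  define ip0 where "ip0 v w = (\<Sum>b\<in>B. co v b * cnj (co w b))" for v w
  define \<Gamma> where "\<Gamma> = (\<lambda>g. restrict (act g) V) ` carrier G"
  define ip where "ip v w = (\<Sum>\<gamma>\<in>\<Gamma>. ip0 (\<gamma> v) (\<gamma> w))" for v w
  have co_add: "co (v + w) b = co v b + co w b" if "v \<in> V" "w \<in> V" for v w b
    using vs.representation_add[OF B(2) subsetD[OF B(3)] subsetD[OF B(3)]] that by (simp add: co_def)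
  have co_scale: "co (c \<star> v) b = c * co v b" if "v \<in> V" for v c b
    using vs.representation_scale[OF B(2) subsetD[OF B(3)]] that by (simp add: co_def)
  have \<Gamma>_cases: "\<exists>g\<in>carrier G. \<forall>v\<in>V. \<gamma> v = act g v" if "\<gamma> \<in> \<Gamma>" for \<gamma>
    using that by (auto simp: \<Gamma>_def)
  have \<Gamma>V: "\<gamma> v \<in> V" if "\<gamma> \<in> \<Gamma>" "v \<in> V" for \<gamma> v
    using \<Gamma>_cases[OF that(1)] that by auto
  have \<Gamma>_add: "\<gamma> (v + w) = \<gamma> v + \<gamma> w" if "\<gamma> \<in> \<Gamma>" "v \<in> V" "w \<in> V" for \<gamma> v w
    using \<Gamma>_cases[OF that(1)] that by auto
  have \<Gamma>_scale: "\<gamma> (c \<star> v) = c \<star> \<gamma> v" if "\<gamma> \<in> \<Gamma>" "v \<in> V" for \<gamma> v c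
    using \<Gamma>_cases[OF that(1)] that by auto
  have ip0_nonneg: "Im (ip0 v v) = 0" "Re (ip0 v v) \<ge> 0" for v
    by (auto simp: ip0_def intro!: sum_nonneg)
  have ip0_pos: "Re (ip0 v v) > 0" if v: "v \<in> V" "v \<noteq> 0" for v
  proof -
    have "v = (\<Sum>b\<in>B. co v b \<star> b)"
      using vs.sum_representation_eq[OF B(2) _ finB, of v] v B(3) by (auto simp: co_def)
    then obtain b where b: "b \<in> B" "co v b \<noteq> 0"
      using v by (metis (no_types, lifting) sum.neutral vs.scale_zero_left)
    have "0 < Re (co v b * cnj (co v b))"
      using b(2) by (simp add: complex_eq_iff sum_power2_gt_zero_iff flip: power2_eq_square)
    also have "\<dots> \<le> Re (ip0 v v)"
      unfolding ip0_def Re_sum using b finB by (intro member_le_sum) auto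
    finally show ?thesis .
  qed
  \<comment> \<open>The summand of the identity operator makes the sum strictly positive; the others
    are nonnegative.\<close>
  define \<iota> where "\<iota> = restrict (act \<one>) V"
  have id\<Gamma>: "\<iota> \<in> \<Gamma>"
    by (simp add: \<Gamma>_def \<iota>_def)
  have fin\<Gamma>: "finite \<Gamma>"
    using fin_im by (simp add: \<Gamma>_def)
  have "unitary_rep G \<rho> ip"
  proof (intro unitary_rep.intro unitary_rep_axioms.intro)
    show "fd_rep G \<rho>" ..
    show "ip (u + v) w = ip u w + ip v w" if "u \<in> V" "v \<in> V" "w \<in> V" for u v w
    proof -
      have "ip0 (\<gamma> (u + v)) (\<gamma> w) = ip0 (\<gamma> u) (\<gamma> w) + ip0 (\<gamma> v) (\<gamma> w)" if "\<gamma> \<in> \<Gamma>" for \<gamma>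
        using that \<open>u \<in> V\<close> \<open>v \<in> V\<close>
        by (simp add: ip0_def distrib_right sum.distrib \<Gamma>_add \<Gamma>V co_add)
      then show ?thesis
        by (simp add: ip_def sum.distrib)
    qed
    show "ip (c \<star> v) w = c * ip v w" if "v \<in> V" "w \<in> V" for c v w
    proof -
      have "ip0 (\<gamma> (c \<star> v)) (\<gamma> w) = c * ip0 (\<gamma> v) (\<gamma> w)" if "\<gamma> \<in> \<Gamma>" for \<gamma>
        using that \<open>v \<in> V\<close>
        by (simp add: ip0_def sum_distrib_left mult.assoc \<Gamma>_scale \<Gamma>V co_scale)
      then show ?thesis
        by (simp add: ip_def sum_distrib_left)
    qed
    show "ip w v = cnj (ip v w)" for v w
      by (simp add: ip_def ip0_def mult.commute)
    show "0 < Re (ip v v)" if v: "v \<in> V" "v \<noteq> 0" for v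
    proof -
      have "0 < Re (ip0 (\<iota> v) (\<iota> v))"
        using v ip0_pos by (simp add: \<iota>_def)
      also have "\<dots> \<le> Re (ip v v)"
        unfolding ip_def Re_sum using id\<Gamma> fin\<Gamma> ip0_nonneg
        by (intro member_le_sum[where f = "\<lambda>\<gamma>. Re (ip0 (\<gamma> v) (\<gamma> v))"]) auto
      finally show ?thesis .
    qed
    show "ip (act h v) (act h w) = ip v w" if h: "h \<in> carrier G" and v: "v \<in> V" and w: "w \<in> V" for h v w
    proof -
      \<comment> \<open>Precomposition with \<open>act h\<close> permutes \<open>\<Gamma>\<close>;
        \<open>restrict\<close> brings the composite back to the form of its members.\<close>
      let ?\<Phi> = "\<lambda>h \<gamma>. restrict (\<lambda>v. \<gamma> (act h v)) V"
      have \<Phi>: "?\<Phi> k \<gamma> \<in> \<Gamma>" if k: "k \<in> carrier G" and \<gamma>: "\<gamma> \<in> \<Gamma>" for k \<gamma>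
      proof -
        obtain g where g: "g \<in> carrier G" "\<gamma> = restrict (act g) V"
          using \<gamma> by (auto simp: \<Gamma>_def)
        then have "?\<Phi> k \<gamma> = restrict (act (g \<otimes> k)) V"
          using k by (auto simp: restrict_def act_mult)
        then show ?thesis
          using g k by (auto simp: \<Gamma>_def)
      qed
      have undef: "\<gamma> x = undefined" if "\<gamma> \<in> \<Gamma>" "x \<notin> V" for \<gamma> x
        using that by (auto simp: \<Gamma>_def)
      have inv1: "?\<Phi> (inv h) (?\<Phi> h \<gamma>) = \<gamma>" "?\<Phi> h (?\<Phi> (inv h) \<gamma>) = \<gamma>" if "\<gamma> \<in> \<Gamma>" for \<gamma>
        using undef[OF that] h by (auto simp: restrict_def fun_eq_iff)
      show ?thesis
        unfolding ip_def
        by (rule sum.reindex_bij_witness[of _ "?\<Phi> (inv h)" "?\<Phi> h"]) (use inv1 \<Phi> h v w in auto)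
    qed
  qed
  then show ?thesis
    by blast
qed

text \<open>Maschke's theorem by orthogonal projection. By the claim \<open>char\<close>,
  \<open>p v\<close> is the only element of \<open>U\<close> whose difference from \<open>v\<close>
  is orthogonal to \<open>U\<close>; a unitary \<open>act g\<close> transports this property, whence
  equivariance.\<close>

lemma equivariant_projection:
  assumes U: "invariant_subspace G \<rho> U"
  obtains p where "\<And>v. v \<in> V \<Longrightarrow> p v \<in> U" "\<And>u. u \<in> U \<Longrightarrow> p u = u"
    "\<And>v w. v \<in> V \<Longrightarrow> w \<in> V \<Longrightarrow> p (v + w) = p v + p w"
    "\<And>c v. v \<in> V \<Longrightarrow> p (c \<star> v) = c \<star> p v"
    "\<And>g v. g \<in> carrier G \<Longrightarrow> v \<in> V \<Longrightarrow> p (act g v) = act g (p v)"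
proof -
  obtain ip where "unitary_rep G \<rho> ip"
    using invariant_inner_product_exists by blast
  then interpret unitary_rep G \<rho> ip .
  have U': "vs.subspace U" "U \<subseteq> V"
    using U by (auto simp: invariant_subspace_def)
  obtain E where E: "orthonormal E" "E \<subseteq> U" "\<And>u. u \<in> U \<Longrightarrow> u = (\<Sum>e\<in>E. ip u e \<star> e)"
    using orthonormal_basis_exists[OF U'] by blast
  have EV: "e \<in> V" if "e \<in> E" for e
    using E U' that by auto
  define p where "p v = (\<Sum>e\<in>E. ip v e \<star> e)" for v
  have pU: "p v \<in> U" for v
    unfolding p_def using E U' by (intro vs.subspace_sum vs.subspace_scale) auto
  have p_add: "p (v + w) = p v + p w" if "v \<in> V" "w \<in> V" for v w
    using that EV by (simp add: p_def ip_add_left vs.scale_left_distrib sum.distrib)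
  have p_scale: "p (c \<star> v) = c \<star> p v" if "v \<in> V" for c v
    using that EV by (simp add: p_def ip_scale_left vs.scale_sum_right)
  have char: "p v = u" if u: "u \<in> U" and v: "v \<in> V" and orth: "\<And>x. x \<in> U \<Longrightarrow> ip (v - u) x = 0" for u v
  proof -
    have "ip v e = ip u e" if "e \<in> E" for e
    proof -
      have "e \<in> U" "u \<in> V"
        using that u E(2) U'(2) by auto
      then show ?thesis
        using orth[of e] v EV[OF that] by (simp add: ip_diff_left)
    qed
    then show ?thesis
      using E(3)[OF u] by (simp add: p_def)
  qed
  have orth: "ip (v - p v) x = 0" if v: "v \<in> V" and x: "x \<in> U" for v x
  proof -
    have pV: "p v \<in> V"
      using pU U' by auto
    have finE: "finite E"
      using E by (simp add: orthonormal_def)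
    have e0: "ip (v - p v) e = 0" if "e \<in> E" for e
      using orthonormal_ip_sum[OF E(1) that, of "ip v"] v pV EV[OF that] by (simp add: ip_diff_left p_def)
    have "ip (v - p v) (\<Sum>e\<in>E. ip x e \<star> e) = 0"
      using e0 v pV EV finE by (simp add: ip_sum_right ip_scale_right)
    then show ?thesis
      using E(3)[OF x] by simp
  qed
  have p_act: "p (act g v) = act g (p v)" if g: "g \<in> carrier G" and v: "v \<in> V" for g v
  proof (rule char)
    have pV: "p v \<in> V"
      using pU U' by auto
    show "act g (p v) \<in> U"
      using pU U g by (auto simp: invariant_subspace_def)
    show "ip (act g v - act g (p v)) x = 0" if x: "x \<in> U" for x
    proof -
      have x': "act (inv g) x \<in> U" "x \<in> V"
        using x U g by (auto simp: invariant_subspace_def)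
      have "ip (act g v - act g (p v)) x = ip (act g (v - p v)) (act g (act (inv g) x))"
        using g v pV x' by simp
      also have "\<dots> = ip (v - p v) (act (inv g) x)"
        using g v pV x' by (intro ip_act) auto
      finally show ?thesis
        using orth[OF v x'(1)] by simp
    qed
  qed (use g v in auto)
  show ?thesis
    by (rule that[of p]) (use pU p_add p_scale p_act E(3) in \<open>auto simp: p_def\<close>)
qed

end

section \<open>Jordan's theorem\<close>

context unitary_rep
begin

text \<open>\<open>\<epsilon>\<close> bounds the square of the operator norm of
  \<open>act g - 1\<close>.\<close>

definition near_id where
  "near_id \<epsilon> g \<longleftrightarrow> g \<in> carrier G \<and> (\<forall>v\<in>V. sqnorm (act g v - v) \<le> \<epsilon> * sqnorm v)"

lemma near_idD: "near_id \<epsilon> g \<Longrightarrow> v \<in> V \<Longrightarrow> sqnorm (act g v - v) \<le> \<epsilon> * sqnorm v"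
  by (simp add: near_id_def)

definition comm where "comm a b = a \<otimes> b \<otimes> inv a \<otimes> inv b"

lemma comm_closed [simp]: "a \<in> carrier G \<Longrightarrow> b \<in> carrier G \<Longrightarrow> comm a b \<in> carrier G"
  by (simp add: comm_def)

text \<open>The identity \<open>ab - ba = (a - 1)(b - 1) - (b - 1)(a - 1)\<close> makes the commutator of two
  operators near the identity much nearer to it.\<close>

lemma near_id_comm:
  assumes a: "near_id \<alpha> a" and b: "near_id \<beta> b" and nonneg: "0 \<le> \<alpha>" "0 \<le> \<beta>"
  shows "near_id (4 * \<alpha> * \<beta>) (comm a b)"
  unfolding near_id_def
proof (intro conjI ballI)
  have G: "a \<in> carrier G" "b \<in> carrier G"
    using a b by (auto simp: near_id_def)
  then show "comm a b \<in> carrier G"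
    by simp
  fix v assume v: "v \<in> V"
  \<comment> \<open>In terms of \<open>u\<close>, the operator of \<open>comm a b\<close> minus the
    identity becomes \<open>ab - ba\<close>.\<close>
  define u where "u = act (inv a) (act (inv b) v)"
  have u: "u \<in> V" "sqnorm u = sqnorm v"
    using v G by (auto simp: u_def)
  have "act (comm a b) v = act a (act b u)"
    using v G by (simp add: comm_def act_mult u_def)
  moreover have "v = act b (act a u)"
    using v G by (simp add: u_def)
  ultimately have "act (comm a b) v - v =
      (act a (act b u - u) - (act b u - u)) - (act b (act a u - u) - (act a u - u))"
    using u G by simp
  \<comment> \<open>Each half contributes \<open>2 * \<alpha> * \<beta>\<close>, whence the constant
    4.\<close>
  also have "sqnorm \<dots> \<le> 2 * sqnorm (act a (act b u - u) - (act b u - u)) +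
      2 * sqnorm (act b (act a u - u) - (act a u - u))"
    using u G by (intro sqnorm_diff_le) auto
  also have "sqnorm (act a (act b u - u) - (act b u - u)) \<le> \<alpha> * (\<beta> * sqnorm u)"
  proof -
    have "sqnorm (act a (act b u - u) - (act b u - u)) \<le> \<alpha> * sqnorm (act b u - u)"
      using u G by (intro near_idD[OF a]) simp
    also have "\<dots> \<le> \<alpha> * (\<beta> * sqnorm u)"
      using u nonneg by (intro mult_left_mono near_idD[OF b]) auto
    finally show ?thesis .
  qed
  also have "sqnorm (act b (act a u - u) - (act a u - u)) \<le> \<beta> * (\<alpha> * sqnorm u)"
  proof -
    have "sqnorm (act b (act a u - u) - (act a u - u)) \<le> \<beta> * sqnorm (act a u - u)"
      using u G by (intro near_idD[OF b]) simp
    also have "\<dots> \<le> \<beta> * (\<alpha> * sqnorm u)"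
      using u nonneg by (intro mult_left_mono near_idD[OF a]) auto
    finally show ?thesis .
  qed
  finally show "sqnorm (act (comm a b) v - v) \<le> 4 * \<alpha> * \<beta> * sqnorm v"
    using u by (simp add: algebra_simps)
qed

text \<open>Frobenius: \<open>a\<close> commutes with its conjugate \<open>c\<close> by \<open>b\<close>.  If \<open>a \<noteq> c\<close>, then a common
  eigenvector \<open>w\<close> with different eigenvalues of \<open>a\<close> and \<open>c\<close> is orthogonal to \<open>u = b\<^sup>-\<^sup>1 w\<close>, so that
  \<open>b\<close> moves \<open>u\<close> too far.\<close>

lemma commute_if_commute_comm:
  assumes a: "a \<in> carrier G" and b: "near_id \<epsilon> b" "\<epsilon> < 2"
    and comm: "\<And>v. v \<in> V \<Longrightarrow> act a (act (comm a b) v) = act (comm a b) (act a v)"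
    and v: "v \<in> V"
  shows "act a (act b v) = act b (act a v)"
proof -
  have bG: "b \<in> carrier G"
    using b by (simp add: near_id_def)
  define c where "c = b \<otimes> a \<otimes> inv b"
  have c: "c \<in> carrier G"
    using a bG by (simp add: c_def)
  \<comment> \<open>So commuting with \<open>comm a b\<close> means, for \<open>a\<close>, commuting
    with \<open>c\<close>.\<close>
  have comm_c: "comm a b = a \<otimes> inv c"
    using a bG by (simp add: comm_def c_def inv_mult_group m_assoc)
  have ac: "act a (act c v) = act c (act a v)" if v: "v \<in> V" for v
  proof -
    have "act a (act a (act (inv c) (act c v))) = act a (act (inv c) (act a (act c v)))"
      using comm[of "act c v"] v a c by (simp add: comm_c act_mult)
    then have "act a v = act (inv c) (act a (act c v))"
      using v a c by (subst (asm) act_eq_iff) auto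
    then have "act c (act a v) = act c (act (inv c) (act a (act c v)))"
      by simp
    then show ?thesis
      using v a c by simp
  qed
  \<comment> \<open>\<open>A\<close> acts by commuting operators. Hence the subspace
    \<open>U\<close> where \<open>a\<close> and \<open>c\<close> agree has an
    \<open>A\<close>-invariant complement \<open>W\<close>, which would contain a common eigenvector
    if it were nonzero.\<close>
  define A where "A = generate G {a, c}"
  have A: "subgroup A G" "A \<subseteq> carrier G"
    unfolding A_def using generate_is_subgroup generate_incl a c by auto
  have A_comm: "act x (act y v) = act y (act x v)" if "x \<in> A" "y \<in> A" "v \<in> V" for x y v
    by (rule generate_acts_commutatively[of "{a, c}"]) (use that a c ac in \<open>auto simp: A_def\<close>)
  have aA: "a \<in> A" and cA: "c \<in> A"
    by (auto simp: A_def generate.incl)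
  interpret A: fd_rep "G\<lparr>carrier := A\<rparr>" \<rho>
    by (rule fd_rep_subgroup[OF A(1)])
  define U where "U = {v \<in> V. act a v = act c v}"
  have U: "invariant_subspace (G\<lparr>carrier := A\<rparr>) \<rho> U"
  proof -
    have "act a (act g v) = act c (act g v)" if "g \<in> A" "v \<in> V" "act a v = act c v" for g v
      using A_comm[OF aA that(1,2)] A_comm[OF cA that(1,2)] that(3) by simp
    then show ?thesis
      using a c A by (auto simp: U_def invariant_subspace_def vs.subspace_def)
  qed
  obtain p where p: "\<And>v. v \<in> V \<Longrightarrow> p v \<in> U" "\<And>u. u \<in> U \<Longrightarrow> p u = u"
    "\<And>v w. v \<in> V \<Longrightarrow> w \<in> V \<Longrightarrow> p (v + w) = p v + p w"
    "\<And>c v. v \<in> V \<Longrightarrow> p (scl c v) = scl c (p v)"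
    "\<And>g v. g \<in> A \<Longrightarrow> v \<in> V \<Longrightarrow> p (act g v) = act g (p v)"
    using A.equivariant_projection[OF U] by auto
  define W where "W = {v \<in> V. p v = 0}"
  have W: "invariant_subspace (G\<lparr>carrier := A\<rparr>) \<rho> W"
    using p A p(2)[of 0] by (auto simp: W_def invariant_subspace_def vs.subspace_def U_def a c subset_iff)
  have "W = {0}"
  proof (rule ccontr)
    assume "W \<noteq> {0}"
    interpret W: fd_rep "G\<lparr>carrier := A\<rparr>" "\<rho>\<lparr>rep_space := W\<rparr>"
      by (rule A.fd_rep_subrep[OF W])
    have "rep_space (\<rho>\<lparr>rep_space := W\<rparr>) \<noteq> {0}"
      using \<open>W \<noteq> {0}\<close> by simp
    moreover have "act x (act y v) = act y (act x v)" if "x \<in> A" "y \<in> A" "v \<in> W" for x y v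
      using A_comm that by (simp add: W_def)
    ultimately obtain w where w: "w \<in> W" "w \<noteq> 0" "\<forall>g\<in>A. \<exists>c. act g w = scl c w"
      using W.common_eigenvector[of "\<exists>w\<in>W. w \<noteq> 0 \<and> (\<forall>g\<in>A. \<exists>c. act g w = scl c w)"] by auto
    obtain \<kappa> \<mu> where lm: "act a w = scl \<kappa> w" "act c w = scl \<mu> w"
      using w(3) aA cA by blast
    have wV: "w \<in> V"
      using w by (simp add: W_def)
    have "\<kappa> \<noteq> \<mu>"
    proof
      assume "\<kappa> = \<mu>"
      then have "w \<in> U"
        using wV lm by (simp add: U_def)
      then show False
        using p(2) w by (simp add: W_def)
    qed
    define u where "u = act (inv b) w"
    have u: "u \<in> V" "u \<noteq> 0" "act b u = w"
      using wV w(2) bG by (auto simp: u_def) (metis act_act_inv act_zero)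
    have "act b (act a u) = act c w"
      using a bG wV by (simp add: c_def act_mult u_def)
    also have "\<dots> = act b (scl \<mu> u)"
      using lm u bG by simp
    finally have au: "act a u = scl \<mu> u"
      using act_eq_iff[of b "act a u" "scl \<mu> u"] a bG u by simp
    have nrm: "cmod \<mu> = 1"
    proof -
      have "(cmod \<mu>)\<^sup>2 * sqnorm u = sqnorm u"
        using au a u(1) sqnorm_act[of a u] by (simp add: sqnorm_scale)
      then have "(cmod \<mu>)\<^sup>2 = 1"
        using u by simp
      then show ?thesis
        by (simp add: power2_eq_1_iff) (metis norm_ge_zero not_one_le_zero neg_0_le_iff_le)
    qed
    \<comment> \<open>\<open>u\<close> and \<open>w\<close> are eigenvectors of the unitary
      \<open>act a\<close> for the different eigenvalues \<open>\<mu>\<close> and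
      \<open>\<kappa>\<close>, hence orthogonal.\<close>
    have "ip u w = ip (act a u) (act a w)"
      using a u wV by simp
    also have "\<dots> = \<mu> * cnj \<kappa> * ip u w"
      using u wV by (simp add: lm au ip_scale_left ip_scale_right)
    finally have "ip u w = 0 \<or> \<mu> * cnj \<kappa> = 1"
      by simp
    moreover have "\<mu> * cnj \<kappa> \<noteq> 1"
    proof
      assume "\<mu> * cnj \<kappa> = 1"
      then have "cnj \<mu> * (\<mu> * cnj \<kappa>) = cnj \<mu>"
        by simp
      moreover have "cnj \<mu> * \<mu> = 1"
        using nrm complex_norm_square[of \<mu>] by (simp add: mult.commute)
      ultimately have "cnj \<kappa> = cnj \<mu>"
        by (simp add: mult.assoc[symmetric])
      then show False
        using \<open>\<kappa> \<noteq> \<mu>\<close> by simp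
    qed
    ultimately have "ip u w = 0" by simp
    then have "sqnorm (w - u) = sqnorm w + sqnorm u"
      using sqnorm_diff[OF u(1) wV] ip_cnj[OF u(1) wV] sqnorm_diff[OF wV u(1)] by simp
    also have "sqnorm w = sqnorm u"
      using sqnorm_act[OF bG u(1)] u(3) by simp
    \<comment> \<open>Pythagoras for orthogonal vectors of equal length; this is the origin of the
      threshold 2 for \<open>\<epsilon>\<close>.\<close>
    finally have "sqnorm (act b u - u) = 2 * sqnorm u"
      using u by simp
    moreover have "sqnorm (act b u - u) \<le> \<epsilon> * sqnorm u"
      by (rule near_idD[OF b(1) u(1)])
    ultimately have "(2 - \<epsilon>) * sqnorm u \<le> 0"
      by (simp add: algebra_simps)
    then show False
      using u b(2) sqnorm_nonneg[OF u(1)] sqnorm_eq_0_iff[OF u(1)] by (simp add: mult_le_0_iff)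
  qed
  have VU: "v \<in> U" if v: "v \<in> V" for v
  proof -
    have pV: "p v \<in> U" "p v \<in> V"
      using p(1)[OF v] by (auto simp: U_def)
    have "p v = p (v - p v) + p (p v)"
      using p(3)[of "v - p v" "p v"] v pV by simp
    then have "v - p v \<in> W"
      using p(2)[OF pV(1)] v pV by (simp add: W_def)
    then show ?thesis
      using \<open>W = {0}\<close> pV by simp
  qed
  have "act a (act b v) = act c (act b v)"
    using VU[of "act b v"] v bG by (simp add: U_def)
  also have "\<dots> = act b (act a v)"
    using v a bG by (simp add: c_def act_mult)
  finally show ?thesis .
qed

text \<open>Iterated commutators with \<open>a\<close> tend to the identity, and as there are
  finitely many operators, some \<open>s k0\<close> equals it on \<open>V\<close>. From there
  \<open>commute_if_commute_comm\<close> leads back to \<open>s 0\<close>, which is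
  \<open>b\<close>.\<close>

lemma near_id_commute:
  assumes a: "near_id (1/16) a" and b: "near_id (1/16) b" and v: "v \<in> V"
  shows "act a (act b v) = act b (act a v)"
proof -
  define s where "s k = (comm a ^^ k) b" for k
  have aG: "a \<in> carrier G"
    using a by (simp add: near_id_def)
  \<comment> \<open>With \<open>\<alpha>\<close> equal to 1/16 the factor
    \<open>4 * \<alpha>\<close> of \<open>near_id_comm\<close> is 1/4, so the bounds decay
    geometrically.\<close>
  have near: "near_id (1/16 * (1/4) ^ k) (s k)" for k
  proof (induction k)
    case 0
    then show ?case using b by (simp add: s_def)
  next
    case (Suc k)
    then show ?case
      using near_id_comm[OF a Suc] by (simp add: s_def)
  qed
  have sG: "s k \<in> carrier G" for k
    using near[of k] by (simp add: near_id_def)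
  have "finite (range (\<lambda>k. restrict (act (s k)) V))"
    by (rule finite_subset[OF _ fin_im]) (use sG in auto)
  \<comment> \<open>An operator that recurs infinitely often satisfies arbitrarily small bounds,
    hence is the identity.\<close>
  then obtain k0 where inf: "infinite {k. restrict (act (s k)) V = restrict (act (s k0)) V}"
    using pigeonhole_infinite[of UNIV "\<lambda>k. restrict (act (s k)) V"] by auto
  have triv: "act (s k0) v = v" if v: "v \<in> V" for v
  proof (rule ccontr)
    assume neq: "act (s k0) v \<noteq> v"
    let ?d = "act (s k0) v - v"
    have d: "?d \<in> V" "?d \<noteq> 0"
      using neq v sG by auto
    then have dpos: "sqnorm ?d > 0"
      using sqnorm_nonneg[OF d(1)] sqnorm_eq_0_iff[OF d(1)] by linarith
    have "v \<noteq> 0"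
      using d sG by auto
    then have vpos: "sqnorm v > 0"
      using sqnorm_nonneg[OF v] sqnorm_eq_0_iff[OF v] by linarith
    obtain m where m: "(1/4) ^ m < sqnorm ?d / sqnorm v"
      using real_arch_pow_inv[of "sqnorm ?d / sqnorm v" "1/4"] dpos vpos by auto
    obtain k where k: "k \<ge> m" "restrict (act (s k)) V = restrict (act (s k0)) V"
      using inf unfolding infinite_nat_iff_unbounded_le by blast
    have "act (s k) v = act (s k0) v"
      using k(2) v by (metis restrict_apply')
    then have "sqnorm ?d \<le> 1/16 * (1/4) ^ k * sqnorm v"
      using near[of k] v by (metis near_id_def)
    also have "\<dots> \<le> (1/4) ^ m * sqnorm v"
    proof (rule mult_right_mono)
      have "1/16 * (1/4) ^ k \<le> (1/4 :: real) ^ k"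
        by simp
      also have "\<dots> \<le> (1/4) ^ m"
        using k(1) by (intro power_decreasing) auto
      finally show "1/16 * (1/4) ^ k \<le> (1/4 :: real) ^ m" .
    qed (use v in simp)
    also have "\<dots> < sqnorm ?d"
      using m vpos by (simp add: field_simps)
    finally show False by simp
  qed
  \<comment> \<open>Downward induction from \<open>k0\<close>, with \<open>j\<close> counting the
    steps; beyond \<open>j = k0\<close> the truncated difference stays at 0.\<close>
  have "\<forall>v\<in>V. act a (act (s (k0 - j)) v) = act (s (k0 - j)) (act a v)" for j
  proof (induction j)
    case 0
    then show ?case using triv aG by simp
  next
    case (Suc j)
    show ?case
    proof (cases "j < k0")
      case True
      define i where "i = k0 - Suc j"
      have i: "k0 - j = Suc i"
        using True by (simp add: i_def)
      have "act a (act (s i) v) = act (s i) (act a v)" if v: "v \<in> V" for v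
      proof (rule commute_if_commute_comm[OF aG near _ _ v])
        have "(1/4 :: real) ^ i \<le> 1"
          by (simp add: power_le_one)
        then show "1/16 * (1/4 :: real) ^ i < 2"
          by simp
        show "act a (act (comm a (s i)) v) = act (comm a (s i)) (act a v)" if "v \<in> V" for v
          using Suc that unfolding i by (simp add: s_def)
      qed
      then show ?thesis
        by (simp add: i_def)
    next
      case False
      then show ?thesis using Suc by simp
    qed
  qed
  from this[of k0] show ?thesis
    using v by (simp add: s_def)
qed

text \<open>The operator of \<open>g \<otimes> inv h\<close> minus the identity sends
  \<open>v\<close> to the difference of the operators of \<open>g\<close> and \<open>h\<close> at
  \<open>u = act (inv h) v\<close>. One factor \<open>card E\<close> counts the entries in a column
  of that difference, the other comes from \<open>sqnorm_sum_le\<close>.\<close>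

lemma near_id_if_close_on_basis:
  fixes \<delta> :: real
  assumes E: "orthonormal E" "\<And>v. v \<in> V \<Longrightarrow> v = (\<Sum>e\<in>E. ip v e \<star> e)"
    and g: "g \<in> carrier G" and h: "h \<in> carrier G"
    and close: "\<And>e f. e \<in> E \<Longrightarrow> f \<in> E \<Longrightarrow> (cmod (ip (act g e) f - ip (act h e) f))\<^sup>2 \<le> \<delta>"
  shows "near_id (card E * (card E * \<delta>)) (g \<otimes> inv h)"
  unfolding near_id_def
proof (intro conjI ballI)
  show "g \<otimes> inv h \<in> carrier G"
    using g h by simp
  fix v assume v: "v \<in> V"
  have EV: "e \<in> V" if "e \<in> E" for e
    using E(1) that by (auto simp: orthonormal_def)
  define u where "u = act (inv h) v"
  have u: "u \<in> V" "sqnorm u = sqnorm v"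
    using v h by (auto simp: u_def)
  define D where "D e = act g e - act h e" for e
  have D: "D e \<in> V" "sqnorm (D e) \<le> card E * \<delta>" if e: "e \<in> E" for e
  proof -
    show DV: "D e \<in> V"
      using EV[OF e] g h by (simp add: D_def)
    have "sqnorm (D e) = (\<Sum>f\<in>E. (cmod (ip (D e) f))\<^sup>2)"
      by (rule sqnorm_orthonormal[OF E(1) E(2)[OF DV]])
    also have "\<dots> \<le> (\<Sum>f\<in>E. \<delta>)"
      using close[OF e] EV e g h by (intro sum_mono) (simp add: D_def ip_diff_left)
    finally show "sqnorm (D e) \<le> card E * \<delta>"
      by simp
  qed
  have finE: "finite E"
    using E(1) by (simp add: orthonormal_def)
  have "act (g \<otimes> inv h) v - v = act g u - act h u"
    using v g h by (simp add: u_def act_mult)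
  also have "\<dots> = (\<Sum>e\<in>E. ip u e \<star> D e)"
  proof -
    have "act k u = (\<Sum>e\<in>E. ip u e \<star> act k e)" if k: "k \<in> carrier G" for k
    proof -
      have "act k u = act k (\<Sum>e\<in>E. ip u e \<star> e)"
        using E(2)[OF u(1)] by simp
      then show ?thesis
        using k EV finE by (simp add: act_sum)
    qed
    then show ?thesis
      using g h by (simp add: D_def vs.scale_right_diff_distrib sum_subtractf)
  qed
  also have "sqnorm \<dots> \<le> card E * (\<Sum>e\<in>E. sqnorm (ip u e \<star> D e))"
    using finE D(1) by (intro sqnorm_sum_le) auto
  also have "\<dots> \<le> card E * (\<Sum>e\<in>E. (cmod (ip u e))\<^sup>2 * (card E * \<delta>))"
    using D by (intro mult_left_mono sum_mono) (auto simp: sqnorm_scale intro!: mult_left_mono)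
  also have "\<dots> = card E * (card E * \<delta>) * sqnorm u"
    by (simp add: sqnorm_orthonormal[OF E(1) E(2)[OF u(1)]] flip: sum_distrib_right)
  finally show "sqnorm (act (g \<otimes> inv h) v - v) \<le> card E * (card E * \<delta>) * sqnorm v"
    using u by simp
qed

end

lemma floor_eq_imp_abs_diff_le:
  fixes x y m :: real
  assumes "m > 0" "\<lfloor>m * x\<rfloor> = \<lfloor>m * y\<rfloor>"
  shows "\<bar>x - y\<bar> \<le> 1 / m"
proof -
  have "\<bar>m * x - m * y\<bar> \<le> 1"
    using assms(2) by linarith
  then have "m * \<bar>x - y\<bar> \<le> 1"
    using assms(1) by (simp add: abs_mult flip: right_diff_distrib)
  then show ?thesis
    using assms(1) by (simp add: field_simps)
qed

text \<open>The number of ways to sort the real and imaginary parts of \<open>d\<^sup>2\<close>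
  matrix entries into \<open>2 * m + 1\<close> integer cells each, for
  \<open>m = 6 * (d + 1)\<close>.\<close>

definition jordan_bound :: "nat \<Rightarrow> nat" where
  "jordan_bound d = ((12 * (d + 1) + 1)\<^sup>2) ^ (d\<^sup>2)"

text \<open>\<open>A\<close> is generated by the elements near the identity, which commute pairwise
  on \<open>V\<close>. If the matrices of \<open>g\<close> and \<open>h\<close> fall into the same
  cells, then \<open>g \<otimes> inv h\<close> is near the identity; so the cosets of
  \<open>A\<close> inject into the finite set of codes.\<close>

lemma (in fd_rep) Jordan:
  assumes "finite F" "V \<subseteq> vs.span F" "card F \<le> d"
  obtains A where "subgroup A G" "\<And>g. g \<in> carrier G \<Longrightarrow> (\<And>v. v \<in> V \<Longrightarrow> act g v = v) \<Longrightarrow> g \<in> A"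
    "finite (rcosets A)" "card (rcosets A) \<le> jordan_bound d"
    "\<And>a b v. a \<in> A \<Longrightarrow> b \<in> A \<Longrightarrow> v \<in> V \<Longrightarrow> act a (act b v) = act b (act a v)"
proof -
  obtain ip where "unitary_rep G \<rho> ip"
    using invariant_inner_product_exists by blast
  then interpret unitary_rep G \<rho> ip .
  obtain E where E: "orthonormal E" "E \<subseteq> V" "\<And>v. v \<in> V \<Longrightarrow> v = (\<Sum>e\<in>E. ip v e \<star> e)"
    by (rule orthonormal_basis_exists[OF subspace_V order_refl]) (rule that)
  have finE: "finite E" and EV: "\<And>e. e \<in> E \<Longrightarrow> e \<in> V"
    using E(1) by (auto simp: orthonormal_def)
  have cardE: "card E \<le> d"
    using orthonormal_card_le[OF E(1) assms(1,2)] assms(3) by simp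
  define S where "S = {g. near_id (1/16) g}"
  define A where "A = generate G S"
  have S: "S \<subseteq> carrier G"
    by (auto simp: S_def near_id_def)
  have A: "subgroup A G"
    unfolding A_def by (rule generate_is_subgroup[OF S])
  \<comment> \<open>Entries in the same cells differ by at most \<open>2 / m\<^sup>2\<close> in
    square, and \<open>d\<^sup>2\<close> times this has to be at most 1/16, that is,
    \<open>32 * d\<^sup>2 \<le> m\<^sup>2\<close>. The factor 6 yields 36, and \<open>d + 1\<close>
    keeps \<open>m\<close> positive.\<close>
  define m :: int where "m = 6 * (int d + 1)"
  define box :: "complex \<Rightarrow> int \<times> int" where "box z = (\<lfloor>m * Re z\<rfloor>, \<lfloor>m * Im z\<rfloor>)" for z
  define code where "code g = restrict (\<lambda>(e, f). box (ip (act g e) f)) (E \<times> E)" for g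
  define codes where "codes = PiE (E \<times> E) (\<lambda>_. {-m..m} \<times> {-m..m})"
  have box_range: "box z \<in> {-m..m} \<times> {-m..m}" if "\<bar>Re z\<bar> \<le> 1" "\<bar>Im z\<bar> \<le> 1" for z
  proof -
    have "- m \<le> \<lfloor>m * x\<rfloor> \<and> \<lfloor>m * x\<rfloor> \<le> m" if "\<bar>x\<bar> \<le> 1" for x :: real
    proof -
      have "\<bar>m * x\<bar> \<le> m"
        using that by (simp add: abs_mult m_def mult_left_le)
      then show ?thesis
        by (simp add: le_floor_iff floor_le_iff) linarith
    qed
    then show ?thesis
      using that by (simp add: box_def)
  qed
  have code_range: "code g \<in> codes" if g: "g \<in> carrier G" for g
  proof -
    have "sqnorm e = 1" if "e \<in> E" for e
      using E(1) that by (auto simp: orthonormal_def sqnorm_def)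
    then have "box (ip (act g e) f) \<in> {-m..m} \<times> {-m..m}" if "e \<in> E" "f \<in> E" for e f
      using that EV g by (intro box_range Re_Im_ip_le_1) auto
    then show ?thesis
      by (auto simp: code_def codes_def PiE_iff)
  qed
  have code_eq: "A #> g = A #> h" if g: "g \<in> carrier G" and h: "h \<in> carrier G" and eq: "code g = code h" for g h
  proof -
    have "near_id (card E * (card E * (2 / m\<^sup>2))) (g \<otimes> inv h)"
    proof (rule near_id_if_close_on_basis[OF E(1,3) g h])
      fix e f assume ef: "e \<in> E" "f \<in> E"
      have "box (ip (act g e) f) = box (ip (act h e) f)"
        using fun_cong[OF eq, of "(e, f)"] ef by (simp add: code_def)
      then have "\<bar>Re (ip (act g e) f) - Re (ip (act h e) f)\<bar> \<le> 1 / m"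
        "\<bar>Im (ip (act g e) f) - Im (ip (act h e) f)\<bar> \<le> 1 / m"
        unfolding box_def by (auto intro!: floor_eq_imp_abs_diff_le simp: m_def)
      then have "(Re (ip (act g e) f) - Re (ip (act h e) f))\<^sup>2 \<le> (1 / m)\<^sup>2"
        "(Im (ip (act g e) f) - Im (ip (act h e) f))\<^sup>2 \<le> (1 / m)\<^sup>2"
        by (metis abs_ge_zero power2_abs power_mono)+
      then show "(cmod (ip (act g e) f - ip (act h e) f))\<^sup>2 \<le> 2 / m\<^sup>2"
        by (simp add: cmod_power2 power_divide)
    qed
    moreover have "card E * (card E * (2 / m\<^sup>2)) \<le> (1/16 :: real)"
    proof -
      have "real (card E) * real (card E) \<le> real d * real d"
        using cardE by (intro mult_mono) auto
      moreover have "(real_of_int m)\<^sup>2 = 36 * (real d * real d) + 72 * real d + 36"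
        by (simp add: m_def power2_eq_square algebra_simps)
      moreover have "0 \<le> real d * real d"
        by simp
      ultimately have "32 * (real (card E) * real (card E)) \<le> (real_of_int m)\<^sup>2"
        by linarith
      moreover have "0 < (real_of_int m)\<^sup>2"
        by (simp add: m_def)
      ultimately show ?thesis
        by (simp add: field_simps)
    qed
    ultimately have "near_id (1/16) (g \<otimes> inv h)"
      unfolding near_id_def by (meson mult_right_mono order_trans sqnorm_nonneg)
    then have "g \<otimes> inv h \<in> A"
      by (simp add: A_def S_def generate.incl)
    then show ?thesis
      using A g h repr_independence[of g A h] subgroup.rcos_module_rev[OF A is_group h g] by simp
  qed
  define F where "F C = code (SOME g. g \<in> carrier G \<and> C = A #> g)" for C
  have F: "\<exists>g\<in>carrier G. C = A #> g \<and> F C = code g" if "C \<in> rcosets A" for C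
  proof -
    have "\<exists>g. g \<in> carrier G \<and> C = A #> g"
      using that by (auto simp: RCOSETS_def)
    from someI_ex[OF this] show ?thesis
      by (auto simp: F_def)
  qed
  have inj: "inj_on F (rcosets A)"
    by (rule inj_onI) (metis F code_eq)
  have img: "F ` (rcosets A) \<subseteq> codes"
    using F code_range by (metis image_subsetI)
  have fin: "finite codes"
    unfolding codes_def using finE by (intro finite_PiE) auto
  have "card codes = ((12 * (d + 1) + 1)\<^sup>2) ^ (card E * card E)"
  proof -
    have "card {-m..m} = 12 * (d + 1) + 1"
      by (simp add: m_def)
    then show ?thesis
      unfolding codes_def using finE by (simp add: card_PiE card_cartesian_product power2_eq_square)
  qed
  also have "\<dots> \<le> jordan_bound d"
    unfolding jordan_bound_def using cardE
    by (intro power_increasing) (auto simp: power2_eq_square intro!: mult_mono)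
  finally have "card codes \<le> jordan_bound d" .
  then have card: "card (rcosets A) \<le> jordan_bound d"
    using card_inj_on_le[OF inj img fin] by simp
  have comm: "act a (act b v) = act b (act a v)" if "a \<in> A" "b \<in> A" "v \<in> V" for a b v
    using generate_acts_commutatively[OF S] near_id_commute that by (simp add: A_def S_def)
  show ?thesis
  proof (rule that[OF A _ _ card comm])
    show "finite (rcosets A)"
      using inj_on_finite[OF inj img fin] .
    show "g \<in> A" if "g \<in> carrier G" "\<And>v. v \<in> V \<Longrightarrow> act g v = v" for g
      unfolding A_def using that by (intro generate.incl) (simp add: S_def near_id_def)
  qed auto
qed

section \<open>Dimensions and spaces of equivariant maps\<close>

lemma edim_less_infinity_iff: "edim s W < \<infinity> \<longleftrightarrow> (\<exists>F. finite F \<and> W \<subseteq> module.span s F)"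
  by (simp add: edim_def)

lemma edim_le_iff:
  assumes "vector_space s"
  shows "edim s W \<le> enat n \<longleftrightarrow> (\<exists>F. finite F \<and> card F \<le> n \<and> W \<subseteq> module.span s F)"
proof -
  interpret vector_space s by fact
  show ?thesis
  proof
    assume le: "edim s W \<le> enat n"
    then obtain F where F: "finite F" "W \<subseteq> span F"
      by (auto simp: edim_def split: if_splits)
    then have "dim W \<le> n"
      using le by (auto simp: edim_def split: if_splits)
    moreover obtain B where B: "B \<subseteq> W" "independent B" "W \<subseteq> span B" "card B = dim W"
      using basis_exists by metis
    moreover have "finite B"
      using independent_span_bound[OF F(1) B(2)] B(1) F(2) by blast
    ultimately show "\<exists>F. finite F \<and> card F \<le> n \<and> W \<subseteq> span F"
      by metis
  next
    assume "\<exists>F. finite F \<and> card F \<le> n \<and> W \<subseteq> span F"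
    then show "edim s W \<le> enat n"
      using dim_le_card by (auto simp: edim_def intro: order_trans)
  qed
qed

lemma edim_eq_0_iff:
  assumes "vector_space s"
  shows "edim s W = 0 \<longleftrightarrow> W \<subseteq> {0}"
proof -
  interpret vector_space s by fact
  have "edim s W = 0 \<longleftrightarrow> edim s W \<le> enat 0"
    by (simp flip: zero_enat_def)
  also have "\<dots> \<longleftrightarrow> W \<subseteq> {0}"
    unfolding edim_le_iff[OF assms] by (auto intro!: exI[of _ "{}"])
  finally show ?thesis .
qed

text \<open>Independence is asked of the indexed family, which makes it injective: two equal members
  would satisfy the relation with coefficients 1 and -1.\<close>

lemma (in vector_space) card_le_if_family_independent:
  assumes "finite I" "finite F" "\<And>i. i \<in> I \<Longrightarrow> m i \<in> span F"
    and ind: "\<And>c i. (\<Sum>i\<in>I. scale (c i) (m i)) = 0 \<Longrightarrow> i \<in> I \<Longrightarrow> c i = 0"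
  shows "card I \<le> card F"
proof -
  have inj: "inj_on m I"
  proof (rule inj_onI, rule ccontr)
    fix i j assume ij: "i \<in> I" "j \<in> I" "m i = m j" "i \<noteq> j"
    define c where "c k = (if k = i then 1 else if k = j then -1 else 0 :: 'a)" for k
    have "(\<Sum>k\<in>I. scale (c k) (m k)) = (\<Sum>k\<in>{i, j}. scale (c k) (m k))"
      using ij assms(1) by (intro sum.mono_neutral_right) (auto simp: c_def)
    also have "\<dots> = 0"
      using ij by (simp add: c_def)
    finally have "c i = 0"
      using ind ij by blast
    then show False
      by (simp add: c_def)
  qed
  have "independent (m ` I)"
  proof (rule independent_if_scalars_zero)
    show "finite (m ` I)"
      using assms by simp
    fix f x assume "(\<Sum>y\<in>m ` I. scale (f y) y) = 0" "x \<in> m ` I"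
    then show "f x = 0"
      using ind[of "\<lambda>i. f (m i)"] inj by (auto simp: sum.reindex)
  qed
  moreover have "m ` I \<subseteq> span F"
    using assms by auto
  ultimately have "card (m ` I) \<le> card F"
    using independent_span_bound[OF assms(2)] by blast
  then show ?thesis
    using inj by (simp add: card_image)
qed

lemma vector_space_pointwise_scale:
  assumes "vector_space s"
  shows "vector_space (pointwise_scale s)"
proof -
  interpret vector_space s by fact
  show ?thesis
    by unfold_locales
      (auto simp: pointwise_scale_def fun_eq_iff scale_right_distrib scale_left_distrib)
qed

lemma vector_space_complex: "vector_space ((*) :: complex \<Rightarrow> complex \<Rightarrow> complex)"
  by unfold_locales (auto simp: algebra_simps)

text \<open>Carries finite-dimensionality from one space of equivariant maps to another. An
  inclusion in the image is enough, so \<open>L\<close> may be any linear operation on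
  functions.\<close>

lemma finite_span_linear_image:
  assumes s: "vector_space s1" "vector_space s2"
    and L: "\<And>f g. L (f + g) = L f + L g" "\<And>c f. L (s1 c f) = s2 c (L f)"
    and Y: "\<exists>F. finite F \<and> Y \<subseteq> module.span s1 F" and sub: "A \<subseteq> L ` Y"
  shows "\<exists>F. finite F \<and> A \<subseteq> module.span s2 F"
proof -
  interpret s1: vector_space s1 by fact
  interpret s2: vector_space s2 by fact
  interpret module_hom s1 s2 L
    by unfold_locales (use L in auto)
  obtain F where F: "finite F" "Y \<subseteq> s1.span F"
    using Y by blast
  then have "A \<subseteq> s2.span (L ` F)"
    using spans_image[OF F(2)] sub by blast
  then show ?thesis
    using F by blast
qed

lemma hom_repD:
  assumes "f \<in> hom_rep G \<rho> \<sigma>"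
  shows "\<And>v. v \<in> rep_space \<rho> \<Longrightarrow> f v \<in> rep_space \<sigma>"
    "\<And>v. v \<notin> rep_space \<rho> \<Longrightarrow> f v = 0"
    "\<And>v w. v \<in> rep_space \<rho> \<Longrightarrow> w \<in> rep_space \<rho> \<Longrightarrow> f (v + w) = f v + f w"
    "\<And>c v. v \<in> rep_space \<rho> \<Longrightarrow> f (rep_scale \<rho> c v) = rep_scale \<sigma> c (f v)"
    "\<And>g v. g \<in> carrier G \<Longrightarrow> v \<in> rep_space \<rho> \<Longrightarrow> f (rep_act \<rho> g v) = rep_act \<sigma> g (f v)"
  using assms by (auto simp: hom_rep_def)

lemma representation_space:
  assumes "representation G \<rho>"
  shows "0 \<in> rep_space \<rho>"
    and "\<And>v w. v \<in> rep_space \<rho> \<Longrightarrow> w \<in> rep_space \<rho> \<Longrightarrow> v + w \<in> rep_space \<rho>"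
    and "\<And>c v. v \<in> rep_space \<rho> \<Longrightarrow> rep_scale \<rho> c v \<in> rep_space \<rho>"
    and "\<And>g v. g \<in> carrier G \<Longrightarrow> v \<in> rep_space \<rho> \<Longrightarrow> rep_act \<rho> g v \<in> rep_space \<rho>"
proof -
  interpret vector_space "rep_scale \<rho>"
    using assms by (simp add: representation_def)
  have "subspace (rep_space \<rho>)"
    using assms by (simp add: Defs.representation_def)
  then show "0 \<in> rep_space \<rho>"
    and "\<And>v w. v \<in> rep_space \<rho> \<Longrightarrow> w \<in> rep_space \<rho> \<Longrightarrow> v + w \<in> rep_space \<rho>"
    and "\<And>c v. v \<in> rep_space \<rho> \<Longrightarrow> rep_scale \<rho> c v \<in> rep_space \<rho>"
    by (simp_all add: subspace_def)
  show "\<And>g v. g \<in> carrier G \<Longrightarrow> v \<in> rep_space \<rho> \<Longrightarrow> rep_act \<rho> g v \<in> rep_space \<rho>"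
    using assms by (simp add: Defs.representation_def)
qed

lemma hom_rep_0:
  assumes "representation G \<rho>" "vector_space (rep_scale \<sigma>)" "f \<in> hom_rep G \<rho> \<sigma>"
  shows "f 0 = 0"
proof -
  interpret s: vector_space "rep_scale \<sigma>" by fact
  interpret r: vector_space "rep_scale \<rho>"
    using assms by (simp add: representation_def)
  have "0 \<in> rep_space \<rho>"
    using assms r.subspace_0 by (simp add: representation_def)
  then show ?thesis
    using hom_repD(4)[OF assms(3), of 0 0] by simp
qed

lemma hom_rep_comp:
  assumes "representation G \<rho>" "representation G \<sigma>" "representation G \<tau>"
    and f: "f \<in> hom_rep G \<rho> \<sigma>" and g: "g \<in> hom_rep G \<sigma> \<tau>"
  shows "g \<circ> f \<in> hom_rep G \<rho> \<tau>"
  using hom_rep_0[OF assms(2) _ g] assms(3) hom_repD[OF f] hom_repD[OF g]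
  by (simp add: hom_rep_def representation_def)

context lin_rep
begin

lemma hom_rep_restrict:
  assumes "f \<in> hom_rep G \<rho> \<sigma>" "invariant_subspace G \<rho> U"
  shows "(\<lambda>v. if v \<in> U then f v else 0) \<in> hom_rep G (\<rho>\<lparr>rep_space := U\<rparr>) \<sigma>"
  using assms(2) hom_repD[OF assms(1)]
  by (auto simp: hom_rep_def invariant_subspace_def subset_iff vs.subspace_add vs.subspace_scale)

lemma hom_rep_inclusion:
  assumes "invariant_subspace G \<rho> U"
  shows "(\<lambda>v. if v \<in> U then v else 0) \<in> hom_rep G (\<rho>\<lparr>rep_space := U\<rparr>) \<rho>"
  using assms
  by (auto simp: hom_rep_def invariant_subspace_def subset_iff vs.subspace_add vs.subspace_scale)

lemma hom_rep_kernel_invariant: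
  assumes "vector_space (rep_scale \<sigma>)" "f \<in> hom_rep G \<rho> \<sigma>" "representation G \<sigma>"
  shows "invariant_subspace G \<rho> {v \<in> V. f v = 0}"
proof -
  interpret s: lin_rep G \<sigma>
    using assms is_group by (simp add: lin_rep_def lin_rep_axioms_def)
  show ?thesis
    using hom_repD[OF assms(2)] hom_rep_0[OF rep assms(1,2)]
    by (auto simp: invariant_subspace_def vs.subspace_def)
qed

lemma hom_rep_image_invariant:
  assumes "vector_space (rep_scale \<sigma>)" "f \<in> hom_rep G \<rho> \<sigma>"
  shows "invariant_subspace G \<sigma> (f ` V)"
proof -
  interpret s: vector_space "rep_scale \<sigma>" by fact
  have "s.subspace (f ` V)"
    unfolding s.subspace_def
  proof (intro conjI ballI allI)
    show "0 \<in> f ` V"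
      using hom_rep_0[OF rep assms] V_zero by (metis imageI)
    show "x + y \<in> f ` V" if "x \<in> f ` V" "y \<in> f ` V" for x y
      using that hom_repD(3)[OF assms(2)] V_add by (metis (no_types, lifting) imageE imageI)
    show "rep_scale \<sigma> c x \<in> f ` V" if "x \<in> f ` V" for c x
      using that hom_repD(4)[OF assms(2)] V_scale by (metis (no_types, lifting) imageE imageI)
  qed
  moreover have "rep_act \<sigma> g x \<in> f ` V" if "g \<in> carrier G" "x \<in> f ` V" for g x
    using that hom_repD(5)[OF assms(2)] act_closed by (metis (no_types, lifting) imageE imageI)
  ultimately show ?thesis
    using hom_repD(1)[OF assms(2)] by (auto simp: invariant_subspace_def)
qed

lemma hom_rep_inj_on:
  assumes "vector_space (rep_scale \<sigma>)" "f \<in> hom_rep G \<rho> \<sigma>" "{v \<in> V. f v = 0} \<subseteq> {0}"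
  shows "inj_on f V"
proof (rule inj_onI)
  fix v w assume vw: "v \<in> V" "w \<in> V" "f v = f w"
  have "f v = f (v - w) + f w"
    using hom_repD(3)[OF assms(2), of "v - w" w] vw by simp
  then have "v - w \<in> {v \<in> V. f v = 0}"
    using vw by simp
  then show "v = w"
    using assms(3) by (metis right_minus_eq singletonD subsetD)
qed

end

lemma lin_rep_iff: "lin_rep G \<rho> \<longleftrightarrow> group G \<and> representation G \<rho>"
  by (simp add: lin_rep_def lin_rep_axioms_def)

lemma hom_rep_irreducible_inj_on:
  assumes "group G" "irreducible_rep G \<rho>" "representation G \<sigma>"
    and f: "f \<in> hom_rep G \<rho> \<sigma>" "f \<noteq> 0"
  shows "inj_on f (rep_space \<rho>)"
proof -
  interpret lin_rep G \<rho>
    using assms by (simp add: lin_rep_iff irreducible_rep_def)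
  have s: "vector_space (rep_scale \<sigma>)"
    using assms by (simp add: representation_def)
  have "{v \<in> V. f v = 0} \<noteq> V"
    using f hom_repD(2)[OF f(1)] by (auto simp: fun_eq_iff)
  then have "{v \<in> V. f v = 0} = {0}"
    using hom_rep_kernel_invariant[OF s f(1) assms(3)] assms(2) by (auto simp: irreducible_rep_iff)
  then show ?thesis
    using hom_rep_inj_on[OF s f(1)] by simp
qed

lemma Schur:
  assumes "group G" "irreducible_rep G \<rho>" "irreducible_rep G \<sigma>"
    and f: "f \<in> hom_rep G \<rho> \<sigma>" "f \<noteq> 0"
  shows "iso_rep G \<rho> \<sigma>"
proof -
  interpret lin_rep G \<rho>
    using assms by (simp add: lin_rep_iff irreducible_rep_def)
  have s: "representation G \<sigma>" "vector_space (rep_scale \<sigma>)"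
    using assms by (simp_all add: representation_def irreducible_rep_def)
  have "f ` V \<noteq> {0}"
    using f hom_repD(2)[OF f(1)] by (auto simp: fun_eq_iff)
  then have "f ` V = rep_space \<sigma>"
    using hom_rep_image_invariant[OF s(2) f(1)] assms(3) by (auto simp: irreducible_rep_iff)
  then show ?thesis
    using hom_rep_irreducible_inj_on[OF assms(1,2) s(1) f] f(1) by (auto simp: iso_rep_def bij_betw_def)
qed

lemma iso_rep_refl:
  assumes "representation G \<rho>"
  shows "iso_rep G \<rho> \<rho>"
proof -
  have "(\<lambda>v. if v \<in> rep_space \<rho> then v else 0) \<in> hom_rep G \<rho> \<rho>"
    using representation_space[OF assms] by (auto simp: hom_rep_def)
  moreover have "bij_betw (\<lambda>v. if v \<in> rep_space \<rho> then v else 0) (rep_space \<rho>) (rep_space \<rho>)"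
    by (auto simp: bij_betw_def inj_on_def)
  ultimately show ?thesis
    unfolding iso_rep_def by blast
qed

lemma iso_rep_inverse:
  assumes "representation G \<rho>" "f \<in> hom_rep G \<rho> \<sigma>" "bij_betw f (rep_space \<rho>) (rep_space \<sigma>)"
  obtains g where "g \<in> hom_rep G \<sigma> \<rho>" "bij_betw g (rep_space \<sigma>) (rep_space \<rho>)"
    "\<And>v. v \<in> rep_space \<rho> \<Longrightarrow> g (f v) = v" "\<And>w. w \<in> rep_space \<sigma> \<Longrightarrow> f (g w) = w"
proof -
  interpret vs: vector_space "rep_scale \<rho>"
    using assms by (simp add: representation_def)
  define g where "g w = (if w \<in> rep_space \<sigma> then inv_into (rep_space \<rho>) f w else 0)" for w
  have inj: "inj_on f (rep_space \<rho>)" and img: "f ` rep_space \<rho> = rep_space \<sigma>"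
    using assms(3) by (auto simp: bij_betw_def)
  have gV: "g w \<in> rep_space \<rho>" and fg: "f (g w) = w" if "w \<in> rep_space \<sigma>" for w
    using that img by (auto simp: g_def inv_into_into f_inv_into_f)
  have gf: "g (f v) = v" if "v \<in> rep_space \<rho>" for v
    using that inj img by (auto simp: g_def)
  have V: "v + w \<in> rep_space \<rho>" "rep_scale \<rho> c v \<in> rep_space \<rho>"
    if "v \<in> rep_space \<rho>" "w \<in> rep_space \<rho>" for v w c
    using assms(1) that vs.subspace_add vs.subspace_scale by (auto simp: representation_def)
  have act: "rep_act \<rho> k v \<in> rep_space \<rho>" if "k \<in> carrier G" "v \<in> rep_space \<rho>" for k v
    using assms(1) that by (auto simp: representation_def)
  have "g (w + x) = g w + g x" if "w \<in> rep_space \<sigma>" "x \<in> rep_space \<sigma>" for w x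
    using gf[of "g w + g x"] hom_repD(3)[OF assms(2) gV gV, OF that] V(1)[OF gV gV, OF that] fg that
    by metis
  moreover have "g (rep_scale \<sigma> c w) = rep_scale \<rho> c (g w)" if "w \<in> rep_space \<sigma>" for c w
    using gf[of "rep_scale \<rho> c (g w)"] hom_repD(4)[OF assms(2) gV[OF that]] V(2)[OF gV gV, OF that that] fg that
    by metis
  moreover have "g (rep_act \<sigma> k w) = rep_act \<rho> k (g w)" if "k \<in> carrier G" "w \<in> rep_space \<sigma>" for k w
    using gf[of "rep_act \<rho> k (g w)"] hom_repD(5)[OF assms(2) that(1) gV[OF that(2)]] act[OF that(1) gV[OF that(2)]] fg that
    by metis
  ultimately have "g \<in> hom_rep G \<sigma> \<rho>"
    using gV by (auto simp: hom_rep_def g_def)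
  moreover have "bij_betw g (rep_space \<sigma>) (rep_space \<rho>)"
    by (rule bij_betw_byWitness[of _ f]) (use gf fg gV img in auto)
  ultimately show ?thesis
    using that gf fg by blast
qed

lemma iso_rep_sym: "representation G \<rho> \<Longrightarrow> iso_rep G \<rho> \<sigma> \<Longrightarrow> iso_rep G \<sigma> \<rho>"
  unfolding iso_rep_def by (metis iso_rep_inverse)

lemma iso_rep_trans:
  assumes "representation G \<rho>" "representation G \<sigma>" "representation G \<tau>"
    and "iso_rep G \<rho> \<sigma>" "iso_rep G \<sigma> \<tau>"
  shows "iso_rep G \<rho> \<tau>"
proof -
  obtain f g where "f \<in> hom_rep G \<rho> \<sigma>" "bij_betw f (rep_space \<rho>) (rep_space \<sigma>)"
    "g \<in> hom_rep G \<sigma> \<tau>" "bij_betw g (rep_space \<sigma>) (rep_space \<tau>)"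
    using assms(4,5) by (auto simp: iso_rep_def)
  then have "g \<circ> f \<in> hom_rep G \<rho> \<tau>" "bij_betw (g \<circ> f) (rep_space \<rho>) (rep_space \<tau>)"
    using hom_rep_comp[OF assms(1-3)] bij_betw_trans by blast+
  then show ?thesis
    unfolding iso_rep_def by blast
qed

text \<open>Multiplicities depend only on the isomorphism class: precomposition with an isomorphism is
  a linear operation on all functions.\<close>

lemma
  assumes reps: "representation G \<pi>" "representation G \<pi>'" "representation G \<rho>" and iso: "iso_rep G \<pi> \<pi>'"
  shows multiplicity_rep_finite_iso:
      "multiplicity_rep G \<pi> \<rho> < \<infinity> \<Longrightarrow> multiplicity_rep G \<pi>' \<rho> < \<infinity>"
    and hom_rep_trivial_iso: "hom_rep G \<pi> \<rho> \<subseteq> {0} \<Longrightarrow> hom_rep G \<pi>' \<rho> \<subseteq> {0}"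
proof -
  obtain f where f: "f \<in> hom_rep G \<pi> \<pi>'" "bij_betw f (rep_space \<pi>) (rep_space \<pi>')"
    using iso by (auto simp: iso_rep_def)
  obtain g where g: "g \<in> hom_rep G \<pi>' \<pi>" "\<And>w. w \<in> rep_space \<pi>' \<Longrightarrow> f (g w) = w"
    using iso_rep_inverse[OF reps(1) f] by metis
  have vs: "vector_space (rep_scale \<rho>)"
    using reps by (simp add: representation_def)
  have sub: "hom_rep G \<pi>' \<rho> \<subseteq> (\<lambda>F. F \<circ> g) ` hom_rep G \<pi> \<rho>"
  proof
    fix F assume F: "F \<in> hom_rep G \<pi>' \<rho>"
    \<comment> \<open>Off their domains all these maps are 0, and they send 0 to 0, so the identity
      holds on the whole type.\<close>
    have "F w = F (f (g w))" for w
    proof (cases "w \<in> rep_space \<pi>'")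
      case False
      have vs': "vector_space (rep_scale \<pi>)" "vector_space (rep_scale \<pi>')"
        using reps by (auto simp: representation_def)
      have "g w = 0"
        using False hom_repD(2)[OF g(1)] by simp
      then show ?thesis
        using False hom_repD(2)[OF F] hom_rep_0[OF reps(1) vs'(2) f(1)] hom_rep_0[OF reps(2) vs F] by simp
    qed (simp add: g)
    then have "F = (F \<circ> f) \<circ> g"
      by (simp add: fun_eq_iff)
    then show "F \<in> (\<lambda>F. F \<circ> g) ` hom_rep G \<pi> \<rho>"
      using hom_rep_comp[OF reps f(1) F] by blast
  qed
  show "hom_rep G \<pi>' \<rho> \<subseteq> {0}" if "hom_rep G \<pi> \<rho> \<subseteq> {0}"
  proof
    fix F assume "F \<in> hom_rep G \<pi>' \<rho>"
    then obtain F' where "F' \<in> hom_rep G \<pi> \<rho>" "F = F' \<circ> g"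
      using sub by blast
    then show "F \<in> {0}"
      using that by (auto simp: fun_eq_iff)
  qed
  show "multiplicity_rep G \<pi>' \<rho> < \<infinity>" if "multiplicity_rep G \<pi> \<rho> < \<infinity>"
    unfolding multiplicity_rep_def edim_less_infinity_iff
    by (rule finite_span_linear_image[OF vector_space_pointwise_scale[OF vs] vector_space_pointwise_scale[OF vs]
            _ _ that[unfolded multiplicity_rep_def edim_less_infinity_iff] sub])
      (auto simp: fun_eq_iff pointwise_scale_def)
qed

text \<open>The spanning set supplied by the degree may lie outside \<open>rep_space \<pi>\<close>,
  where \<open>f\<close> is not linear; hence the passage to a basis \<open>B\<close> inside
  it.\<close>

lemma degree_rep_le_iso:
  assumes reps: "representation G \<pi>" "representation G \<pi>'" and iso: "iso_rep G \<pi> \<pi>'"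
    and le: "degree_rep \<pi> \<le> enat n"
  shows "degree_rep \<pi>' \<le> enat n"
proof -
  interpret p: vector_space "rep_scale \<pi>"
    using reps by (simp add: representation_def)
  interpret q: vector_space "rep_scale \<pi>'"
    using reps by (simp add: representation_def)
  obtain f where f: "f \<in> hom_rep G \<pi> \<pi>'" "bij_betw f (rep_space \<pi>) (rep_space \<pi>')"
    using iso by (auto simp: iso_rep_def)
  obtain F where F: "finite F" "card F \<le> n" "rep_space \<pi> \<subseteq> p.span F"
    using le unfolding degree_rep_def edim_le_iff[OF p.vector_space_axioms] by blast
  obtain B where B: "B \<subseteq> rep_space \<pi>" "p.independent B" "rep_space \<pi> \<subseteq> p.span B"
    using p.basis_exists by metis
  have finB: "finite B" "card B \<le> n"
    using p.independent_span_bound[OF F(1) B(2)] B(1) F(2,3) F(2) le_trans[OF _ F(2)] by blast+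
  have sub: "p.subspace (rep_space \<pi>)"
    using reps by (simp add: representation_def)
  have "f v \<in> q.span (f ` B) \<and> v \<in> rep_space \<pi>" if "v \<in> p.span B" for v
    using that
  proof (induction rule: p.span_induct_alt)
    case base
    then show ?case
      using hom_rep_0[OF reps(1) q.vector_space_axioms f(1)] p.subspace_0[OF sub] q.span_zero by simp
  next
    case (step c x y)
    then have "x \<in> rep_space \<pi>" "rep_scale \<pi> c x \<in> rep_space \<pi>"
      using B(1) p.subspace_scale[OF sub] by auto
    then show ?case
      using step hom_repD(3,4)[OF f(1)] p.subspace_add[OF sub]
      by (simp add: q.span_add q.span_scale q.span_base)
  qed
  then have "f ` rep_space \<pi> \<subseteq> q.span (f ` B)"
    using B(3) by blast
  then have "rep_space \<pi>' \<subseteq> q.span (f ` B)"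
    using f(2) by (simp add: bij_betw_def)
  moreover have "card (f ` B) \<le> n"
    using finB card_image_le[of B f] by simp
  ultimately show ?thesis
    unfolding degree_rep_def edim_le_iff[OF q.vector_space_axioms] using finB by blast
qed

subsection \<open>Weights\<close>

text \<open>The value 0 off \<open>K\<close> makes a weight the same thing as its values on
  \<open>K\<close>, so that finiteness of this set counts characters.\<close>

definition weights :: "'g set \<Rightarrow> ('g, 'v::ab_group_add) rep \<Rightarrow> ('g \<Rightarrow> complex) set" where
  "weights K \<rho> = {\<theta>. (\<forall>g. g \<notin> K \<longrightarrow> \<theta> g = 0) \<and>
     (\<exists>v\<in>rep_space \<rho>. v \<noteq> 0 \<and> (\<forall>k\<in>K. rep_act \<rho> k v = rep_scale \<rho> (\<theta> k) v))}"

lemma weights_mono_hom: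
  assumes f: "f \<in> hom_rep G \<rho> \<sigma>" "inj_on f (rep_space \<rho>)" and "representation G \<rho>" "vector_space (rep_scale \<sigma>)"
    and K: "K \<subseteq> carrier G"
  shows "weights K \<rho> \<subseteq> weights K \<sigma>"
proof
  fix \<theta> assume "\<theta> \<in> weights K \<rho>"
  then obtain v where v: "v \<in> rep_space \<rho>" "v \<noteq> 0" "\<And>k. k \<in> K \<Longrightarrow> rep_act \<rho> k v = rep_scale \<rho> (\<theta> k) v"
    and \<theta>: "\<And>g. g \<notin> K \<Longrightarrow> \<theta> g = 0"
    by (auto simp: weights_def)
  have f0: "f 0 = 0"
    using hom_rep_0 assms by blast
  have "0 \<in> rep_space \<rho>"
    using representation_space(1) assms(3) .
  then have "f v \<noteq> 0"
    using f(2) v f0 by (metis inj_onD)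
  moreover have "rep_act \<sigma> k (f v) = rep_scale \<sigma> (\<theta> k) (f v)" if "k \<in> K" for k
    using hom_repD(4)[OF f(1) v(1), of "\<theta> k"] hom_repD(5)[OF f(1) _ v(1), of k] v(3)[OF that] that K by auto
  ultimately show "\<theta> \<in> weights K \<sigma>"
    using \<theta> hom_repD(1)[OF f(1) v(1)] by (auto simp: weights_def)
qed

lemma (in lin_rep) weight_vectors_independent:
  assumes I: "finite I" and K: "K \<subseteq> carrier G"
    and m: "\<And>\<theta>. \<theta> \<in> I \<Longrightarrow> m \<theta> \<in> V \<and> (\<forall>k\<in>K. act k (m \<theta>) = \<theta> k \<star> m \<theta>)"
    and I0: "\<And>\<theta> g. \<theta> \<in> I \<Longrightarrow> g \<notin> K \<Longrightarrow> \<theta> g = 0"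
    and sum0: "(\<Sum>\<theta>\<in>I. m \<theta>) = 0" and "\<theta> \<in> I"
  shows "m \<theta> = 0"
  using I m I0 sum0 \<open>\<theta> \<in> I\<close>
proof (induction I arbitrary: m \<theta> rule: finite_induct)
  case empty
  then show ?case by simp
next
  case (insert \<eta> I)
  have mV: "m \<theta> \<in> V" "k \<in> K \<Longrightarrow> act k (m \<theta>) = \<theta> k \<star> m \<theta>" if "\<theta> \<in> insert \<eta> I" for \<theta> k
    using insert.prems(1)[OF that] by auto
  have m0: "m \<theta> = 0" if \<theta>: "\<theta> \<in> I" for \<theta>
  proof -
    obtain k where k: "\<theta> k \<noteq> \<eta> k"
      using \<theta> insert.hyps by (metis ext)
    then have kK: "k \<in> K"
      using insert.prems(2) \<theta> by (metis insertCI)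
    have "(\<Sum>\<theta>\<in>I. (\<theta> k - \<eta> k) \<star> m \<theta>) = (\<Sum>\<theta>\<in>insert \<eta> I. (\<theta> k - \<eta> k) \<star> m \<theta>)"
      using insert.hyps by simp
    also have "\<dots> = (\<Sum>\<theta>\<in>insert \<eta> I. act k (m \<theta>)) - \<eta> k \<star> (\<Sum>\<theta>\<in>insert \<eta> I. m \<theta>)"
      using mV(2) kK by (simp add: vs.scale_left_diff_distrib sum_subtractf vs.scale_sum_right del: sum.insert)
    also have "(\<Sum>\<theta>\<in>insert \<eta> I. act k (m \<theta>)) = act k (\<Sum>\<theta>\<in>insert \<eta> I. m \<theta>)"
      using mV(1) kK K insert.hyps by (subst act_sum) auto
    finally have *: "(\<Sum>\<theta>\<in>I. (\<theta> k - \<eta> k) \<star> m \<theta>) = 0"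
      using insert.prems(3) kK K by (simp add: subset_iff)
    have "(\<theta> k - \<eta> k) \<star> m \<theta> = 0"
    proof (rule insert.IH[OF _ _ * \<theta>])
      fix \<xi> assume \<xi>: "\<xi> \<in> I"
      then show "(\<xi> k - \<eta> k) \<star> m \<xi> \<in> V \<and> (\<forall>l\<in>K. act l ((\<xi> k - \<eta> k) \<star> m \<xi>) = \<xi> l \<star> (\<xi> k - \<eta> k) \<star> m \<xi>)"
        using mV K by (auto simp: subset_iff vs.scale_left_commute)
    qed (use insert.prems(2) in auto)
    then show ?thesis
      using k by simp
  qed
  moreover have "m \<eta> = 0"
    using insert.prems(3) insert.hyps m0 by simp
  ultimately show ?case
    using insert.prems(4) by auto
qed

lemma (in lin_rep) finite_weights:
  assumes fd: "\<exists>F. finite F \<and> V \<subseteq> vs.span F" and K: "K \<subseteq> carrier G"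
  shows "finite (weights K \<rho>)"
proof -
  obtain F where F: "finite F" "V \<subseteq> vs.span F"
    using fd by blast
  have "\<forall>\<theta>\<in>weights K \<rho>. \<exists>v\<in>V. v \<noteq> 0 \<and> (\<forall>k\<in>K. act k v = \<theta> k \<star> v)"
    by (auto simp: weights_def)
  then obtain m where m: "\<And>\<theta>. \<theta> \<in> weights K \<rho> \<Longrightarrow> m \<theta> \<in> V \<and> m \<theta> \<noteq> 0 \<and> (\<forall>k\<in>K. act k (m \<theta>) = \<theta> k \<star> m \<theta>)"
    by metis
  have "card I \<le> card F" if I: "finite I" "I \<subseteq> weights K \<rho>" for I
  proof (rule vs.card_le_if_family_independent[OF I(1) F(1)])
    show "m \<theta> \<in> vs.span F" if "\<theta> \<in> I" for \<theta>
      using m that I F by blast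
    fix c \<theta> assume c: "(\<Sum>\<theta>\<in>I. c \<theta> \<star> m \<theta>) = 0" and \<theta>: "\<theta> \<in> I"
    have "c \<theta> \<star> m \<theta> = 0"
    proof (rule weight_vectors_independent[OF I(1) K _ _ c \<theta>])
      show "c \<xi> \<star> m \<xi> \<in> V \<and> (\<forall>k\<in>K. act k (c \<xi> \<star> m \<xi>) = \<xi> k \<star> c \<xi> \<star> m \<xi>)" if "\<xi> \<in> I" for \<xi>
        using m[of \<xi>] that I(2) K by (auto simp: subset_iff vs.scale_left_commute)
    qed (use I(2) in \<open>auto simp: weights_def\<close>)
    then show "c \<theta> = 0"
      using m \<theta> I(2) by auto
  qed
  then show ?thesis
    using finite_if_finite_subsets_card_bdd by metis
qed

text \<open>Isotypic components for different irreducible representations are independent: a relation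
  would give a nonzero equivariant map between two of them.\<close>

lemma irreducible_images_independent:
  assumes G: "group G" and M: "representation G M"
    and I: "finite I" and irr: "\<And>i. i \<in> I \<Longrightarrow> irreducible_rep G (\<pi> i)"
    and noniso: "\<And>i j. i \<in> I \<Longrightarrow> j \<in> I \<Longrightarrow> i \<noteq> j \<Longrightarrow> \<not> iso_rep G (\<pi> i) (\<pi> j)"
    and \<phi>: "\<And>i. i \<in> I \<Longrightarrow> \<phi> i \<in> hom_rep G (\<pi> i) M \<and> \<phi> i \<noteq> 0"
    and v: "\<And>i. i \<in> I \<Longrightarrow> v i \<in> rep_space (\<pi> i)" and sum0: "(\<Sum>i\<in>I. \<phi> i (v i)) = 0" and "i \<in> I"
  shows "v i = 0"
  using I irr noniso \<phi> v sum0 \<open>i \<in> I\<close>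
proof (induction I arbitrary: v i rule: finite_induct)
  case empty
  then show ?case by simp
next
  case (insert j I)
  interpret M: lin_rep G M
    using G M by (simp add: lin_rep_iff)
  have lr: "lin_rep G (\<pi> i)" if "i \<in> insert j I" for i
    using insert.prems(1)[OF that] G by (simp add: lin_rep_iff irreducible_rep_def)
  interpret J: lin_rep G "\<pi> j"
    using lr by simp
  have hom: "\<phi> i \<in> hom_rep G (\<pi> i) M" if "i \<in> insert j I" for i
    using insert.prems(3)[OF that] by simp
  have \<phi>0: "\<phi> i 0 = 0" if "i \<in> insert j I" for i
    using hom_rep_0[OF _ M.vs.vector_space_axioms hom[OF that]] lr[OF that] by (simp add: lin_rep_iff)
  have IH: "u i = 0" if "\<And>i. i \<in> I \<Longrightarrow> u i \<in> rep_space (\<pi> i)" "(\<Sum>i\<in>I. \<phi> i (u i)) = 0" "i \<in> I" for u i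
    using insert.IH[of u i] insert.prems that by blast
  \<comment> \<open>\<open>sol x u\<close> expresses the image of \<open>x\<close> through the
    components in \<open>I\<close>. The induction hypothesis makes \<open>u\<close> unique, so its
    entries depend linearly and equivariantly on \<open>x\<close>.\<close>
  define sol where "sol x u \<longleftrightarrow> (\<forall>i\<in>I. u i \<in> rep_space (\<pi> i)) \<and> \<phi> j x = (\<Sum>i\<in>I. \<phi> i (u i))" for x u
  have sol0: "sol 0 (\<lambda>i. 0)"
    using \<phi>0 lr lin_rep.V_zero by (auto simp: sol_def)
  have sol_add: "sol (x + y) (\<lambda>i. u i + w i)" if "sol x u" "sol y w" "x \<in> J.V" "y \<in> J.V" for x y u w
    using that hom_repD(3)[OF hom] lin_rep.V_add[OF lr]
    by (auto simp: sol_def sum.distrib[symmetric] intro!: sum.cong)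
  have sol_scale: "sol (rep_scale (\<pi> j) c x) (\<lambda>i. rep_scale (\<pi> i) c (u i))" if "sol x u" "x \<in> J.V" for c x u
    using that hom_repD(4)[OF hom] lin_rep.V_scale[OF lr]
    by (auto simp: sol_def M.vs.scale_sum_right intro!: sum.cong)
  have sol_act: "sol (rep_act (\<pi> j) g x) (\<lambda>i. rep_act (\<pi> i) g (u i))" if "sol x u" "x \<in> J.V" "g \<in> carrier G" for g x u
  proof -
    have "rep_act M g (\<Sum>i\<in>I. \<phi> i (u i)) = (\<Sum>i\<in>I. rep_act M g (\<phi> i (u i)))"
      using that insert.hyps hom_repD(1)[OF hom] by (intro M.act_sum) (auto simp: sol_def)
    then show ?thesis
      using that hom_repD(5)[OF hom] lin_rep.act_closed[OF lr]
      by (auto simp: sol_def intro!: sum.cong)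
  qed
  have uniq: "u i = w i" if "sol x u" "sol x w" "i \<in> I" for x u w i
  proof -
    have "(\<Sum>i\<in>I. \<phi> i (u i - w i)) = 0"
    proof -
      have "\<phi> i (u i - w i) = \<phi> i (u i) - \<phi> i (w i)" if "i \<in> I" for i
      proof -
        have "u i - w i \<in> rep_space (\<pi> i)" "w i \<in> rep_space (\<pi> i)"
          using \<open>sol x u\<close> \<open>sol x w\<close> that lin_rep.V_diff[OF lr] by (auto simp: sol_def)
        then show ?thesis
          using hom_repD(3)[OF hom, of i "u i - w i" "w i"] that by simp
      qed
      then show ?thesis
        using that by (simp add: sum_subtractf sol_def)
    qed
    moreover have "u i - w i \<in> rep_space (\<pi> i)" if "i \<in> I" for i
      using \<open>sol x u\<close> \<open>sol x w\<close> that lin_rep.V_diff[OF lr] by (auto simp: sol_def)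
    ultimately show ?thesis
      using IH[of "\<lambda>i. u i - w i" i] that(3) by simp
  qed
  \<comment> \<open>\<open>U\<close> is invariant, hence zero or everything. In the second case some
    entry of the solution would be a nonzero equivariant map from \<open>\<pi> j\<close> to another
    \<open>\<pi> i\<close>, against Schur's lemma.\<close>
  define U where "U = {x \<in> J.V. \<exists>u. sol x u}"
  have "invariant_subspace G (\<pi> j) U"
    unfolding invariant_subspace_def J.vs.subspace_def U_def
    using sol0 sol_add sol_scale sol_act by (auto; blast)
  then have "U = {0} \<or> U = J.V"
    using insert.prems(1)[of j] by (simp add: irreducible_rep_iff)
  moreover have "U \<noteq> J.V"
  proof
    assume "U = J.V"
    then have "\<forall>x\<in>J.V. \<exists>u. sol x u"
      by (auto simp: U_def)
    then obtain \<psi> where \<psi>: "\<And>x. x \<in> J.V \<Longrightarrow> sol x (\<psi> x)"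
      by metis
    define f where "f i x = (if x \<in> J.V then \<psi> x i else 0)" for i x
    have fhom: "f i \<in> hom_rep G (\<pi> j) (\<pi> i)" if i: "i \<in> I" for i
    proof -
      have "\<psi> (x + y) i = \<psi> x i + \<psi> y i" if "x \<in> J.V" "y \<in> J.V" for x y
        by (rule uniq[OF \<psi> sol_add i]) (use that \<psi> in auto)
      moreover have "\<psi> (rep_scale (\<pi> j) c x) i = rep_scale (\<pi> i) c (\<psi> x i)" if "x \<in> J.V" for c x
        by (rule uniq[OF \<psi> sol_scale i]) (use that \<psi> in auto)
      moreover have "\<psi> (rep_act (\<pi> j) g x) i = rep_act (\<pi> i) g (\<psi> x i)" if "x \<in> J.V" "g \<in> carrier G" for g x
        by (rule uniq[OF \<psi> sol_act i]) (use that \<psi> in auto)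
      moreover have "\<psi> x i \<in> rep_space (\<pi> i)" if "x \<in> J.V" for x
        using \<psi>[OF that] i by (simp add: sol_def)
      ultimately show ?thesis
        by (auto simp: hom_rep_def f_def)
    qed
    have "\<exists>x\<in>J.V. \<phi> j x \<noteq> 0"
      using insert.prems(3)[of j] hom_repD(2)[OF hom, of j] by (auto simp: fun_eq_iff)
    then obtain x where x: "x \<in> J.V" "\<phi> j x \<noteq> 0"
      by blast
    have "\<exists>i\<in>I. \<psi> x i \<noteq> 0"
    proof (rule ccontr)
      assume "\<not> ?thesis"
      then have "(\<Sum>i\<in>I. \<phi> i (\<psi> x i)) = 0"
        using \<phi>0 by (intro sum.neutral) simp
      then show False
        using \<psi>[OF x(1)] x(2) by (simp add: sol_def)
    qed
    then obtain i where i: "i \<in> I" "\<psi> x i \<noteq> 0"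
      by blast
    then have "f i \<noteq> 0"
      using x by (auto simp: f_def fun_eq_iff)
    then have "iso_rep G (\<pi> j) (\<pi> i)"
      using Schur[OF G _ _ fhom[OF i(1)]] insert.prems(1) i(1) by simp
    then show False
      using insert.prems(2)[of j i] insert.hyps i(1) by auto
  qed
  ultimately have U0: "U = {0}" by simp
  have vi: "v i \<in> rep_space (\<pi> i)" if "i \<in> insert j I" for i
    using insert.prems(4) that by simp
  \<comment> \<open>The given relation itself puts \<open>v j\<close> into \<open>U\<close>, which
    is zero.\<close>
  have "sol (v j) (\<lambda>i. - v i)"
  proof -
    have "\<phi> i (- v i) = - \<phi> i (v i)" "- v i \<in> rep_space (\<pi> i)" if "i \<in> I" for i
    proof -
      interpret i: lin_rep G "\<pi> i"
        using lr that by simp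
      have "- v i = rep_scale (\<pi> i) (-1) (v i)"
        by simp
      then show "\<phi> i (- v i) = - \<phi> i (v i)" "- v i \<in> rep_space (\<pi> i)"
        using hom_repD(4)[OF hom, of i "v i" "-1"] vi that i.V_scale[of "v i" "-1"] by auto
    qed
    moreover have "\<phi> j (v j) = - (\<Sum>i\<in>I. \<phi> i (v i))"
      using insert.prems(5) insert.hyps by (simp add: eq_neg_iff_add_eq_0)
    ultimately show ?thesis
      by (simp add: sol_def sum_negf)
  qed
  then have "v j = 0"
    using U0 vi by (auto simp: U_def)
  moreover from this have "v i = 0" if "i \<in> I" for i
    using IH[of v i] insert.prems(5) insert.hyps vi \<phi>0 that by simp
  ultimately show ?case
    using insert.prems(6) by auto
qed

section \<open>Smooth representations\<close>

context lin_rep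
begin

text \<open>\<open>K\<close> moves \<open>v\<close> only by scalars, so up to scalars
  \<open>act g v\<close> depends on the coset \<open>g K\<close>. As \<open>rcosets\<close> consists
  of the cosets \<open>K x\<close>, representatives are inverted.\<close>

lemma orbit_in_span:
  assumes K: "subgroup K G" "finite (rcosets K)" and v: "v \<in> V"
    and sc: "\<And>k. k \<in> K \<Longrightarrow> \<exists>c. act k v = c \<star> v"
  obtains F where "finite F" "card F \<le> card (rcosets K)" "F \<subseteq> (\<lambda>g. act g v) ` carrier G"
    "\<And>g. g \<in> carrier G \<Longrightarrow> \<exists>c. \<exists>f\<in>F. act g v = c \<star> f"
proof -
  define r where "r C = inv (SOME x. x \<in> C)" for C
  have r: "r C \<in> carrier G" "g \<in> carrier G \<Longrightarrow> C = K #> inv g \<Longrightarrow> \<exists>k\<in>K. g = r C \<otimes> k"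
    if C: "C \<in> rcosets K" for C g
  proof -
    have "(SOME x. x \<in> C) \<in> C"
      using subgroup.rcosets_non_empty[OF K(1) C] by (simp add: some_in_eq)
    moreover have "C \<subseteq> carrier G"
      using subgroup.rcosets_carrier[OF K(1) is_group C] .
    ultimately have x: "(SOME x. x \<in> C) \<in> C" "(SOME x. x \<in> C) \<in> carrier G"
      by auto
    then show "r C \<in> carrier G"
      by (simp add: r_def)
    assume g: "g \<in> carrier G" "C = K #> inv g"
    then have "(SOME x. x \<in> C) \<otimes> inv (inv g) \<in> K"
      using subgroup.rcos_module_imp[OF K(1) is_group _ x(1)[unfolded g(2)]] by simp
    moreover have "g = r C \<otimes> ((SOME x. x \<in> C) \<otimes> inv (inv g))"
      using x g(1) by (simp add: r_def flip: m_assoc)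
    ultimately show "\<exists>k\<in>K. g = r C \<otimes> k"
      by blast
  qed
  show ?thesis
  proof
    show "finite ((\<lambda>C. act (r C) v) ` (rcosets K))" "card ((\<lambda>C. act (r C) v) ` (rcosets K)) \<le> card (rcosets K)"
      using K(2) card_image_le by auto
    show "(\<lambda>C. act (r C) v) ` (rcosets K) \<subseteq> (\<lambda>g. act g v) ` carrier G"
      using r(1) by blast
    fix g assume g: "g \<in> carrier G"
    then have C: "K #> inv g \<in> rcosets K"
      using rcosetsI subgroup.subset[OF K(1)] by simp
    obtain k where k: "k \<in> K" "g = r (K #> inv g) \<otimes> k"
      using r(2)[OF C g refl] by blast
    obtain c where c: "act k v = c \<star> v"
      using sc k(1) by blast
    have "act g v = act (r (K #> inv g)) (act k v)"
      using k r(1)[OF C] v subgroup.mem_carrier[OF K(1)] act_mult by metis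
    also have "\<dots> = c \<star> act (r (K #> inv g)) v"
      using c r(1)[OF C] v by simp
    finally show "\<exists>c. \<exists>f\<in>(\<lambda>C. act (r C) v) ` (rcosets K). act g v = c \<star> f"
      using C by blast
  qed
qed

lemma invariant_subspace_span_orbit:
  assumes v: "v \<in> V"
  shows "invariant_subspace G \<rho> (vs.span ((\<lambda>g. act g v) ` carrier G))"
proof -
  let ?O = "(\<lambda>g. act g v) ` carrier G"
  have sub: "vs.span ?O \<subseteq> V"
    using v subspace_V by (intro vs.span_minimal) auto
  have "act g x \<in> vs.span ?O \<and> x \<in> V" if g: "g \<in> carrier G" and x: "x \<in> vs.span ?O" for g x
    using x
  proof (induction rule: vs.span_induct_alt)
    case base
    then show ?case using g vs.span_zero by simp
  next
    case (step c x y)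
    obtain h where h: "h \<in> carrier G" "x = act h v"
      using step by auto
    then have "act g x = act (g \<otimes> h) v"
      using g v by (simp add: act_mult)
    then have "act g x \<in> ?O"
      using g h by auto
    moreover have "x \<in> V"
      using h v by auto
    ultimately show ?case
      using step g by (simp add: vs.span_add vs.span_scale vs.span_base)
  qed
  then show ?thesis
    using sub by (simp add: invariant_subspace_def)
qed

text \<open>The operator of \<open>g\<close> depends only on the coset \<open>U #> inv g\<close>,
  the inverse again exchanging left and right cosets.\<close>

lemma fd_rep_if_finite_index_kernel:
  assumes U: "subgroup U G" "finite (rcosets U)" "\<And>u v. u \<in> U \<Longrightarrow> v \<in> V \<Longrightarrow> act u v = v"
    and fd: "\<exists>F. finite F \<and> V \<subseteq> vs.span F"
  shows "fd_rep G \<rho>"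
proof -
  obtain F where F: "finite F" "V \<subseteq> vs.span F"
    using fd by blast
  have sub: "(\<lambda>g. restrict (act g) V) ` carrier G \<subseteq>
      (\<lambda>C. restrict (act (SOME h. h \<in> carrier G \<and> U #> inv h = C)) V) ` (rcosets U)"
  proof (intro image_subsetI)
    fix g assume g: "g \<in> carrier G"
    let ?C = "U #> inv g"
    let ?h = "SOME h. h \<in> carrier G \<and> U #> inv h = ?C"
    have h: "?h \<in> carrier G \<and> U #> inv ?h = ?C"
      by (rule someI[of _ g]) (use g in simp)
    then have u: "inv ?h \<otimes> g \<in> U"
      using rcoset_eq_iff[OF U(1), of "inv ?h" "inv g"] g by simp
    have "act ?h v = act g v" if v: "v \<in> V" for v
    proof -
      have "act ?h (act (inv ?h \<otimes> g) v) = act g v"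
        using h g v by (simp add: act_mult)
      then show ?thesis
        using U(3)[OF u v] by simp
    qed
    then have "restrict (act g) V = restrict (act ?h) V"
      by (auto simp: restrict_def)
    moreover have "?C \<in> rcosets U"
      using g rcosetsI subgroup.subset[OF U(1)] by simp
    ultimately show "restrict (act g) V \<in> (\<lambda>C. restrict (act (SOME h. h \<in> carrier G \<and> U #> inv h = C)) V) ` (rcosets U)"
      by blast
  qed
  have "finite ((\<lambda>g. restrict (act g) V) ` carrier G)"
    by (rule finite_subset[OF sub]) (use U(2) in simp)
  then show ?thesis
    using fd by (simp add: fd_rep_def fd_rep_axioms_def lin_rep_axioms)
qed

lemma subgroup_stabilizer:
  assumes "v \<in> V"
  shows "subgroup {g \<in> carrier G. act g v = v} G"
proof
  fix x assume x: "x \<in> {g \<in> carrier G. act g v = v}"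
  then have x': "x \<in> carrier G" "act x v = v"
    by auto
  have "act (inv x) (act x v) = v"
    using x'(1) assms by (rule act_inv_act)
  then show "inv x \<in> {g \<in> carrier G. act g v = v}"
    using x' by simp
qed (use assms in \<open>auto simp: act_mult\<close>)

end

lemma smooth_subrep:
  assumes "group G" "smooth G T \<rho>" "invariant_subspace G \<rho> U"
  shows "smooth G T (\<rho>\<lparr>rep_space := U\<rparr>)"
proof -
  interpret lin_rep G \<rho>
    using assms by (simp add: lin_rep_iff smooth_def)
  show ?thesis
    using lin_rep_subrep[OF assms(3)] assms(2,3)
    by (auto simp: smooth_def lin_rep_iff invariant_subspace_def)
qed

lemma smooth_subgroup:
  assumes "group G" "smooth G T \<rho>" "subgroup H G"
  shows "smooth (G\<lparr>carrier := H\<rparr>) (subtopology T H) \<rho>"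
proof -
  interpret lin_rep G \<rho>
    using assms by (simp add: lin_rep_iff smooth_def)
  have "{g \<in> H. act g v = v} = {g \<in> carrier G. act g v = v} \<inter> H" for v
    using subgroup.subset[OF assms(3)] by auto
  then show ?thesis
    using lin_rep_subgroup[OF assms(3)] assms(2)
    by (auto simp: smooth_def lin_rep_iff openin_subtopology)
qed

lemma smooth_iso:
  assumes "representation G \<rho>" "smooth G T \<sigma>" "iso_rep G \<rho> \<sigma>"
  shows "smooth G T \<rho>"
proof -
  obtain f where f: "f \<in> hom_rep G \<rho> \<sigma>" "bij_betw f (rep_space \<rho>) (rep_space \<sigma>)"
    using assms(3) by (auto simp: iso_rep_def)
  have "{g \<in> carrier G. rep_act \<rho> g v = v} = {g \<in> carrier G. rep_act \<sigma> g (f v) = f v}" if v: "v \<in> rep_space \<rho>" for v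
  proof (intro Collect_cong conj_cong refl)
    fix g assume g: "g \<in> carrier G"
    have "rep_act \<rho> g v \<in> rep_space \<rho>"
      using assms(1) g v by (rule representation_space)
    then show "rep_act \<rho> g v = v \<longleftrightarrow> rep_act \<sigma> g (f v) = f v"
      using hom_repD(5)[OF f(1) g v] f(2) v by (metis bij_betw_def inj_on_contraD)
  qed
  then show ?thesis
    using assms hom_repD(1)[OF f(1)] by (auto simp: smooth_def)
qed

lemma irreducible_iso:
  assumes "group G" "representation G \<rho>" "irreducible_rep G \<sigma>" "iso_rep G \<rho> \<sigma>"
  shows "irreducible_rep G \<rho>"
proof -
  interpret lin_rep G \<rho>
    using assms by (simp add: lin_rep_iff)
  have s: "representation G \<sigma>" "vector_space (rep_scale \<sigma>)"
    using assms by (simp_all add: irreducible_rep_def representation_def)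
  obtain f where f: "f \<in> hom_rep G \<rho> \<sigma>" "bij_betw f V (rep_space \<sigma>)"
    using assms(4) by (auto simp: iso_rep_def)
  have inj: "inj_on f V" and img: "f ` V = rep_space \<sigma>"
    using f(2) by (auto simp: bij_betw_def)
  have f0: "f 0 = 0"
    using hom_rep_0[OF assms(2) s(2) f(1)] .
  have "V \<noteq> {0}"
    using img f0 assms(3) by (auto simp: irreducible_rep_iff)
  moreover have "U = {0} \<or> U = V" if U: "invariant_subspace G \<rho> U" for U
  proof -
    have UV: "U \<subseteq> V"
      using U by (simp add: invariant_subspace_def)
    interpret U: lin_rep G "\<rho>\<lparr>rep_space := U\<rparr>"
      by (rule lin_rep_subrep[OF U])
    have "invariant_subspace G \<sigma> ((\<lambda>v. if v \<in> U then f v else 0) ` U)"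
      using U.hom_rep_image_invariant[OF s(2) hom_rep_restrict[OF f(1) U]] by simp
    also have "(\<lambda>v. if v \<in> U then f v else 0) ` U = f ` U"
      by auto
    finally consider "f ` U = {0}" | "f ` U = f ` V"
      using assms(3) img by (auto simp: irreducible_rep_iff)
    then show ?thesis
    proof cases
      case 1
      have "u = 0" if "u \<in> U" for u
        using 1 that f0 inj UV V_zero by (metis imageI inj_onD singletonD subsetD)
      then show ?thesis
        using U.V_zero by auto
    next
      case 2
      then show ?thesis
        using inj UV by (meson inj_on_image_eq_iff order_refl)
    qed
  qed
  ultimately show ?thesis
    using assms(2) by (auto simp: irreducible_rep_iff)
qed

section \<open>Open kernels and finite-dimensionality\<close>

context profinite_group
begin

lemma open_subgroup_stabilizer:
  assumes "smooth G T \<rho>" "v \<in> rep_space \<rho>"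
  shows "open_subgroup {g \<in> carrier G. rep_act \<rho> g v = v} G T"
proof -
  interpret lin_rep G \<rho>
    using assms is_group by (simp add: lin_rep_iff smooth_def)
  show ?thesis
    using subgroup_stabilizer assms by (simp add: open_subgroup_def smooth_def)
qed

text \<open>The stabilisers of the members of a finite basis meet in an open subgroup.\<close>

lemma smooth_fd_open_kernel:
  assumes sm: "smooth G T \<rho>" and fd: "\<exists>F. finite F \<and> rep_space \<rho> \<subseteq> module.span (rep_scale \<rho>) F"
  obtains U where "open_subgroup U G T" "\<And>u v. u \<in> U \<Longrightarrow> v \<in> rep_space \<rho> \<Longrightarrow> rep_act \<rho> u v = v"
proof -
  interpret lin_rep G \<rho>
    using sm is_group by (simp add: lin_rep_iff smooth_def)
  obtain F where F: "finite F" "V \<subseteq> vs.span F"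
    using fd by blast
  obtain B where B: "B \<subseteq> V" "vs.independent B" "V \<subseteq> vs.span B"
    using vs.basis_exists by metis
  have finB: "finite B"
    using vs.independent_span_bound[OF F(1) B(2)] B(1) F(2) by blast
  let ?S = "\<lambda>b. {g \<in> carrier G. act g b = b}"
  let ?U = "\<Inter>(insert (carrier G) (?S ` B))"
  have car: "open_subgroup (carrier G) G T"
    using subgroup_self topspace_eq openin_topspace by (metis open_subgroup_def)
  have D: "open_subgroup D G T" if "D \<in> insert (carrier G) (?S ` B)" for D
    using that car open_subgroup_stabilizer[OF sm] B(1) by auto
  have "openin T ?U"
    by (rule openin_Inter) (use D finB in \<open>auto simp: open_subgroup_def\<close>)
  moreover have "subgroup ?U G"
    by (rule subgroups_Inter) (use D in \<open>auto simp: open_subgroup_def\<close>)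
  ultimately have U: "open_subgroup ?U G T"
    by (simp add: open_subgroup_def)
  have "act u v = v" if u: "u \<in> ?U" and v: "v \<in> V" for u v
  proof -
    have uG: "u \<in> carrier G"
      using u by auto
    have "act u v = v \<and> v \<in> V" if "v \<in> vs.span B" for v
      using that
    proof (induction rule: vs.span_induct_alt)
      case base
      then show ?case using uG by simp
    next
      case (step c x y)
      then have "act u x = x" "x \<in> V"
        using u B(1) by auto
      then show ?case
        using step uG by simp
    qed
    then show ?thesis
      using v B(3) by auto
  qed
  with U show ?thesis
    by (rule that)
qed

lemma fd_rep_smooth:
  assumes sm: "smooth G T \<rho>" and fd: "\<exists>F. finite F \<and> rep_space \<rho> \<subseteq> module.span (rep_scale \<rho>) F"
  shows "fd_rep G \<rho>"
proof -
  interpret lin_rep G \<rho>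
    using sm is_group by (simp add: lin_rep_iff smooth_def)
  obtain U where "open_subgroup U G T" "\<And>u v. u \<in> U \<Longrightarrow> v \<in> V \<Longrightarrow> act u v = v"
    using smooth_fd_open_kernel[OF assms] by blast
  then show ?thesis
    using finite_rcosets_open_subgroup fd
    by (intro fd_rep_if_finite_index_kernel[of U]) (simp_all add: open_subgroup_def)
qed

text \<open>The stabiliser of a nonzero vector is open, hence of finite index, so the orbit is
  contained in the span of a finite set; the span of the orbit is invariant and therefore
  everything.\<close>

lemma smooth_irreducible_fd:
  assumes "smooth G T \<rho>" "irreducible_rep G \<rho>"
  shows "fd_rep G \<rho>"
proof -
  interpret lin_rep G \<rho>
    using assms is_group by (simp add: lin_rep_iff smooth_def)
  obtain v where v: "v \<in> V" "v \<noteq> 0"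
    using assms(2) V_zero by (auto simp: irreducible_rep_iff)
  let ?S = "{g \<in> carrier G. act g v = v}"
  have S: "open_subgroup ?S G T"
    using open_subgroup_stabilizer[OF assms(1) v(1)] .
  then have S': "subgroup ?S G" "finite (rcosets ?S)"
    using finite_rcosets_open_subgroup by (simp_all only: open_subgroup_def)
  have sc: "\<exists>c. act k v = c \<star> v" if "k \<in> ?S" for k
    using that by (intro exI[of _ 1]) simp
  obtain F where F: "finite F" "\<And>g. g \<in> carrier G \<Longrightarrow> \<exists>c. \<exists>f\<in>F. act g v = c \<star> f"
    by (rule orbit_in_span[OF S' v(1) sc]) (assumption, rule that)
  let ?O = "(\<lambda>g. act g v) ` carrier G"
  have "act \<one> v \<in> vs.span ?O"
    by (rule vs.span_base) auto
  then have "v \<in> vs.span ?O"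
    using v by simp
  then have "vs.span ?O = V"
    using invariant_subspace_span_orbit[OF v(1)] assms(2) v(2) by (auto simp: irreducible_rep_iff)
  moreover have "?O \<subseteq> vs.span F"
    using F(2) vs.span_scale vs.span_base by (metis image_subsetI)
  ultimately have "V \<subseteq> vs.span F"
    using vs.span_minimal[of ?O "vs.span F"] by simp
  then show ?thesis
    using fd_rep_smooth[OF assms(1)] F(1) by blast
qed

end

text \<open>Coordinates with respect to a basis move a finite-dimensional representation to the type
  in which \<^const>\<open>Irr\<close> lives.\<close>

lemma (in lin_rep) coordinate_rep_exists:
  assumes fd: "\<exists>F. finite F \<and> V \<subseteq> vs.span F"
  obtains \<pi> :: "('g, nat \<Rightarrow> complex) rep" where "representation G \<pi>" "iso_rep G \<pi> \<rho>"
proof -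
  obtain F where F: "finite F" "V \<subseteq> vs.span F"
    using fd by blast
  obtain B where B: "B \<subseteq> V" "vs.independent B" "V \<subseteq> vs.span B"
    using vs.basis_exists by metis
  have finB: "finite B"
    using vs.independent_span_bound[OF F(1) B(2)] B(1) F(2) by blast
  obtain b where b: "bij_betw b {..<card B} B"
    using ex_bij_betw_nat_finite[OF finB] by (auto simp: atLeast0LessThan)
  let ?n = "card B"
  define co where "co = vs.representation B"
  define \<phi> where "\<phi> v = (\<lambda>i. if i < ?n then co v (b i) else 0)" for v
  define \<psi> where "\<psi> a = (\<Sum>i<?n. a i \<star> b i)" for a :: "nat \<Rightarrow> complex"
  have bV: "b i \<in> B" "b i \<in> V" if "i < ?n" for i
    using b that B(1) by (auto simp: bij_betw_def)
  have co_add: "co (v + w) x = co v x + co w x" if "v \<in> V" "w \<in> V" for v w x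
    using vs.representation_add[OF B(2) subsetD[OF B(3)] subsetD[OF B(3)]] that by (simp add: co_def)
  have co_scale: "co (c \<star> v) x = c * co v x" if "v \<in> V" for v c x
    using vs.representation_scale[OF B(2) subsetD[OF B(3)]] that by (simp add: co_def)
  have \<psi>V: "\<psi> a \<in> V" for a
    unfolding \<psi>_def by (rule V_sum) (use bV in auto)
  have \<psi>\<phi>: "\<psi> (\<phi> v) = v" if v: "v \<in> V" for v
  proof -
    have "\<psi> (\<phi> v) = (\<Sum>x\<in>B. co v x \<star> x)"
      unfolding \<psi>_def \<phi>_def sum.reindex_bij_betw[OF b, symmetric] by (rule sum.cong) auto
    also have "\<dots> = v"
      using vs.sum_representation_eq[OF B(2) subsetD[OF B(3) v] finB order_refl] by (simp add: co_def)
    finally show ?thesis .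
  qed
  have \<phi>\<psi>: "\<phi> (\<psi> a) = a" if a: "\<forall>i\<ge>?n. a i = 0" for a
  proof
    fix j
    show "\<phi> (\<psi> a) j = a j"
    proof (cases "j < ?n")
      case True
      have "co (\<psi> a) (b j) = (\<Sum>i<?n. co (a i \<star> b i) (b j))"
        unfolding \<psi>_def co_def using bV B by (subst vs.representation_sum) (auto intro: vs.span_scale vs.span_base)
      also have "\<dots> = (\<Sum>i<?n. if i = j then a i else 0)"
      proof (rule sum.cong)
        fix i assume i: "i \<in> {..<?n}"
        have "b i = b j \<longleftrightarrow> i = j"
          using b i True by (auto simp: bij_betw_def inj_on_def)
        then show "co (a i \<star> b i) (b j) = (if i = j then a i else 0)"
          using vs.representation_basis[OF B(2), of "b i"] bV i co_scale by (auto simp: co_def)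
      qed simp
      also have "\<dots> = a j"
        using True by simp
      finally show ?thesis
        using True by (simp add: \<phi>_def)
    qed (use a in \<open>simp add: \<phi>_def\<close>)
  qed
  have \<phi>_add: "\<phi> (v + w) = \<phi> v + \<phi> w" if "v \<in> V" "w \<in> V" for v w
    using co_add[OF that] by (auto simp: \<phi>_def fun_eq_iff)
  have \<phi>_scale: "\<phi> (c \<star> v) = pointwise_scale (*) c (\<phi> v)" if "v \<in> V" for c v
    using co_scale[OF that] by (auto simp: \<phi>_def fun_eq_iff pointwise_scale_def)
  have \<psi>_add: "\<psi> (a + a') = \<psi> a + \<psi> a'" for a a'
    by (simp add: \<psi>_def vs.scale_left_distrib sum.distrib)
  have \<psi>_scale: "\<psi> (pointwise_scale (*) c a) = c \<star> \<psi> a" for c a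
    by (simp add: \<psi>_def pointwise_scale_def vs.scale_sum_right)
  define \<pi> :: "('g, nat \<Rightarrow> complex) rep" where
    "\<pi> = \<lparr>rep_scale = pointwise_scale (*), rep_space = {a. \<forall>i\<ge>?n. a i = 0}, rep_act = (\<lambda>g a. \<phi> (act g (\<psi> a)))\<rparr>"
  interpret c: vector_space "pointwise_scale (*) :: complex \<Rightarrow> (nat \<Rightarrow> complex) \<Rightarrow> nat \<Rightarrow> complex"
    by (rule vector_space_pointwise_scale[OF vector_space_complex])
  have \<phi>V: "\<forall>i\<ge>?n. \<phi> v i = 0" for v
    by (simp add: \<phi>_def)
  have "representation G \<pi>"
    unfolding Defs.representation_def
  proof (intro conjI ballI allI)
    show "vector_space (rep_scale \<pi>)"
      by (simp add: \<pi>_def c.vector_space_axioms)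
    show "module.subspace (rep_scale \<pi>) (rep_space \<pi>)"
      by (auto simp: \<pi>_def c.subspace_def pointwise_scale_def)
  qed (use \<phi>V \<psi>V in \<open>auto simp: \<pi>_def \<psi>_add \<psi>_scale \<phi>_add \<phi>_scale \<psi>\<phi> \<phi>\<psi> act_mult\<close>)
  moreover have "iso_rep G \<pi> \<rho>"
    unfolding iso_rep_def
  proof (intro bexI)
    let ?f = "\<lambda>a. if a \<in> rep_space \<pi> then \<psi> a else 0"
    show "bij_betw ?f (rep_space \<pi>) V"
      by (rule bij_betw_byWitness[of _ \<phi>]) (use \<psi>V \<phi>V \<psi>\<phi> \<phi>\<psi> in \<open>auto simp: \<pi>_def\<close>)
    show "?f \<in> hom_rep G \<pi> \<rho>"
      using representation_space[OF \<open>representation G \<pi>\<close>] \<psi>V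
      by (auto simp: hom_rep_def) (auto simp: \<pi>_def \<psi>_add \<psi>_scale \<psi>\<phi>)
  qed
  ultimately show ?thesis
    using that by blast
qed

section \<open>Isomorphism classes\<close>

text \<open>Isomorphism is an equivalence relation on \<open>smooth_irreps\<close>, so
  \<open>representative\<close> picks a member of each class. These facts are the interface through
  which classes are handled.\<close>

lemma
  assumes G: "group G"
  shows Irr_representative: "c \<in> Irr G T \<Longrightarrow> representative c \<in> smooth_irreps G T"
    and Irr_iso_unique: "c \<in> Irr G T \<Longrightarrow> c' \<in> Irr G T \<Longrightarrow>
      iso_rep G (representative c) (representative c') \<Longrightarrow> c = c'"
    and Irr_cover: "\<pi> \<in> smooth_irreps G T \<Longrightarrow> \<exists>c\<in>Irr G T. iso_rep G (representative c) \<pi>"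
proof -
  let ?S = "smooth_irreps G T"
  let ?R = "{(\<pi>, \<pi>'). \<pi> \<in> ?S \<and> \<pi>' \<in> ?S \<and> iso_rep G \<pi> \<pi>'}"
  have rep: "representation G \<pi>" if "\<pi> \<in> ?S" for \<pi>
    using that by (simp add: smooth_irreps_def smooth_def)
  have eq: "equiv ?S ?R"
  proof (rule equivI)
    show "?R \<subseteq> ?S \<times> ?S" by auto
    show "refl_on ?S ?R"
      using rep iso_rep_refl by (auto simp: refl_on_def)
    show "sym ?R"
      using rep iso_rep_sym by (auto simp: sym_def)
    show "trans ?R"
      using rep iso_rep_trans by (auto simp: trans_def) blast
  qed
  have mem: "representative c \<in> c" if "c \<in> Irr G T" for c
    using in_quotient_imp_non_empty[OF eq] that by (auto simp: Irr_def representative_def some_in_eq)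
  show *: "c \<in> Irr G T \<Longrightarrow> representative c \<in> ?S" for c
    using mem in_quotient_imp_subset[OF eq] by (auto simp: Irr_def)
  show "c = c'" if "c \<in> Irr G T" "c' \<in> Irr G T" "iso_rep G (representative c) (representative c')" for c c'
    using quotient_eqI[OF eq, of c c' "representative c" "representative c'"] that mem * by (auto simp: Irr_def)
  show "\<exists>c\<in>Irr G T. iso_rep G (representative c) \<pi>" if \<pi>: "\<pi> \<in> ?S" for \<pi>
  proof (intro bexI)
    show c: "?R `` {\<pi>} \<in> Irr G T"
      unfolding Irr_def by (rule quotientI[OF \<pi>])
    then show "iso_rep G (representative (?R `` {\<pi>})) \<pi>"
      using mem[OF c] rep \<pi> iso_rep_sym by blast
  qed
qed

lemma enat_sum_less_infinity_iff:
  fixes f :: "'a \<Rightarrow> enat"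
  assumes "finite A"
  shows "sum f A < \<infinity> \<longleftrightarrow> (\<forall>a\<in>A. f a < \<infinity>)"
proof -
  have "sum f A = \<infinity> \<longleftrightarrow> (\<exists>a\<in>A. f a = \<infinity>)"
    using assms by (induction A rule: finite_induct) (auto simp: plus_eq_infty_iff_enat)
  then show ?thesis
    by auto
qed

text \<open>A nonzero extended natural number is at least 1, so infinitely many nonzero terms have
  sum infinity.\<close>

lemma enat_infsum_less_infinity_iff:
  fixes f :: "'a \<Rightarrow> enat"
  shows "infsum f A < \<infinity> \<longleftrightarrow> finite {a \<in> A. f a \<noteq> 0} \<and> (\<forall>a\<in>A. f a < \<infinity>)"
proof -
  let ?A = "{a \<in> A. f a \<noteq> 0}"
  have eq: "infsum f A = infsum f ?A"
    by (rule infsum_cong_neutral) auto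
  show ?thesis
  proof (cases "finite ?A")
    case True
    have "f a < \<infinity>" if "\<forall>a\<in>?A. f a < \<infinity>" "a \<in> A" for a
      using that by (cases "f a = 0") auto
    then have "(\<forall>a\<in>A. f a < \<infinity>) \<longleftrightarrow> (\<forall>a\<in>?A. f a < \<infinity>)"
      by blast
    then show ?thesis
      unfolding eq infsum_finite[OF True] enat_sum_less_infinity_iff[OF True] using True by blast
  next
    case False
    have "1 \<le> f a" if "f a \<noteq> 0" for a
      using that ileI1[of 0 "f a"] unfolding one_eSuc by simp
    then have "infsum f ?A = \<infinity>"
      by (intro infsum_superconst_infinite_enat[OF _ _ False, of 1]) auto
    then show ?thesis
      unfolding eq using False by simp
  qed
qed

text \<open>Finiteness of \<open>R_count\<close> splits into finiteness of each multiplicity and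
  finiteness of the set of classes with a nonzero Hom space. For induced representations the two are
  proved by different means.\<close>

lemma strongly_admissible_iff:
  fixes \<rho> :: "('g, 'w::ab_group_add) rep"
  assumes G: "group G"
  shows "strongly_admissible G T \<rho> \<longleftrightarrow> smooth G T \<rho> \<and>
    (\<forall>c\<in>Irr G T. multiplicity_rep G (representative c) \<rho> < \<infinity>) \<and>
    (\<forall>d. finite {c \<in> Irr G T. degree_rep (representative c) \<le> enat d \<and>
        \<not> hom_rep G (representative c) \<rho> \<subseteq> {0}})"
proof (cases "smooth G T \<rho>")
  case True
  then have "vector_space (pointwise_scale (rep_scale \<rho>) :: complex \<Rightarrow> ((nat \<Rightarrow> complex) \<Rightarrow> 'w) \<Rightarrow> _)"
    by (intro vector_space_pointwise_scale) (simp add: smooth_def representation_def)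
  then have "multiplicity_rep G \<pi> \<rho> = 0 \<longleftrightarrow> hom_rep G \<pi> \<rho> \<subseteq> {0}" for \<pi> :: "('g, nat \<Rightarrow> complex) rep"
    by (simp add: multiplicity_rep_def edim_eq_0_iff)
  then have "R_count G T d \<rho> < \<infinity> \<longleftrightarrow>
      finite {c \<in> Irr G T. degree_rep (representative c) \<le> enat d \<and> \<not> hom_rep G (representative c) \<rho> \<subseteq> {0}} \<and>
      (\<forall>c\<in>{c \<in> Irr G T. degree_rep (representative c) \<le> enat d}. multiplicity_rep G (representative c) \<rho> < \<infinity>)" for d
    unfolding R_count_def enat_infsum_less_infinity_iff by (simp only: mem_Collect_eq conj_assoc)
  then show ?thesis
    using True unfolding strongly_admissible_def admissible_def by blast
qed (simp add: strongly_admissible_def admissible_def)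

section \<open>Induced representations\<close>

lemma Ind_simps [simp]:
  "rep_scale (Ind G T H \<sigma>) = pointwise_scale (rep_scale \<sigma>)"
  "rep_act (Ind G T H \<sigma>) g f = (\<lambda>x. if x \<in> carrier G then f (x \<otimes>\<^bsub>G\<^esub> g) else 0)"
  by (simp_all add: Ind_def)

lemma mem_Ind_iff: "f \<in> rep_space (Ind G T H \<sigma>) \<longleftrightarrow>
    (\<forall>x\<in>carrier G. f x \<in> rep_space \<sigma>) \<and> (\<forall>x. x \<notin> carrier G \<longrightarrow> f x = 0) \<and>
    locally_constant_on G T f \<and> (\<forall>h\<in>H. \<forall>x\<in>carrier G. f (h \<otimes>\<^bsub>G\<^esub> x) = rep_act \<sigma> h (f x))"
  by (simp add: Ind_def)

lemma locally_constant_on_comp2: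
  assumes "locally_constant_on G T f" "locally_constant_on G T f'"
  shows "locally_constant_on G T (\<lambda>x. h (f x) (f' x))"
  unfolding locally_constant_on_def
proof
  fix x assume "x \<in> carrier G"
  then obtain U U' where "openin T U" "x \<in> U" "\<forall>y\<in>U. f y = f x" "openin T U'" "x \<in> U'" "\<forall>y\<in>U'. f' y = f' x"
    using assms unfolding locally_constant_on_def by metis
  then have "openin T (U \<inter> U')" "x \<in> U \<inter> U'" "\<And>y. y \<in> U \<inter> U' \<Longrightarrow> f y = f x \<and> f' y = f' x"
    by blast+
  then show "\<exists>W. openin T W \<and> x \<in> W \<and> (\<forall>y\<in>W. h (f y) (f' y) = h (f x) (f' x))"
    by metis
qed

lemma locally_constant_on_comp:
  "locally_constant_on G T f \<Longrightarrow> locally_constant_on G T (\<lambda>x. h (f x))"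
  using locally_constant_on_comp2[of G T f f "\<lambda>a b. h a"] by simp

context topological_group
begin

lemma locally_constant_on_translate:
  assumes f: "locally_constant_on G T f" and g: "g \<in> carrier G"
  shows "locally_constant_on G T (\<lambda>x. if x \<in> carrier G then f (x \<otimes> g) else c)"
  unfolding locally_constant_on_def
proof
  fix x assume x: "x \<in> carrier G"
  then obtain U where U: "openin T U" "x \<otimes> g \<in> U" "\<forall>y\<in>U. f y = f (x \<otimes> g)"
    using f g unfolding locally_constant_on_def by (meson m_closed)
  show "\<exists>U. openin T U \<and> x \<in> U \<and> (\<forall>y\<in>U. (if y \<in> carrier G then f (y \<otimes> g) else c) =
      (if x \<in> carrier G then f (x \<otimes> g) else c))"
  proof (intro exI[of _ "{y \<in> carrier G. y \<otimes> g \<in> U}"] conjI ballI)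
    show "openin T {y \<in> carrier G. y \<otimes> g \<in> U}"
      by (rule openin_right_preimage[OF g U(1)])
    fix y assume "y \<in> {y \<in> carrier G. y \<otimes> g \<in> U}"
    then have "y \<in> carrier G" "f (y \<otimes> g) = f (x \<otimes> g)"
      using U(3) by blast+
    then show "(if y \<in> carrier G then f (y \<otimes> g) else c) = (if x \<in> carrier G then f (x \<otimes> g) else c)"
      using x by (simp only: if_True)
  qed (use x U(2) in simp)
qed

lemma representation_Ind:
  assumes H: "subgroup H G" and \<sigma>: "representation (G\<lparr>carrier := H\<rparr>) \<sigma>"
  shows "representation G (Ind G T H \<sigma>)"
proof -
  interpret s: lin_rep "G\<lparr>carrier := H\<rparr>" \<sigma>
    using \<sigma> subgroup_imp_group[OF H] by (simp add: lin_rep_iff)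
  have HG: "h \<in> carrier G" if "h \<in> H" for h
    using subgroup.mem_carrier[OF H that] .
  interpret p: vector_space "pointwise_scale (rep_scale \<sigma>) :: complex \<Rightarrow> ('a \<Rightarrow> 'c) \<Rightarrow> 'a \<Rightarrow> 'c"
    by (rule vector_space_pointwise_scale[OF s.vs.vector_space_axioms])
  let ?V = "rep_space (Ind G T H \<sigma>)"
  have const: "locally_constant_on G T (\<lambda>x. 0)"
    using topspace_eq openin_topspace[of T] by (auto simp: locally_constant_on_def intro!: exI[of _ "carrier G"])
  have "p.subspace ?V"
    unfolding p.subspace_def
  proof (intro conjI ballI allI)
    show "0 \<in> ?V"
      using const s.act_zero by (simp add: mem_Ind_iff zero_fun_def)
    show "f + f' \<in> ?V" if "f \<in> ?V" "f' \<in> ?V" for f f'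
      using that locally_constant_on_comp2[of G T f f' "(+)"] HG by (simp add: mem_Ind_iff plus_fun_def)
    show "pointwise_scale (rep_scale \<sigma>) c f \<in> ?V" if "f \<in> ?V" for c f
      using that locally_constant_on_comp[of G T f "rep_scale \<sigma> c"] HG by (simp add: mem_Ind_iff pointwise_scale_def)
  qed
  moreover have "rep_act (Ind G T H \<sigma>) g f \<in> ?V" if g: "g \<in> carrier G" and f: "f \<in> ?V" for g f
    using f g locally_constant_on_translate[of f g 0] HG by (auto simp: mem_Ind_iff m_assoc)
  ultimately show ?thesis
    unfolding Defs.representation_def using p.vector_space_axioms
    by (auto simp: fun_eq_iff pointwise_scale_def mem_Ind_iff m_assoc)
qed

text \<open>One direction of Frobenius reciprocity. The function attached to \<open>v\<close> is
  locally constant because it is constant on \<open>x\<close> times the open stabiliser of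
  \<open>v\<close>.\<close>

lemma frobenius_hom:
  assumes H: "subgroup H G" and \<sigma>: "representation (G\<lparr>carrier := H\<rparr>) \<sigma>"
    and \<pi>: "smooth G T \<pi>" and l: "l \<in> hom_rep (G\<lparr>carrier := H\<rparr>) \<pi> \<sigma>"
  shows "(\<lambda>v x. if v \<in> rep_space \<pi> \<and> x \<in> carrier G then l (rep_act \<pi> x v) else 0)
    \<in> hom_rep G \<pi> (Ind G T H \<sigma>)" (is "?\<Phi> \<in> _")
proof -
  interpret lin_rep G \<pi>
    using \<pi> is_group by (simp add: lin_rep_iff smooth_def)
  interpret s: lin_rep "G\<lparr>carrier := H\<rparr>" \<sigma>
    using \<sigma> subgroup_imp_group[OF H] by (simp add: lin_rep_iff)
  have HG: "h \<in> carrier G" if "h \<in> H" for h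
    using subgroup.mem_carrier[OF H that] .
  have "locally_constant_on G T (?\<Phi> v)" if v: "v \<in> V" for v
    unfolding locally_constant_on_def
  proof
    fix x assume x: "x \<in> carrier G"
    let ?S = "{g \<in> carrier G. act g v = v}"
    show "\<exists>U. openin T U \<and> x \<in> U \<and> (\<forall>y\<in>U. ?\<Phi> v y = ?\<Phi> v x)"
    proof (intro exI[of _ "{y \<in> carrier G. inv x \<otimes> y \<in> ?S}"] conjI ballI)
      show "openin T {y \<in> carrier G. inv x \<otimes> y \<in> ?S}"
        using x v \<pi> by (intro openin_left_preimage) (auto simp: smooth_def)
      show "x \<in> {y \<in> carrier G. inv x \<otimes> y \<in> ?S}"
        using x v by simp
      fix y assume y: "y \<in> {y \<in> carrier G. inv x \<otimes> y \<in> ?S}"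
      then have y': "y \<in> carrier G" "act (inv x \<otimes> y) v = v"
        by auto
      have "act x (act (inv x \<otimes> y) v) = act y v"
        using x y'(1) v by (simp add: act_mult)
      then have "act y v = act x v"
        using y'(2) by simp
      then show "?\<Phi> v y = ?\<Phi> v x"
        using x y v by simp
    qed
  qed
  moreover have "?\<Phi> v x \<in> rep_space \<sigma>" if "v \<in> V" "x \<in> carrier G" for v x
    using that hom_repD(1)[OF l] by simp
  moreover have "?\<Phi> v (h \<otimes> x) = rep_act \<sigma> h (?\<Phi> v x)" if "v \<in> V" "h \<in> H" "x \<in> carrier G" for v h x
    using that hom_repD(5)[OF l, of h "act x v"] HG by (simp add: act_mult)
  ultimately have "?\<Phi> v \<in> rep_space (Ind G T H \<sigma>)" if "v \<in> V" for v
    using that by (simp add: mem_Ind_iff)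
  then show ?thesis
    using hom_repD(3,4)[OF l]
    by (auto simp: hom_rep_def fun_eq_iff pointwise_scale_def act_mult)
qed

text \<open>The other direction, by evaluation at the identity; the last two claims recover
  \<open>F\<close> from its evaluation.\<close>

lemma frobenius_eval:
  assumes H: "subgroup H G" and \<sigma>: "representation (G\<lparr>carrier := H\<rparr>) \<sigma>"
    and \<pi>: "representation G \<pi>" and F: "F \<in> hom_rep G \<pi> (Ind G T H \<sigma>)"
  shows "(\<lambda>v. F v \<one>) \<in> hom_rep (G\<lparr>carrier := H\<rparr>) \<pi> \<sigma>"
    and "v \<in> rep_space \<pi> \<Longrightarrow> x \<in> carrier G \<Longrightarrow> F v x = F (rep_act \<pi> x v) \<one>"
    and "v \<in> rep_space \<pi> \<Longrightarrow> x \<notin> carrier G \<Longrightarrow> F v x = 0"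
proof -
  have HG: "h \<in> carrier G" if "h \<in> H" for h
    using subgroup.mem_carrier[OF H that] .
  have V: "F v \<in> rep_space (Ind G T H \<sigma>)" if "v \<in> rep_space \<pi>" for v
    using hom_repD(1)[OF F that] .
  show eq: "F v x = F (rep_act \<pi> x v) \<one>" if "v \<in> rep_space \<pi>" "x \<in> carrier G" for v x
    using hom_repD(5)[OF F that(2,1)] that by simp
  show "F v x = 0" if "v \<in> rep_space \<pi>" "x \<notin> carrier G" for v x
    using V[OF that(1)] that(2) by (simp add: mem_Ind_iff)
  have "F (rep_act \<pi> h v) \<one> = rep_act \<sigma> h (F v \<one>)" if "h \<in> H" "v \<in> rep_space \<pi>" for h v
  proof -
    have "F v (h \<otimes> \<one>) = rep_act \<sigma> h (F v \<one>)"
      using V[OF that(2)] that(1) by (simp add: mem_Ind_iff)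
    then show ?thesis
      using eq[OF that(2) HG[OF that(1)]] HG[OF that(1)] by simp
  qed
  then show "(\<lambda>v. F v \<one>) \<in> hom_rep (G\<lparr>carrier := H\<rparr>) \<pi> \<sigma>"
    using V hom_repD(2,3,4)[OF F] by (auto simp: hom_rep_def mem_Ind_iff pointwise_scale_def)
qed

end

lemma (in profinite_group) smooth_Ind:
  assumes H: "subgroup H G" and \<sigma>: "representation (G\<lparr>carrier := H\<rparr>) \<sigma>"
  shows "smooth G T (Ind G T H \<sigma>)"
proof -
  have "openin T {g \<in> carrier G. rep_act (Ind G T H \<sigma>) g f = f}" if f: "f \<in> rep_space (Ind G T H \<sigma>)" for f
  proof -
    have "{g \<in> carrier G. rep_act (Ind G T H \<sigma>) g f = f} = {g \<in> carrier G. \<forall>x\<in>carrier G. f (x \<otimes> g) = f x}"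
      using f by (auto simp: fun_eq_iff mem_Ind_iff)
    then show ?thesis
      using open_stabilizer_locally_constant[of f] f by (simp add: open_subgroup_def mem_Ind_iff)
  qed
  then show ?thesis
    using representation_Ind[OF assms] by (simp add: smooth_def)
qed

section \<open>Smooth characters\<close>

text \<open>Extended by 0 off \<open>K\<close> to match \<open>weights\<close>; smoothness is
  expressed as openness of the kernel.\<close>

definition smooth_chars :: "('g, 'm) monoid_scheme \<Rightarrow> 'g topology \<Rightarrow> 'g set \<Rightarrow> ('g \<Rightarrow> complex) set" where
  "smooth_chars G T K = {\<theta>. (\<forall>g. g \<notin> K \<longrightarrow> \<theta> g = 0) \<and> (\<forall>k\<in>K. \<theta> k \<noteq> 0) \<and>
     (\<forall>k\<in>K. \<forall>l\<in>K. \<theta> (k \<otimes>\<^bsub>G\<^esub> l) = \<theta> k * \<theta> l) \<and> openin T {k \<in> K. \<theta> k = 1}}"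

definition char_rep :: "('g \<Rightarrow> complex) \<Rightarrow> ('g, complex) rep" where
  "char_rep \<theta> = \<lparr>rep_scale = (*), rep_space = UNIV, rep_act = (\<lambda>g z. \<theta> g * z)\<rparr>"

lemma char_rep_simps [simp]:
  "rep_scale (char_rep \<theta>) = (*)" "rep_space (char_rep \<theta>) = UNIV" "rep_act (char_rep \<theta>) g z = \<theta> g * z"
  by (simp_all add: char_rep_def)

context topological_group
begin

lemma smooth_chars_one:
  assumes "subgroup K G" "\<theta> \<in> smooth_chars G T K"
  shows "\<theta> \<one> = 1"
proof -
  have "\<one> \<in> K"
    using assms(1) by (simp add: subgroup.one_closed)
  then have "\<theta> (\<one> \<otimes> \<one>) = \<theta> \<one> * \<theta> \<one>" "\<theta> \<one> \<noteq> 0"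
    using assms(2) unfolding smooth_chars_def by blast+
  then show ?thesis
    by simp
qed

lemma smooth_chars_inv:
  assumes "subgroup K G" "\<theta> \<in> smooth_chars G T K" "k \<in> K"
  shows "\<theta> (inv k) * \<theta> k = 1"
proof -
  have "inv k \<in> K" "k \<in> carrier G"
    using assms by (auto simp: subgroup.m_inv_closed subgroup.mem_carrier)
  then have "\<theta> (inv k \<otimes> k) = \<theta> (inv k) * \<theta> k"
    using assms(2,3) unfolding smooth_chars_def by blast
  then show ?thesis
    using smooth_chars_one[OF assms(1,2)] \<open>k \<in> carrier G\<close> by simp
qed

lemma representation_char_rep:
  assumes "subgroup K G" "\<theta> \<in> smooth_chars G T K"
  shows "representation (G\<lparr>carrier := K\<rparr>) (char_rep \<theta>)"
proof -
  interpret vector_space "(*) :: complex \<Rightarrow> complex \<Rightarrow> complex"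
    by (rule vector_space_complex)
  show ?thesis
    using assms smooth_chars_one[OF assms] vector_space_complex
    by (auto simp: Defs.representation_def smooth_chars_def algebra_simps)
qed

lemma open_subgroup_char_kernel:
  assumes K: "subgroup K G" and \<theta>: "\<theta> \<in> smooth_chars G T K"
  shows "open_subgroup {k \<in> K. \<theta> k = 1} G T"
proof -
  have "subgroup {k \<in> K. \<theta> k = 1} G"
  proof
    show "{k \<in> K. \<theta> k = 1} \<subseteq> carrier G"
      using subgroup.subset[OF K] by auto
    show "\<one> \<in> {k \<in> K. \<theta> k = 1}"
      using smooth_chars_one[OF K \<theta>] subgroup.one_closed[OF K] by simp
    show "x \<otimes> y \<in> {k \<in> K. \<theta> k = 1}" if "x \<in> {k \<in> K. \<theta> k = 1}" "y \<in> {k \<in> K. \<theta> k = 1}" for x y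
      using that \<theta> subgroup.m_closed[OF K] by (simp add: smooth_chars_def)
    show "inv x \<in> {k \<in> K. \<theta> k = 1}" if "x \<in> {k \<in> K. \<theta> k = 1}" for x
      using that smooth_chars_inv[OF K \<theta>, of x] subgroup.m_inv_closed[OF K] by simp
  qed
  then show ?thesis
    using \<theta> by (simp add: open_subgroup_def smooth_chars_def)
qed

text \<open>The kernel of \<open>\<theta>\<close> contains all commutators, and their closure as
  well because an open subgroup is closed.\<close>

lemma smooth_char_commutator:
  assumes K: "subgroup K G" and \<theta>: "\<theta> \<in> smooth_chars G T K"
    and k: "k \<in> closed_commutator_subgroup G T K"
  shows "k \<in> K" "\<theta> k = 1"
proof -
  let ?L = "{k \<in> K. \<theta> k = 1}"
  have mult: "\<theta> (x \<otimes> y) = \<theta> x * \<theta> y" if "x \<in> K" "y \<in> K" for x y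
    using \<theta> that by (simp add: smooth_chars_def)
  have "derived_set G K \<subseteq> ?L"
  proof
    fix c assume "c \<in> derived_set G K"
    then obtain a b where ab: "a \<in> K" "b \<in> K" "c = a \<otimes> b \<otimes> inv a \<otimes> inv b"
      by auto
    have "inv a \<in> K" "inv b \<in> K" "a \<otimes> b \<in> K" "a \<otimes> b \<otimes> inv a \<in> K"
      using ab K by (auto intro: subgroup.m_closed subgroup.m_inv_closed)
    then have "\<theta> c = (\<theta> (inv a) * \<theta> a) * (\<theta> (inv b) * \<theta> b)" "c \<in> K"
      using ab mult K by (auto intro: subgroup.m_closed)
    then show "c \<in> ?L"
      using smooth_chars_inv[OF K \<theta>] ab by simp
  qed
  then have "derived G K \<subseteq> ?L"
    unfolding derived_def
    using generate_subgroup_incl open_subgroup_char_kernel[OF K \<theta>] by (simp add: open_subgroup_def)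
  then have "closed_commutator_subgroup G T K \<subseteq> ?L"
    unfolding closed_commutator_subgroup_def
    using closure_of_minimal closedin_open_subgroup[OF open_subgroup_char_kernel[OF K \<theta>]] by metis
  then show "k \<in> K" "\<theta> k = 1"
    using k by auto
qed

text \<open>The kernel of the weight of \<open>v\<close> is the intersection of \<open>K\<close>
  with the stabiliser of \<open>v\<close>, hence open.\<close>

lemma weights_smooth_chars:
  assumes K: "open_subgroup K G T" and \<rho>: "smooth G T \<rho>"
  shows "weights K \<rho> \<subseteq> smooth_chars G T K"
proof
  interpret lin_rep G \<rho>
    using \<rho> is_group by (simp add: lin_rep_iff smooth_def)
  fix \<theta> assume "\<theta> \<in> weights K \<rho>"
  then obtain v where v: "v \<in> V" "v \<noteq> 0" "\<And>k. k \<in> K \<Longrightarrow> act k v = \<theta> k \<star> v"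
    and \<theta>: "\<And>g. g \<notin> K \<Longrightarrow> \<theta> g = 0"
    by (auto simp: weights_def)
  have K': "subgroup K G" "openin T K"
    using K by (auto simp: open_subgroup_def)
  have KG: "k \<in> carrier G" if "k \<in> K" for k
    using subgroup.mem_carrier[OF K'(1) that] .
  have "\<theta> k \<noteq> 0" if "k \<in> K" for k
    using v(3)[OF that] act_inv_act[OF KG[OF that] v(1)] v(2) KG[OF that] by auto
  moreover have "\<theta> (k \<otimes> l) = \<theta> k * \<theta> l" if "k \<in> K" "l \<in> K" for k l
  proof -
    have "\<theta> (k \<otimes> l) \<star> v = act (k \<otimes> l) v"
      using v(3) subgroup.m_closed[OF K'(1)] that by simp
    also have "\<dots> = act k (act l v)"
      using v(1) that KG by (simp add: act_mult)
    also have "\<dots> = (\<theta> k * \<theta> l) \<star> v"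
      using v that KG by (simp add: mult.commute)
    finally show ?thesis
      using v(2) by simp
  qed
  moreover have "{k \<in> K. \<theta> k = 1} = K \<inter> {g \<in> carrier G. act g v = v}"
    using v KG vs.scale_cancel_right[of _ v 1] by auto
  then have "openin T {k \<in> K. \<theta> k = 1}"
    using K'(2) \<rho> v(1) by (auto simp: smooth_def)
  ultimately show "\<theta> \<in> smooth_chars G T K"
    using \<theta> by (simp add: smooth_chars_def)
qed

end

lemma sum_fun_apply: "(\<Sum>i\<in>I. f i) x = (\<Sum>i\<in>I. f i x)"
  by (induction I rule: infinite_finite_induct) auto

context profinite_group
begin

text \<open>An induced function is determined by its values at coset representatives;
  \<open>\<delta> C\<close> is the one supported on \<open>C\<close> with value 1 at
  \<open>r C\<close>.\<close>

lemma Ind_char_rep_fd: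
  assumes K: "open_subgroup K G T" and \<theta>: "\<theta> \<in> smooth_chars G T K"
  shows "fd_rep G (Ind G T K (char_rep \<theta>))"
proof (rule fd_rep_smooth)
  have K': "subgroup K G"
    using K by (simp add: open_subgroup_def)
  show "smooth G T (Ind G T K (char_rep \<theta>))"
    by (rule smooth_Ind[OF K' representation_char_rep[OF K' \<theta>]])
  interpret p: vector_space "pointwise_scale (*) :: complex \<Rightarrow> ('a \<Rightarrow> complex) \<Rightarrow> 'a \<Rightarrow> complex"
    by (rule vector_space_pointwise_scale[OF vector_space_complex])
  define r where "r C = (SOME x. x \<in> C)" for C :: "'a set"
  define \<delta> where "\<delta> C x = (if x \<in> C then \<theta> (x \<otimes> inv (r C)) else 0)" for C x
  have fin: "finite (rcosets K)"
    using finite_rcosets_open_subgroup[OF K] .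
  have r: "r C \<in> C" "r C \<in> carrier G" if C: "C \<in> rcosets K" for C
  proof -
    show "r C \<in> C"
      using subgroup.rcosets_non_empty[OF K' C] by (simp add: r_def some_in_eq)
    then show "r C \<in> carrier G"
      using subgroup.rcosets_carrier[OF K' is_group C] by auto
  qed
  have "f = (\<Sum>C\<in>rcosets K. pointwise_scale (*) (f (r C)) (\<delta> C))" if f: "f \<in> rep_space (Ind G T K (char_rep \<theta>))" for f
  proof
    fix x
    have sum: "(\<Sum>C\<in>rcosets K. pointwise_scale (*) (f (r C)) (\<delta> C)) x =
        (\<Sum>C\<in>rcosets K. if x \<in> C then f (r C) * \<theta> (x \<otimes> inv (r C)) else 0)"
      by (simp add: sum_fun_apply pointwise_scale_def \<delta>_def) (rule sum.cong, auto)
    show "f x = (\<Sum>C\<in>rcosets K. pointwise_scale (*) (f (r C)) (\<delta> C)) x"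
    proof (cases "x \<in> carrier G")
      case True
      have C: "K #> x \<in> rcosets K"
        using rcosetsI subgroup.subset[OF K'] True by simp
      have "x \<in> C \<longleftrightarrow> C = K #> x" if "C \<in> rcosets K" for C
        using that True rcos_self[OF True K'] repr_independence[OF _ _ K'] unfolding RCOSETS_def by blast
      then have "(\<Sum>C\<in>rcosets K. if x \<in> C then f (r C) * \<theta> (x \<otimes> inv (r C)) else 0) =
          (\<Sum>C\<in>rcosets K. if C = K #> x then f (r C) * \<theta> (x \<otimes> inv (r C)) else 0)"
        by (intro sum.cong) auto
      also have "\<dots> = f (r (K #> x)) * \<theta> (x \<otimes> inv (r (K #> x)))"
        using fin C by simp
      also have "\<dots> = f x"
      proof -
        have "x \<in> K #> r (K #> x)"
          using repr_independence[OF r(1)[OF C] True K'] rcos_self[OF True K'] by simp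
        then have k: "x \<otimes> inv (r (K #> x)) \<in> K"
          using subgroup.rcos_module_imp[OF K' is_group r(2)[OF C]] by simp
        have "f ((x \<otimes> inv (r (K #> x))) \<otimes> r (K #> x)) = \<theta> (x \<otimes> inv (r (K #> x))) * f (r (K #> x))"
          using f k r(2)[OF C] by (simp add: mem_Ind_iff)
        then show ?thesis
          using True r(2)[OF C] by (simp add: m_assoc)
      qed
      finally show ?thesis
        using sum by simp
    next
      case False
      then have "x \<notin> C" if "C \<in> rcosets K" for C
        using subgroup.rcosets_carrier[OF K' is_group that] by auto
      then show ?thesis
        unfolding sum using False f by (simp add: mem_Ind_iff)
    qed
  qed
  then have "f \<in> p.span (\<delta> ` (rcosets K))" if "f \<in> rep_space (Ind G T K (char_rep \<theta>))" for f
    using that p.span_sum[of "rcosets K" "\<lambda>C. pointwise_scale (*) (f (r C)) (\<delta> C)" "\<delta> ` (rcosets K)"]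
      p.span_scale p.span_base by (metis (no_types, lifting) imageI)
  then show "\<exists>F. finite F \<and> rep_space (Ind G T K (char_rep \<theta>)) \<subseteq>
      module.span (rep_scale (Ind G T K (char_rep \<theta>))) F"
    using fin by (intro exI[of _ "\<delta> ` (rcosets K)"]) auto
qed

text \<open>Pairing with a weight vector embeds a representation into the representation induced from
  its weight.\<close>

lemma finite_Irr_weight:
  assumes K: "open_subgroup K G T" and \<theta>: "\<theta> \<in> smooth_chars G T K"
  shows "finite {c \<in> Irr G T. \<theta> \<in> weights K (representative c)}" (is "finite ?S")
proof -
  have K': "subgroup K G"
    using K by (simp add: open_subgroup_def)
  let ?M = "Ind G T K (char_rep \<theta>)"
  interpret M: fd_rep G ?M
    by (rule Ind_char_rep_fd[OF assms])
  have ex: "\<exists>v \<Phi>. v \<in> rep_space (representative c) \<and> v \<noteq> 0 \<and> \<Phi> \<in> hom_rep G (representative c) ?M \<and> \<Phi> \<noteq> 0"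
    if c: "c \<in> ?S" for c
  proof -
    let ?\<pi> = "representative c"
    have sm: "smooth G T ?\<pi>" "irreducible_rep G ?\<pi>"
      using Irr_representative[OF is_group] c by (auto simp: smooth_irreps_def)
    interpret fd_rep G ?\<pi>
      by (rule smooth_irreducible_fd[OF sm])
    obtain ip where "unitary_rep G ?\<pi> ip"
      using invariant_inner_product_exists by blast
    then interpret unitary_rep G ?\<pi> ip .
    obtain v where v: "v \<in> V" "v \<noteq> 0" "\<And>k. k \<in> K \<Longrightarrow> act k v = rep_scale ?\<pi> (\<theta> k) v"
      using c by (auto simp: weights_def)
    \<comment> \<open>Moving \<open>k\<close> across the pairing produces the conjugate of
      \<open>\<theta> k\<close>, and \<open>\<theta> k\<close> has modulus 1 because
      \<open>ip v v\<close> is invariant; so \<open>l\<close> is a \<open>K\<close>-map to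
      \<open>char_rep \<theta>\<close>.\<close>
    define l where "l x = (if x \<in> V then ip x v else 0)" for x
    have "ip (act k x) v = \<theta> k * ip x v" if k: "k \<in> K" and x: "x \<in> V" for k x
    proof -
      have kG: "k \<in> carrier G"
        using subgroup.mem_carrier[OF K' k] .
      have "ip v v = \<theta> k * cnj (\<theta> k) * ip v v"
        using ip_act[OF kG v(1,1)] v(1) v(3)[OF k] by (simp add: ip_scale_left ip_scale_right mult.commute)
      moreover have "ip v v \<noteq> 0"
        using ip_pos[OF v(1,2)] by auto
      ultimately have unit: "\<theta> k * cnj (\<theta> k) = 1"
        by simp
      have "ip x v = cnj (\<theta> k) * ip (act k x) v"
        using ip_act[OF kG x v(1)] v(1) v(3)[OF k] x kG by (simp add: ip_scale_right)
      then have "\<theta> k * ip x v = (\<theta> k * cnj (\<theta> k)) * ip (act k x) v"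
        by simp
      then show ?thesis
        using unit by simp
    qed
    then have l: "l \<in> hom_rep (G\<lparr>carrier := K\<rparr>) ?\<pi> (char_rep \<theta>)"
      using subgroup.mem_carrier[OF K'] v(1)
      by (auto simp: hom_rep_def l_def ip_add_left ip_scale_left)
    let ?\<Phi> = "\<lambda>v x. if v \<in> V \<and> x \<in> carrier G then l (act x v) else 0"
    have "?\<Phi> v \<one> \<noteq> 0"
      using v ip_pos[OF v(1,2)] by (auto simp: l_def)
    then have "?\<Phi> \<noteq> 0"
      using fun_cong[OF fun_cong[of ?\<Phi> 0 v], of \<one>] by auto
    then show ?thesis
      using frobenius_hom[OF K' representation_char_rep[OF K' \<theta>] sm(1) l] v by blast
  qed
  define v where "v c = (SOME v. v \<in> rep_space (representative c) \<and> v \<noteq> 0)" for c :: "('a, nat \<Rightarrow> complex) rep set"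
  define \<Phi> where "\<Phi> c = (SOME \<Phi>. \<Phi> \<in> hom_rep G (representative c) ?M \<and> \<Phi> \<noteq> 0)" for c :: "('a, nat \<Rightarrow> complex) rep set"
  have v\<Phi>: "v c \<in> rep_space (representative c) \<and> v c \<noteq> 0 \<and>
      \<Phi> c \<in> hom_rep G (representative c) ?M \<and> \<Phi> c \<noteq> 0" if "c \<in> ?S" for c
  proof -
    have "\<exists>v. v \<in> rep_space (representative c) \<and> v \<noteq> 0"
      and "\<exists>\<Phi>. \<Phi> \<in> hom_rep G (representative c) ?M \<and> \<Phi> \<noteq> 0"
      using ex[OF that] by blast+
    from someI_ex[OF this(1)] someI_ex[OF this(2)] show ?thesis
      by (simp add: v_def \<Phi>_def)
  qed
  obtain F where F: "finite F" "M.V \<subseteq> M.vs.span F"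
    using M.fin_dim by blast
  \<comment> \<open>The vectors \<open>\<Phi> c (v c)\<close> of different classes are independent
    in \<open>?M\<close>, so a finite spanning set bounds the number of classes.\<close>
  have "card I \<le> card F" if I: "finite I" "I \<subseteq> ?S" for I
  proof (rule M.vs.card_le_if_family_independent[OF I(1) F(1)])
    have vI: "v c \<in> rep_space (representative c) \<and> v c \<noteq> 0 \<and>
      \<Phi> c \<in> hom_rep G (representative c) ?M \<and> \<Phi> c \<noteq> 0" if "c \<in> I" for c
      using v\<Phi> I(2) that by blast
    show "\<Phi> c (v c) \<in> M.vs.span F" if "c \<in> I" for c
      using vI[OF that] F(2) hom_repD(1) by blast
    fix a c assume sum0: "(\<Sum>c\<in>I. rep_scale ?M (a c) (\<Phi> c (v c))) = 0" and c: "c \<in> I"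
    have irr: "irreducible_rep G (representative c)" if "c \<in> I" for c
      using Irr_representative[OF is_group, of c T] that I(2) by (auto simp: smooth_irreps_def)
    have sp: "rep_scale (representative c) (a c) (v c) \<in> rep_space (representative c)" if "c \<in> I" for c
      using irr[OF that] vI[OF that] by (intro representation_space(3)) (auto simp: irreducible_rep_def)
    have "rep_scale ?M (a c) (\<Phi> c (v c)) = \<Phi> c (rep_scale (representative c) (a c) (v c))" if "c \<in> I" for c
      using vI[OF that] hom_repD(4)[of "\<Phi> c" G "representative c" ?M "v c" "a c"] by simp
    then have "(\<Sum>c\<in>I. \<Phi> c (rep_scale (representative c) (a c) (v c))) = 0"
      using sum0 by simp
    then have "rep_scale (representative c) (a c) (v c) = 0"
      using irreducible_images_independent[where \<pi> = representative and \<phi> = \<Phi> and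
          v = "\<lambda>c. rep_scale (representative c) (a c) (v c)", OF is_group M.rep I(1) irr _ _ sp _ c]
        vI I(2) Irr_iso_unique[OF is_group] by blast
    moreover have "vector_space (rep_scale (representative c))"
      using irr[OF c] by (simp add: irreducible_rep_def Defs.representation_def)
    ultimately show "a c = 0"
      using vI[OF c] vector_space.scale_eq_0_iff by blast
  qed
  then show ?thesis
    using conjunct1[OF finite_if_finite_subsets_card_bdd[of ?S "card F"]] by blast
qed

end

section \<open>Relative FAb groups\<close>

context fd_rep
begin

text \<open>An irreducible subspace of an invariant complement of the kernel of \<open>l\<close>
  meets that kernel only in 0.\<close>

lemma irreducible_subrep_not_in_kernel:
  assumes \<sigma>: "representation G \<sigma>" and l: "l \<in> hom_rep G \<rho> \<sigma>" "l \<noteq> 0"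
  obtains W where "invariant_subspace G \<rho> W" "irreducible_rep G (\<rho>\<lparr>rep_space := W\<rparr>)" "\<exists>w\<in>W. l w \<noteq> 0"
proof -
  define U where "U = {v \<in> V. l v = 0}"
  have s: "vector_space (rep_scale \<sigma>)"
    using \<sigma> by (simp add: Defs.representation_def)
  have U: "invariant_subspace G \<rho> U"
    unfolding U_def by (rule hom_rep_kernel_invariant[OF s l(1) \<sigma>])
  obtain p where p: "\<And>v. v \<in> V \<Longrightarrow> p v \<in> U" "\<And>u. u \<in> U \<Longrightarrow> p u = u"
    "\<And>v w. v \<in> V \<Longrightarrow> w \<in> V \<Longrightarrow> p (v + w) = p v + p w"
    "\<And>c v. v \<in> V \<Longrightarrow> p (c \<star> v) = c \<star> p v"
    "\<And>g v. g \<in> carrier G \<Longrightarrow> v \<in> V \<Longrightarrow> p (act g v) = act g (p v)"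
    using equivariant_projection[OF U] by blast
  define C where "C = {v \<in> V. p v = 0}"
  have p0: "p 0 = 0"
    using p(4)[of 0 0] by simp
  have C: "invariant_subspace G \<rho> C"
    using p p0 by (auto simp: C_def invariant_subspace_def vs.subspace_def)
  interpret C: fd_rep G "\<rho>\<lparr>rep_space := C\<rparr>"
    by (rule fd_rep_subrep[OF C])
  have "\<exists>v\<in>V. l v \<noteq> 0"
    using l hom_repD(2)[OF l(1)] by (auto simp: fun_eq_iff)
  then obtain v where v: "v \<in> V" "l v \<noteq> 0"
    by blast
  have pv: "p v \<in> U" "p v \<in> V"
    using p(1)[OF v(1)] by (auto simp: U_def)
  have "p v = p (v - p v) + p (p v)"
    using p(3)[of "v - p v" "p v"] v pv by simp
  then have "v - p v \<in> C"
    using p(2)[OF pv(1)] v pv by (simp add: C_def)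
  moreover have "v - p v \<noteq> 0"
    using v pv by (auto simp: U_def)
  ultimately have "rep_space (\<rho>\<lparr>rep_space := C\<rparr>) \<noteq> {0}"
    by auto
  then obtain W where W: "invariant_subspace G (\<rho>\<lparr>rep_space := C\<rparr>) W" "W \<noteq> {0}"
    "irreducible_rep G (\<rho>\<lparr>rep_space := C\<rparr>\<lparr>rep_space := W\<rparr>)"
    by (rule C.irreducible_subrep_exists)
  have W': "invariant_subspace G \<rho> W" "W \<subseteq> C"
    using W(1) C by (auto simp: invariant_subspace_def)
  have "0 \<in> W"
    using W'(1) vs.subspace_0 by (auto simp: invariant_subspace_def)
  then obtain w where w: "w \<in> W" "w \<noteq> 0"
    using W(2) by blast
  have "l w \<noteq> 0"
  proof
    assume "l w = 0"
    then have "w \<in> U" "p w = 0"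
      using w W'(2) by (auto simp: U_def C_def)
    then show False
      using p(2) w by simp
  qed
  then show ?thesis
    using that[OF W'(1)] W(3) w by auto
qed

text \<open>Split off an irreducible \<open>W\<close> with complement \<open>C\<close> in
  \<open>U\<close>: every \<open>f\<close> is its restriction to \<open>W\<close> after the
  projection \<open>p\<close> plus its restriction to \<open>C\<close> after \<open>1 - p\<close>.
  The dimension drops from \<open>U\<close> to \<open>C\<close>.\<close>

lemma finite_span_hom_rep:
  assumes \<sigma>: "representation G \<sigma>"
    and irr: "\<And>W. invariant_subspace G \<rho> W \<Longrightarrow> irreducible_rep G (\<rho>\<lparr>rep_space := W\<rparr>) \<Longrightarrow>
      \<exists>F. finite F \<and> hom_rep G (\<rho>\<lparr>rep_space := W\<rparr>) \<sigma> \<subseteq> module.span (pointwise_scale (rep_scale \<sigma>)) F"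
  shows "\<exists>F. finite F \<and> hom_rep G \<rho> \<sigma> \<subseteq> module.span (pointwise_scale (rep_scale \<sigma>)) F"
proof -
  have s: "vector_space (rep_scale \<sigma>)"
    using \<sigma> by (simp add: Defs.representation_def)
  interpret s: vector_space "rep_scale \<sigma>"
    by (rule s)
  interpret ps: vector_space "pointwise_scale (rep_scale \<sigma>) :: complex \<Rightarrow> ('c \<Rightarrow> 'd) \<Rightarrow> 'c \<Rightarrow> 'd"
    by (rule vector_space_pointwise_scale[OF s])
  have "\<exists>F. finite F \<and> hom_rep G (\<rho>\<lparr>rep_space := U\<rparr>) \<sigma> \<subseteq> ps.span F"
    if "invariant_subspace G \<rho> U" for U
    using that
  proof (induction "vs.dim U" arbitrary: U rule: less_induct)
    case less
    note U = less.prems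
    have UV: "u \<in> V" if "u \<in> U" for u
      using U that by (auto simp: invariant_subspace_def)
    interpret U: fd_rep G "\<rho>\<lparr>rep_space := U\<rparr>"
      by (rule fd_rep_subrep[OF U])
    show ?case
    proof (cases "U = {0}")
      case True
      have "f = 0" if f: "f \<in> hom_rep G (\<rho>\<lparr>rep_space := U\<rparr>) \<sigma>" for f
      proof
        fix v
        show "f v = 0 v"
          using hom_repD(2)[OF f, of v] hom_rep_0[OF U.rep s f] True by (cases "v = 0") auto
      qed
      then show ?thesis
        using ps.span_zero by (intro exI[of _ "{}"]) auto
    next
      case False
      then have "rep_space (\<rho>\<lparr>rep_space := U\<rparr>) \<noteq> {0}"
        by simp
      then obtain W where W: "invariant_subspace G (\<rho>\<lparr>rep_space := U\<rparr>) W" "W \<noteq> {0}"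
        "irreducible_rep G (\<rho>\<lparr>rep_space := U\<rparr>\<lparr>rep_space := W\<rparr>)"
        by (rule U.irreducible_subrep_exists)
      have W': "invariant_subspace G \<rho> W" "W \<subseteq> U"
        using W(1) U by (auto simp: invariant_subspace_def)
      obtain p where "\<And>v. v \<in> U.V \<Longrightarrow> p v \<in> W" "\<And>u. u \<in> W \<Longrightarrow> p u = u"
        "\<And>v w. v \<in> U.V \<Longrightarrow> w \<in> U.V \<Longrightarrow> p (v + w) = p v + p w"
        "\<And>c v. v \<in> U.V \<Longrightarrow> p (U.scl c v) = U.scl c (p v)"
        "\<And>g v. g \<in> carrier G \<Longrightarrow> v \<in> U.V \<Longrightarrow> p (U.act g v) = U.act g (p v)"
        using U.equivariant_projection[OF W(1)] by blast
      then have p: "\<And>v. v \<in> U \<Longrightarrow> p v \<in> W" "\<And>u. u \<in> W \<Longrightarrow> p u = u"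
        "\<And>v w. v \<in> U \<Longrightarrow> w \<in> U \<Longrightarrow> p (v + w) = p v + p w"
        "\<And>c v. v \<in> U \<Longrightarrow> p (scl c v) = scl c (p v)"
        "\<And>g v. g \<in> carrier G \<Longrightarrow> v \<in> U \<Longrightarrow> p (act g v) = act g (p v)"
        by simp_all
      define C where "C = {v \<in> U. p v = 0}"
      have p0: "p 0 = 0"
        using p(4)[of 0 0] U.V_zero by simp
      have C: "invariant_subspace G \<rho> C"
        using U p p0 by (auto simp: C_def invariant_subspace_def vs.subspace_def)
      have "0 \<in> W"
        using W'(1) vs.subspace_0 by (auto simp: invariant_subspace_def)
      then obtain w where w: "w \<in> W" "w \<noteq> 0"
        using W(2) by blast
      then have "w \<in> U" "w \<notin> C"
        using W'(2) p(2)[OF w(1)] by (auto simp: C_def)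
      then have CU: "C \<subset> U"
        by (auto simp: C_def)
      have dim: "vs.dim C < vs.dim U"
        using dim_less[OF C CU] UV by blast
      obtain F1 where F1: "finite F1" "hom_rep G (\<rho>\<lparr>rep_space := W\<rparr>) \<sigma> \<subseteq> ps.span F1"
        using irr[OF W'(1)] W(3) by auto
      obtain F2 where F2: "finite F2" "hom_rep G (\<rho>\<lparr>rep_space := C\<rparr>) \<sigma> \<subseteq> ps.span F2"
        using less.hyps[OF dim C] by blast
      \<comment> \<open>\<open>L1\<close> and \<open>L2\<close> extend maps from \<open>W\<close>
        and from \<open>C\<close> to \<open>U\<close>; being linear on all functions, they carry
        finite spanning sets to finite spanning sets.\<close>
      define L1 where "L1 f = (\<lambda>v. if v \<in> U then f (p v) else 0)" for f :: "'c \<Rightarrow> 'd"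
      define L2 where "L2 f = (\<lambda>v. if v \<in> U then f (v - p v) else 0)" for f :: "'c \<Rightarrow> 'd"
      interpret L1: module_hom "pointwise_scale (rep_scale \<sigma>)" "pointwise_scale (rep_scale \<sigma>)" L1
        by unfold_locales (auto simp: L1_def pointwise_scale_def fun_eq_iff)
      interpret L2: module_hom "pointwise_scale (rep_scale \<sigma>)" "pointwise_scale (rep_scale \<sigma>)" L2
        by unfold_locales (auto simp: L2_def pointwise_scale_def fun_eq_iff)
      have "f \<in> ps.span (L1 ` F1 \<union> L2 ` F2)" if f: "f \<in> hom_rep G (\<rho>\<lparr>rep_space := U\<rparr>) \<sigma>" for f
      proof -
        have fW: "(\<lambda>v. if v \<in> W then f v else 0) \<in> ps.span F1"
          using U.hom_rep_restrict[OF f W(1)] F1(2) by auto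
        have "invariant_subspace G (\<rho>\<lparr>rep_space := U\<rparr>) C"
          using C CU by (auto simp: invariant_subspace_def)
        then have fC: "(\<lambda>v. if v \<in> C then f v else 0) \<in> ps.span F2"
          using U.hom_rep_restrict[OF f] F2(2) by auto
        have "f v = (L1 (\<lambda>v. if v \<in> W then f v else 0) + L2 (\<lambda>v. if v \<in> C then f v else 0)) v" for v
        proof (cases "v \<in> U")
          case True
          have pv: "p v \<in> W" "p v \<in> U" "v - p v \<in> U"
            using p(1)[OF True] W'(2) True U.V_diff[of v "p v"] by auto
          have "p v = p (v - p v) + p (p v)"
            using p(3)[OF pv(3,2)] by simp
          then have "v - p v \<in> C"
            using p(2)[OF pv(1)] pv by (simp add: C_def)
          moreover have "f v = f (v - p v) + f (p v)"
            using hom_repD(3)[OF f, of "v - p v" "p v"] pv by simp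
          ultimately show ?thesis
            using True pv by (simp add: L1_def L2_def add.commute)
        qed (use hom_repD(2)[OF f] in \<open>simp add: L1_def L2_def\<close>)
        then have f_eq: "f = L1 (\<lambda>v. if v \<in> W then f v else 0) + L2 (\<lambda>v. if v \<in> C then f v else 0)"
          by blast
        have "L1 (\<lambda>v. if v \<in> W then f v else 0) \<in> ps.span (L1 ` F1)"
          unfolding L1.span_image using fW by blast
        then have "L1 (\<lambda>v. if v \<in> W then f v else 0) \<in> ps.span (L1 ` F1 \<union> L2 ` F2)"
          using ps.span_mono[of "L1 ` F1" "L1 ` F1 \<union> L2 ` F2"] by blast
        moreover have "L2 (\<lambda>v. if v \<in> C then f v else 0) \<in> ps.span (L2 ` F2)"
          unfolding L2.span_image using fC by blast
        then have "L2 (\<lambda>v. if v \<in> C then f v else 0) \<in> ps.span (L1 ` F1 \<union> L2 ` F2)"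
          using ps.span_mono[of "L2 ` F2" "L1 ` F1 \<union> L2 ` F2"] by blast
        ultimately show ?thesis
          by (subst f_eq) (rule ps.span_add)
      qed
      then show ?thesis
        using F1(1) F2(1) by (intro exI[of _ "L1 ` F1 \<union> L2 ` F2"]) auto
    qed
  qed
  from this[OF invariant_subspace_V] show ?thesis
    by simp
qed

lemma weights_nonempty:
  assumes "\<And>a b v. a \<in> carrier G \<Longrightarrow> b \<in> carrier G \<Longrightarrow> v \<in> V \<Longrightarrow> act a (act b v) = act b (act a v)" "V \<noteq> {0}"
  shows "weights (carrier G) \<rho> \<noteq> {}"
proof -
  obtain w where w: "w \<in> V" "w \<noteq> 0" "\<And>g. g \<in> carrier G \<Longrightarrow> \<exists>c. act g w = c \<star> w"
    using common_eigenvector[OF assms] by blast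
  then obtain c where "\<And>g. g \<in> carrier G \<Longrightarrow> act g w = c g \<star> w"
    by metis
  then have "(\<lambda>g. if g \<in> carrier G then c g else 0) \<in> weights (carrier G) \<rho>"
    using w by (auto simp: weights_def)
  then show ?thesis
    by blast
qed

end

context topological_group
begin

text \<open>The quotient of two extensions of a given character is constant on the finitely many
  cosets, hence takes finitely many values, and these are roots of unity.\<close>

lemma finite_smooth_chars_extending:
  assumes K: "subgroup K G" and A: "subgroup A G" "A \<subseteq> K"
    and fin: "finite (carrier (G\<lparr>carrier := K\<rparr> Mod (A <#> closed_commutator_subgroup G T K)))"
  shows "finite {\<theta> \<in> smooth_chars G T K. \<forall>a\<in>A. \<theta> a = \<eta> a}" (is "finite ?\<Theta>")
proof (cases "?\<Theta> = {}")
  case False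
  then obtain \<theta>0 where \<theta>0: "\<theta>0 \<in> ?\<Theta>"
    by blast
  let ?D = "closed_commutator_subgroup G T K"
  define N where "N = A <#> ?D"
  define Q where "Q = (\<lambda>x. N #> x) ` K"
  have finQ: "finite Q"
    using fin by (simp add: Q_def N_def carrier_FactGroup)
  have KG: "k \<in> carrier G" if "k \<in> K" for k
    using subgroup.mem_carrier[OF K that] .
  have mult: "\<theta> (x \<otimes> y) = \<theta> x * \<theta> y" if "\<theta> \<in> ?\<Theta>" "x \<in> K" "y \<in> K" for \<theta> x y
    using that by (simp add: smooth_chars_def)
  have nz: "\<theta> x \<noteq> 0" if "\<theta> \<in> ?\<Theta>" "x \<in> K" for \<theta> x
    using that by (simp add: smooth_chars_def)
  \<comment> \<open>All extensions agree on \<open>N\<close>: they equal \<open>\<eta>\<close> on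
    \<open>A\<close> and are 1 on \<open>?D\<close>.\<close>
  have N: "n \<in> K" "\<theta> n = \<theta>0 n" if "n \<in> N" "\<theta> \<in> ?\<Theta>" for n \<theta>
  proof -
    obtain a d where ad: "a \<in> A" "d \<in> ?D" "n = a \<otimes> d"
      using \<open>n \<in> N\<close> by (auto simp: N_def set_mult_def)
    have d: "d \<in> K" "\<theta> d = 1" "\<theta>0 d = 1"
      using smooth_char_commutator[OF K _ ad(2)] that \<theta>0 by auto
    show "n \<in> K"
      using ad d A(2) subgroup.m_closed[OF K] by auto
    have "\<theta> a = \<eta> a" "\<theta>0 a = \<eta> a"
      using that \<theta>0 ad(1) by auto
    then show "\<theta> n = \<theta>0 n"
      using mult[OF that(2) _ d(1), of a] mult[OF \<theta>0 _ d(1), of a] ad A(2) d by auto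
  qed
  have "\<one> \<in> ?D"
    unfolding closed_commutator_subgroup_def
    using closure_of_subset[of "derived G K" T] derived_in_carrier[OF subgroup.subset[OF K]] topspace_eq
      subgroup.one_closed[OF derived_is_subgroup[OF subgroup.subset[OF K]]] by auto
  then have "\<one> \<otimes> \<one> \<in> N"
    unfolding N_def set_mult_def using subgroup.one_closed[OF A(1)] by blast
  then have oneN: "\<one> \<in> N"
    by simp
  have quot: "\<theta> x / \<theta>0 x = \<theta> y / \<theta>0 y" if \<theta>: "\<theta> \<in> ?\<Theta>" and xy: "x \<in> K" "y \<in> K" "N #> x = N #> y" for \<theta> x y
  proof -
    have "\<one> \<otimes> x \<in> N #> x"
      using oneN by (auto simp: r_coset_def)
    then have "x \<in> N #> y"
      using xy KG by simp
    then obtain n where n: "n \<in> N" "x = n \<otimes> y"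
      by (auto simp: r_coset_def)
    have "\<theta> x = \<theta>0 n * \<theta> y" "\<theta>0 x = \<theta>0 n * \<theta>0 y"
      using n N[OF n(1) \<theta>] mult[OF \<theta> _ xy(2)] mult[OF \<theta>0 _ xy(2)] by auto
    then show ?thesis
      using nz[OF \<theta>0 N(1)[OF n(1) \<theta>]] by simp
  qed
  define Z where "Z = (\<Union>k\<in>{1..card Q}. {z::complex. z ^ k = 1})"
  have finZ: "finite Z"
    unfolding Z_def by (intro finite_UN_I) (auto intro!: finite_roots_unity)
  have quotZ: "\<theta> x / \<theta>0 x \<in> Z" if \<theta>: "\<theta> \<in> ?\<Theta>" and x: "x \<in> K" for \<theta> x
  proof -
    let ?z = "\<theta> x / \<theta>0 x"
    have xk: "x [^] (i::nat) \<in> K" for i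
      by (induction i) (use x subgroup.one_closed[OF K] subgroup.m_closed[OF K] in auto)
    have pow: "\<theta>' (x [^] (i::nat)) = \<theta>' x ^ i" if "\<theta>' \<in> ?\<Theta>" for \<theta>' i
    proof (induction i)
      case 0
      then show ?case using smooth_chars_one[OF K] that by simp
    next
      case (Suc i)
      then show ?case using mult[OF that xk x] by simp
    qed
    \<comment> \<open>These are \<open>card Q + 1\<close> powers, so two of them share a coset, and
      the quotient of the characters at \<open>x\<close> is a root of unity of order at most
      \<open>card Q\<close>.\<close>
    have "\<not> inj_on (\<lambda>i::nat. N #> (x [^] i)) {0..card Q}"
    proof
      assume "inj_on (\<lambda>i::nat. N #> (x [^] i)) {0..card Q}"
      then have "card {0..card Q} \<le> card Q"
        by (rule card_inj_on_le[OF _ _ finQ]) (use xk in \<open>auto simp: Q_def\<close>)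
      then show False by simp
    qed
    then obtain i j :: nat where ij: "i < j" "j \<le> card Q" "N #> (x [^] i) = N #> (x [^] j)"
      unfolding inj_on_def by (metis atLeastAtMost_iff linorder_neqE_nat)
    have "?z ^ i = ?z ^ j"
      using quot[OF \<theta> xk xk ij(3)] pow[OF \<theta>] pow[OF \<theta>0] by (simp add: power_divide)
    also have "\<dots> = ?z ^ i * ?z ^ (j - i)"
      using ij(1) by (simp flip: power_add)
    finally have "?z ^ (j - i) = 1"
      using nz[OF \<theta> x] nz[OF \<theta>0 x] by simp
    then show ?thesis
      using ij by (auto simp: Z_def intro!: bexI[of _ "j - i"])
  qed
  define r where "r C = (SOME x. x \<in> K \<and> N #> x = C)" for C
  have r: "r C \<in> K" "N #> r C = C" if "C \<in> Q" for C
  proof -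
    have "\<exists>x. x \<in> K \<and> N #> x = C"
      using that by (auto simp: Q_def)
    from someI_ex[OF this] show "r C \<in> K" "N #> r C = C"
      by (simp_all add: r_def)
  qed
  define enc where "enc \<theta> = restrict (\<lambda>C. \<theta> (r C) / \<theta>0 (r C)) Q" for \<theta>
  have "enc ` ?\<Theta> \<subseteq> PiE Q (\<lambda>_. Z)"
    using quotZ r(1) by (auto simp: enc_def)
  moreover have "finite (PiE Q (\<lambda>_. Z))"
    using finQ finZ by (intro finite_PiE) auto
  ultimately have "finite (enc ` ?\<Theta>)"
    using finite_subset by blast
  moreover have "inj_on enc ?\<Theta>"
  proof (rule inj_onI, rule ext)
    fix \<theta> \<theta>' x assume \<theta>: "\<theta> \<in> ?\<Theta>" "\<theta>' \<in> ?\<Theta>" "enc \<theta> = enc \<theta>'"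
    show "\<theta> x = \<theta>' x"
    proof (cases "x \<in> K")
      case True
      then have C: "N #> x \<in> Q"
        by (auto simp: Q_def)
      have "\<theta> x / \<theta>0 x = \<theta>' x / \<theta>0 x"
        using quot[OF \<theta>(1) True r(1)[OF C] r(2)[OF C, symmetric]]
          quot[OF \<theta>(2) True r(1)[OF C] r(2)[OF C, symmetric]] fun_cong[OF \<theta>(3), of "N #> x"] C
        by (simp add: enc_def)
      then show ?thesis
        using nz[OF \<theta>0 True] by simp
    next
      case False
      then show ?thesis
        using \<theta> by (simp add: smooth_chars_def)
    qed
  qed
  ultimately show ?thesis
    using finite_imageD by blast
qed (simp only: finite.emptyI)

end

section \<open>From finite relative abelian quotients to strong admissibility\<close>

context profinite_group
begin

text \<open>As \<open>K\<close> acts by commuting operators, the eigenspace \<open>U\<close> of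
  \<open>\<eta>\<close> is stable under \<open>K\<close>. A common eigenvector of \<open>K\<close>
  in \<open>U\<close> has a weight that agrees with \<open>\<eta>\<close> on
  \<open>H \<inter> K\<close>.\<close>

lemma weight_extension:
  assumes K: "open_subgroup K G T" and H: "subgroup H G"
    and \<pi>: "smooth G T \<pi>" "fd_rep G \<pi>"
    and comm: "\<And>a b v. a \<in> K \<Longrightarrow> b \<in> K \<Longrightarrow> v \<in> rep_space \<pi> \<Longrightarrow>
      rep_act \<pi> a (rep_act \<pi> b v) = rep_act \<pi> b (rep_act \<pi> a v)"
    and \<eta>: "\<eta> \<in> weights (H \<inter> K) \<pi>"
  obtains \<theta> where "\<theta> \<in> weights K \<pi>" "\<And>a. a \<in> H \<inter> K \<Longrightarrow> \<theta> a = \<eta> a"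
proof -
  interpret fd_rep G \<pi>
    by (rule \<pi>(2))
  have K': "subgroup K G"
    using K by (simp add: open_subgroup_def)
  have KG: "k \<in> carrier G" if "k \<in> K" for k
    using subgroup.mem_carrier[OF K' that] .
  interpret K: fd_rep "G\<lparr>carrier := K\<rparr>" \<pi>
    by (rule fd_rep_subgroup[OF K'])
  define U where "U = {v \<in> V. \<forall>a\<in>H \<inter> K. act a v = scl (\<eta> a) v}"
  have "act a (act k v) = scl (\<eta> a) (act k v)" if "k \<in> K" "v \<in> U" "a \<in> H \<inter> K" for k v a
    using comm[of a k v] that KG by (simp add: U_def)
  then have U: "invariant_subspace (G\<lparr>carrier := K\<rparr>) \<pi> U"
    using KG by (auto simp: U_def invariant_subspace_def vs.subspace_def vs.scale_right_distrib vs.scale_left_commute)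
  interpret U: fd_rep "G\<lparr>carrier := K\<rparr>" "\<pi>\<lparr>rep_space := U\<rparr>"
    by (rule K.fd_rep_subrep[OF U])
  have "U \<noteq> {0}"
    using \<eta> by (auto simp: weights_def U_def)
  then have "weights K (\<pi>\<lparr>rep_space := U\<rparr>) \<noteq> {}"
    using U.weights_nonempty comm by (simp add: U_def)
  then obtain \<theta> v where \<theta>: "\<forall>g. g \<notin> K \<longrightarrow> \<theta> g = 0" and
    v: "v \<in> U" "v \<noteq> 0" "\<And>k. k \<in> K \<Longrightarrow> act k v = scl (\<theta> k) v"
    by (auto simp: weights_def)
  have "\<theta> \<in> weights K \<pi>"
    using \<theta> v by (auto simp: weights_def U_def)
  moreover have "\<theta> a = \<eta> a" if "a \<in> H \<inter> K" for a
  proof -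
    have "scl (\<theta> a) v = scl (\<eta> a) v"
      using v(1) v(3)[of a] that by (auto simp: U_def)
    then show ?thesis
      using v(2) by simp
  qed
  ultimately show ?thesis
    using that by blast
qed

text \<open>The index of the subgroup in Jordan's theorem is bounded in terms of the degree alone, so
  \<open>K\<close> can be the intersection of all open subgroups of at most that index.\<close>

lemma uniform_abelian_subgroup:
  assumes "topologically_fg G T"
  obtains K where "open_subgroup K G T"
    "\<And>(\<pi> :: ('a, 'v::ab_group_add) rep) a b v. smooth G T \<pi> \<Longrightarrow> degree_rep \<pi> \<le> enat d \<Longrightarrow>
      a \<in> K \<Longrightarrow> b \<in> K \<Longrightarrow> v \<in> rep_space \<pi> \<Longrightarrow> rep_act \<pi> a (rep_act \<pi> b v) = rep_act \<pi> b (rep_act \<pi> a v)"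
proof -
  obtain K where K: "open_subgroup K G T"
    "\<And>U. open_subgroup U G T \<Longrightarrow> card (rcosets U) \<le> jordan_bound d \<Longrightarrow> K \<subseteq> U"
    using open_subgroup_Inter_index_le[OF assms] by blast
  have "rep_act \<pi> a (rep_act \<pi> b v) = rep_act \<pi> b (rep_act \<pi> a v)"
    if \<pi>: "smooth G T \<pi>" and deg: "degree_rep \<pi> \<le> enat d" and ab: "a \<in> K" "b \<in> K" and v: "v \<in> rep_space \<pi>"
    for \<pi> :: "('a, 'v::ab_group_add) rep" and a b v
  proof -
    have "vector_space (rep_scale \<pi>)"
      using \<pi> by (simp add: smooth_def Defs.representation_def)
    from deg[unfolded degree_rep_def edim_le_iff[OF this]]
    obtain F where F: "finite F" "rep_space \<pi> \<subseteq> module.span (rep_scale \<pi>) F" "card F \<le> d"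
      by blast
    then have fd: "\<exists>F. finite F \<and> rep_space \<pi> \<subseteq> module.span (rep_scale \<pi>) F"
      by blast
    interpret fd_rep G \<pi>
      by (rule fd_rep_smooth[OF \<pi> fd])
    obtain A where A: "subgroup A G" "\<And>g. g \<in> carrier G \<Longrightarrow> (\<And>v. v \<in> V \<Longrightarrow> act g v = v) \<Longrightarrow> g \<in> A"
      "card (rcosets A) \<le> jordan_bound d"
      "\<And>a b v. a \<in> A \<Longrightarrow> b \<in> A \<Longrightarrow> v \<in> V \<Longrightarrow> act a (act b v) = act b (act a v)"
      using Jordan[OF F] by metis
    obtain U where U: "open_subgroup U G T" "\<And>u v. u \<in> U \<Longrightarrow> v \<in> V \<Longrightarrow> act u v = v"
      using smooth_fd_open_kernel[OF \<pi> fd] by blast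
    \<comment> \<open>Jordan's subgroup contains the open kernel, so it is open itself and one of
      the subgroups that contain \<open>K\<close>.\<close>
    have "U \<subseteq> A"
      using U A(2) subgroup.mem_carrier by (metis open_subgroup_def subsetI)
    then have "open_subgroup A G T"
      using open_subgroupI[OF A(1), of U] U(1) subgroup.one_closed by (auto simp: open_subgroup_def)
    then have "K \<subseteq> A"
      using K(2) A(3) by blast
    then show ?thesis
      using A(4) ab v by blast
  qed
  then show ?thesis
    using that K(1) by blast
qed

lemma FAb_imp_strongly_admissible_Ind:
  fixes \<sigma> :: "('a, 'w::ab_group_add) rep"
  assumes fg: "topologically_fg G T" and H: "subgroup H G" and FAb: "FAb_relative G T H"
    and \<sigma>: "strongly_admissible (G\<lparr>carrier := H\<rparr>) (subtopology T H) \<sigma>"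
  shows "strongly_admissible G T (Ind G T H \<sigma>)"
proof -
  let ?H = "G\<lparr>carrier := H\<rparr>" and ?TH = "subtopology T H"
  have HG: "H \<subseteq> carrier G"
    using subgroup.subset[OF H] .
  have gH: "group ?H"
    using subgroup_imp_group[OF H] .
  have \<sigma>_sm: "smooth ?H ?TH \<sigma>"
    and \<sigma>_adm: "\<And>c. c \<in> Irr ?H ?TH \<Longrightarrow> multiplicity_rep ?H (representative c) \<sigma> < \<infinity>"
    and \<sigma>_fin: "\<And>d. finite {c \<in> Irr ?H ?TH. degree_rep (representative c) \<le> enat d \<and>
      \<not> hom_rep ?H (representative c) \<sigma> \<subseteq> {0}}"
    using \<sigma> unfolding strongly_admissible_iff[OF gH] by blast+
  have \<sigma>_rep: "representation ?H \<sigma>"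
    using \<sigma>_sm by (simp add: smooth_def)
  then have \<sigma>_vs: "vector_space (rep_scale \<sigma>)"
    by (simp add: Defs.representation_def)
  have Ind_sm: "smooth G T (Ind G T H \<sigma>)"
    by (rule smooth_Ind[OF H \<sigma>_rep])
  have rep_sm: "smooth G T (representative c)" "irreducible_rep G (representative c)" if "c \<in> Irr G T" for c
    using Irr_representative[OF is_group that] by (auto simp: smooth_irreps_def)
  \<comment> \<open>An \<open>H\<close>-stable subspace of a representation on
    \<open>nat \<Rightarrow> complex\<close> lives on the same type, so \<open>Irr_cover\<close>
    provides its class directly.\<close>
  have cover: "\<exists>c'\<in>Irr ?H ?TH. iso_rep ?H (representative c') (\<pi>\<lparr>rep_space := W\<rparr>) \<and>
      representation ?H (representative c') \<and> representation ?H (\<pi>\<lparr>rep_space := W\<rparr>)"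
    if \<pi>: "smooth G T \<pi>" and W: "invariant_subspace ?H \<pi> W" "irreducible_rep ?H (\<pi>\<lparr>rep_space := W\<rparr>)"
    for \<pi> :: "('a, nat \<Rightarrow> complex) rep" and W
  proof -
    have "smooth ?H ?TH (\<pi>\<lparr>rep_space := W\<rparr>)"
      by (rule smooth_subrep[OF gH smooth_subgroup[OF is_group \<pi> H] W(1)])
    then have mem: "\<pi>\<lparr>rep_space := W\<rparr> \<in> smooth_irreps ?H ?TH"
      using W(2) by (simp add: smooth_irreps_def)
    then obtain c' where c': "c' \<in> Irr ?H ?TH" "iso_rep ?H (representative c') (\<pi>\<lparr>rep_space := W\<rparr>)"
      using Irr_cover[OF gH] by blast
    moreover have "representation ?H (representative c')"
      using Irr_representative[OF gH c'(1)] by (simp add: smooth_irreps_def smooth_def)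
    ultimately show ?thesis
      using mem by (auto simp: smooth_irreps_def smooth_def)
  qed
  have adm: "multiplicity_rep G (representative c) (Ind G T H \<sigma>) < \<infinity>" if c: "c \<in> Irr G T" for c
  proof -
    let ?\<pi> = "representative c"
    interpret fd_rep G ?\<pi>
      using smooth_irreducible_fd rep_sm[OF c] by blast
    interpret H: fd_rep ?H ?\<pi>
      by (rule fd_rep_subgroup[OF H])
    interpret s: vector_space "rep_scale \<sigma>"
      by (rule \<sigma>_vs)
    \<comment> \<open>The restriction to \<open>H\<close> is broken into irreducible constituents,
      whose multiplicities in \<open>\<sigma>\<close> are finite by admissibility.\<close>
    have fd: "\<exists>F. finite F \<and> hom_rep ?H ?\<pi> \<sigma> \<subseteq> module.span (pointwise_scale (rep_scale \<sigma>)) F"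
    proof (rule H.finite_span_hom_rep[OF \<sigma>_rep])
      fix W assume W: "invariant_subspace ?H ?\<pi> W" "irreducible_rep ?H (?\<pi>\<lparr>rep_space := W\<rparr>)"
      obtain c' where c': "c' \<in> Irr ?H ?TH" "iso_rep ?H (representative c') (?\<pi>\<lparr>rep_space := W\<rparr>)"
        "representation ?H (representative c')" "representation ?H (?\<pi>\<lparr>rep_space := W\<rparr>)"
        using cover[OF rep_sm(1)[OF c] W] by blast
      then have "multiplicity_rep ?H (?\<pi>\<lparr>rep_space := W\<rparr>) \<sigma> < \<infinity>"
        using multiplicity_rep_finite_iso[OF c'(3,4) \<sigma>_rep c'(2) \<sigma>_adm] by blast
      then show "\<exists>F. finite F \<and> hom_rep ?H (?\<pi>\<lparr>rep_space := W\<rparr>) \<sigma> \<subseteq>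
          module.span (pointwise_scale (rep_scale \<sigma>)) F"
        unfolding multiplicity_rep_def edim_less_infinity_iff .
    qed
    \<comment> \<open>Frobenius reciprocity as a linear operation on all functions; it reaches every
      equivariant map into the induced representation.\<close>
    define L where "L f = (\<lambda>v x. if v \<in> V \<and> x \<in> carrier G then f (act x v) else 0)"
      for f :: "(nat \<Rightarrow> complex) \<Rightarrow> 'w"
    have sub: "hom_rep G ?\<pi> (Ind G T H \<sigma>) \<subseteq> L ` hom_rep ?H ?\<pi> \<sigma>"
    proof
      fix F assume F: "F \<in> hom_rep G ?\<pi> (Ind G T H \<sigma>)"
      note ev = frobenius_eval[OF H \<sigma>_rep rep F]
      have "F v x = L (\<lambda>v. F v \<one>) v x" for v x
        using ev(2,3)[of v x] hom_repD(2)[OF F, of v] by (cases "v \<in> V"; cases "x \<in> carrier G") (simp_all add: L_def)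
      then have "F = L (\<lambda>v. F v \<one>)"
        by (intro ext)
      then show "F \<in> L ` hom_rep ?H ?\<pi> \<sigma>"
        using ev(1) by blast
    qed
    have "\<exists>F. finite F \<and> hom_rep G ?\<pi> (Ind G T H \<sigma>) \<subseteq>
        module.span (pointwise_scale (pointwise_scale (rep_scale \<sigma>))) F"
      by (rule finite_span_linear_image[OF vector_space_pointwise_scale[OF \<sigma>_vs]
            vector_space_pointwise_scale[OF vector_space_pointwise_scale[OF \<sigma>_vs]] _ _ fd sub])
        (auto simp: L_def fun_eq_iff pointwise_scale_def s.scale_zero_right)
    then show ?thesis
      unfolding multiplicity_rep_def edim_less_infinity_iff by simp
  qed
  have "finite {c \<in> Irr G T. degree_rep (representative c) \<le> enat d \<and>
      \<not> hom_rep G (representative c) (Ind G T H \<sigma>) \<subseteq> {0}}" (is "finite ?C") for d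
  proof -
    obtain K where K: "open_subgroup K G T"
      "\<And>(\<pi> :: ('a, nat \<Rightarrow> complex) rep) a b v. smooth G T \<pi> \<Longrightarrow> degree_rep \<pi> \<le> enat d \<Longrightarrow> a \<in> K \<Longrightarrow> b \<in> K \<Longrightarrow>
        v \<in> rep_space \<pi> \<Longrightarrow> rep_act \<pi> a (rep_act \<pi> b v) = rep_act \<pi> b (rep_act \<pi> a v)"
      using uniform_abelian_subgroup[OF fg] by blast
    have K': "subgroup K G"
      using K(1) by (simp add: open_subgroup_def)
    have HK: "subgroup (H \<inter> K) G" "H \<inter> K \<subseteq> K" "H \<inter> K \<subseteq> H"
      using subgroups_Inter_pair[OF H K'] by auto
    \<comment> \<open>A constituent over \<open>H\<close> of a representation of degree at most
      \<open>d\<close> again has degree at most \<open>d\<close>; hence strong admissibility of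
      \<open>\<sigma>\<close> with this same \<open>d\<close> applies.\<close>
    define \<T> where "\<T> = {c \<in> Irr ?H ?TH. degree_rep (representative c) \<le> enat d \<and>
      \<not> hom_rep ?H (representative c) \<sigma> \<subseteq> {0}}"
    define \<Theta> where "\<Theta> \<eta> = {\<theta> \<in> smooth_chars G T K. \<forall>a\<in>H \<inter> K. \<theta> a = \<eta> a}" for \<eta>
    have fin\<Theta>: "finite (\<Theta> \<eta>)" for \<eta>
      unfolding \<Theta>_def using FAb K(1) finite_smooth_chars_extending[OF K' HK(1,2)]
      by (simp add: FAb_relative_def)
    have finw: "finite (weights (H \<inter> K) (representative c))" if c: "c \<in> \<T>" for c
    proof -
      have r: "representation ?H (representative c)"
        using Irr_representative[OF gH] c by (auto simp: \<T>_def smooth_irreps_def smooth_def)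
      then interpret R: lin_rep ?H "representative c"
        using gH by (simp add: lin_rep_iff)
      have "edim (rep_scale (representative c)) (rep_space (representative c)) < \<infinity>"
        using c by (auto simp: \<T>_def degree_rep_def intro: le_less_trans)
      then show ?thesis
        unfolding edim_less_infinity_iff using R.finite_weights[of "H \<inter> K"] HK(3) by simp
    qed
    \<comment> \<open>Each class is caught by a chain: a constituent \<open>t\<close> over
      \<open>H\<close>, a weight \<open>\<eta>\<close> of \<open>t\<close>, an extension
      \<open>\<theta>\<close> of \<open>\<eta>\<close> to \<open>K\<close>. Every link leaves
      finitely many choices.\<close>
    have "?C \<subseteq> (\<Union>t\<in>\<T>. \<Union>\<eta>\<in>weights (H \<inter> K) (representative t). \<Union>\<theta>\<in>\<Theta> \<eta>.
        {c \<in> Irr G T. \<theta> \<in> weights K (representative c)})"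
    proof
      fix c assume "c \<in> ?C"
      then have c: "c \<in> Irr G T" "degree_rep (representative c) \<le> enat d"
        "\<not> hom_rep G (representative c) (Ind G T H \<sigma>) \<subseteq> {0}"
        by auto
      let ?\<pi> = "representative c"
      interpret fd_rep G ?\<pi>
        using smooth_irreducible_fd rep_sm[OF c(1)] by blast
      interpret H: fd_rep ?H ?\<pi>
        by (rule fd_rep_subgroup[OF H])
      note comm = K(2)[OF rep_sm(1)[OF c(1)] c(2)]
      obtain F where F: "F \<in> hom_rep G ?\<pi> (Ind G T H \<sigma>)" "F \<noteq> 0"
        using c(3) by auto
      note ev = frobenius_eval[OF H \<sigma>_rep rep F(1)]
      have "(\<lambda>v. F v \<one>) \<noteq> 0"
      proof
        assume "(\<lambda>v. F v \<one>) = 0"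
        then have F1: "F v \<one> = 0" for v
          by (simp add: fun_eq_iff)
        have "F v x = 0" for v x
          using ev(2,3)[of v x] hom_repD(2)[OF F(1), of v] F1[of "act x v"]
          by (cases "v \<in> V"; cases "x \<in> carrier G") simp_all
        then show False
          using F(2) by (simp add: fun_eq_iff)
      qed
      then obtain W where W: "invariant_subspace ?H ?\<pi> W" "irreducible_rep ?H (?\<pi>\<lparr>rep_space := W\<rparr>)"
        "\<exists>w\<in>W. F w \<one> \<noteq> 0"
        by (rule H.irreducible_subrep_not_in_kernel[OF \<sigma>_rep ev(1)])
      let ?\<tau> = "?\<pi>\<lparr>rep_space := W\<rparr>"
      have WV: "W \<subseteq> V"
        using W(1) by (simp add: invariant_subspace_def)
      obtain t where t: "t \<in> Irr ?H ?TH" "iso_rep ?H (representative t) ?\<tau>"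
        "representation ?H (representative t)" "representation ?H ?\<tau>"
        using cover[OF rep_sm(1)[OF c(1)] W(1,2)] by blast
      have t': "iso_rep ?H ?\<tau> (representative t)"
        by (rule iso_rep_sym[OF t(3,2)])
      have "t \<in> \<T>"
      proof -
        have "\<exists>F. finite F \<and> card F \<le> d \<and> V \<subseteq> vs.span F"
          using c(2) unfolding degree_rep_def edim_le_iff[OF vs.vector_space_axioms] .
        then have "degree_rep ?\<tau> \<le> enat d"
          using WV unfolding degree_rep_def by (simp add: edim_le_iff[OF vs.vector_space_axioms]) (meson order_trans)
        then have "degree_rep (representative t) \<le> enat d"
          by (rule degree_rep_le_iso[OF t(4,3) t'])
        moreover have "\<not> hom_rep ?H ?\<tau> \<sigma> \<subseteq> {0}"
        proof
          assume "hom_rep ?H ?\<tau> \<sigma> \<subseteq> {0}"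
          then have "(\<lambda>v. if v \<in> W then F v \<one> else 0) = 0"
            using H.hom_rep_restrict[OF ev(1) W(1)] by blast
          moreover obtain w where "w \<in> W" "F w \<one> \<noteq> 0"
            using W(3) by blast
          ultimately show False
            using fun_cong[of _ _ w] by fastforce
        qed
        then have "\<not> hom_rep ?H (representative t) \<sigma> \<subseteq> {0}"
          using hom_rep_trivial_iso[OF t(3,4) \<sigma>_rep t(2)] by blast
        ultimately show ?thesis
          using t(1) by (simp add: \<T>_def)
      qed
      interpret HK: fd_rep "G\<lparr>carrier := H \<inter> K\<rparr>" ?\<pi>
        by (rule fd_rep_subgroup[OF HK(1)])
      have "invariant_subspace (G\<lparr>carrier := H \<inter> K\<rparr>) ?\<pi> W"
        using W(1) by (auto simp: invariant_subspace_def)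
      then interpret W: fd_rep "G\<lparr>carrier := H \<inter> K\<rparr>" ?\<tau>
        by (rule HK.fd_rep_subrep)
      have "W \<noteq> {0}"
        using W(2) by (simp add: irreducible_rep_def)
      then have "weights (H \<inter> K) ?\<tau> \<noteq> {}"
        using W.weights_nonempty comm HK(2) WV by (simp add: subset_iff)
      then obtain \<eta> where \<eta>: "\<eta> \<in> weights (H \<inter> K) ?\<tau>"
        by blast
      obtain f where f: "f \<in> hom_rep ?H ?\<tau> (representative t)" "inj_on f (rep_space ?\<tau>)"
        using t' by (auto simp: iso_rep_def bij_betw_def)
      have "\<eta> \<in> weights (H \<inter> K) (representative t)"
        using weights_mono_hom[OF f t(4), of "H \<inter> K"] t(3) \<eta> HK(3) by (auto simp: Defs.representation_def)
      moreover have "\<eta> \<in> weights (H \<inter> K) ?\<pi>"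
        using \<eta> WV by (auto simp: weights_def)
      then obtain \<theta> where \<theta>: "\<theta> \<in> weights K ?\<pi>" "\<And>a. a \<in> H \<inter> K \<Longrightarrow> \<theta> a = \<eta> a"
        using weight_extension[OF K(1) H rep_sm(1)[OF c(1)] fd_rep_axioms comm] by blast
      then have "\<theta> \<in> \<Theta> \<eta>"
        using weights_smooth_chars[OF K(1) rep_sm(1)[OF c(1)]] by (auto simp: \<Theta>_def)
      ultimately show "c \<in> (\<Union>t\<in>\<T>. \<Union>\<eta>\<in>weights (H \<inter> K) (representative t). \<Union>\<theta>\<in>\<Theta> \<eta>.
          {c \<in> Irr G T. \<theta> \<in> weights K (representative c)})"
        using \<open>t \<in> \<T>\<close> \<theta>(1) c(1) by blast
    qed
    moreover have "finite (\<Union>t\<in>\<T>. \<Union>\<eta>\<in>weights (H \<inter> K) (representative t). \<Union>\<theta>\<in>\<Theta> \<eta>.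
        {c \<in> Irr G T. \<theta> \<in> weights K (representative c)})"
    proof (intro finite_UN_I)
      show "finite \<T>"
        unfolding \<T>_def by (rule \<sigma>_fin)
      show "finite {c \<in> Irr G T. \<theta> \<in> weights K (representative c)}" if "\<theta> \<in> \<Theta> \<eta>" for \<theta> \<eta>
        using finite_Irr_weight[OF K(1)] that by (simp add: \<Theta>_def)
    qed (use finw fin\<Theta> in auto)
    ultimately show ?thesis
      by (rule finite_subset)
  qed
  then show ?thesis
    unfolding strongly_admissible_iff[OF is_group] using Ind_sm adm by blast
qed

end

section \<open>Separating characters\<close>

lemma (in group) commutator_in_derived: "a \<in> K \<Longrightarrow> b \<in> K \<Longrightarrow> a \<otimes> b \<otimes> inv a \<otimes> inv b \<in> derived G K"
  unfolding derived_def by (rule generate.incl) blast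

text \<open>A subgroup between \<open>derived G K\<close> and \<open>K\<close> is normal in
  \<open>K\<close>, since the conjugate is a commutator times \<open>b\<close>.\<close>

lemma (in group) conjugate_mem_if_derived_subset:
  assumes K: "subgroup K G" and B: "subgroup B G" "B \<subseteq> K" "derived G K \<subseteq> B"
    and k: "k \<in> K" and b: "b \<in> B"
  shows "inv k \<otimes> b \<otimes> k \<in> B"
proof -
  have G: "k \<in> carrier G" "b \<in> carrier G"
    using subgroup.mem_carrier K B k b by metis+
  have "inv k \<otimes> b \<otimes> inv (inv k) \<otimes> inv b \<in> B"
    using commutator_in_derived[of "inv k" K b] subgroup.m_inv_closed[OF K k] b B by blast
  then have "inv k \<otimes> b \<otimes> inv (inv k) \<otimes> inv b \<otimes> b \<in> B"
    using b subgroup.m_closed[OF B(1)] by blast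
  then show ?thesis
    using G by (simp add: m_assoc)
qed

text \<open>\<open>A\<close> normalises \<open>B\<close> by the previous lemma, so a factor from
  \<open>B\<close> can be moved past one from \<open>A\<close>.\<close>

lemma (in group) subgroup_set_mult_derived:
  assumes K: "subgroup K G" and A: "subgroup A G" "A \<subseteq> K" and B: "subgroup B G" "B \<subseteq> K" "derived G K \<subseteq> B"
  shows "subgroup (A <#> B) G"
proof
  have G: "a \<in> carrier G" if "a \<in> A \<or> a \<in> B" for a
    using that subgroup.mem_carrier A(1) B(1) by metis
  show "A <#> B \<subseteq> carrier G"
    using subgroup.subset[OF A(1)] subgroup.subset[OF B(1)] by (rule setmult_subset_G)
  have "\<one> \<otimes> \<one> \<in> A <#> B"
    using subgroup.one_closed[OF A(1)] subgroup.one_closed[OF B(1)] unfolding set_mult_def by blast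
  then show "\<one> \<in> A <#> B"
    by simp
  show "x \<otimes> y \<in> A <#> B" if xy: "x \<in> A <#> B" "y \<in> A <#> B" for x y
  proof -
    obtain a b a' b' where ab: "a \<in> A" "b \<in> B" "x = a \<otimes> b" "a' \<in> A" "b' \<in> B" "y = a' \<otimes> b'"
      using xy unfolding set_mult_def by blast
    have "inv a' \<otimes> b \<otimes> a' \<otimes> b' \<in> B"
      using conjugate_mem_if_derived_subset[OF K B, of a' b] ab A(2) subgroup.m_closed[OF B(1)] by blast
    moreover have "a \<otimes> a' \<in> A"
      using ab subgroup.m_closed[OF A(1)] by blast
    moreover have "a' \<otimes> (inv a' \<otimes> (b \<otimes> (a' \<otimes> b'))) = b \<otimes> (a' \<otimes> b')"
      using ab G by (simp flip: m_assoc)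
    then have "x \<otimes> y = (a \<otimes> a') \<otimes> (inv a' \<otimes> b \<otimes> a' \<otimes> b')"
      using ab G by (simp add: m_assoc)
    ultimately show ?thesis
      unfolding set_mult_def by blast
  qed
  show "inv x \<in> A <#> B" if x: "x \<in> A <#> B" for x
  proof -
    obtain a b where ab: "a \<in> A" "b \<in> B" "x = a \<otimes> b"
      using x unfolding set_mult_def by blast
    have a': "inv a \<in> A" "inv a \<in> K"
      using subgroup.m_inv_closed[OF A(1) ab(1)] A(2) by auto
    have "inv (inv a) \<otimes> inv b \<otimes> inv a \<in> B"
      using conjugate_mem_if_derived_subset[OF K B a'(2), of "inv b"] ab subgroup.m_inv_closed[OF B(1)] by blast
    moreover have "inv a \<otimes> (a \<otimes> (inv b \<otimes> inv a)) = inv b \<otimes> inv a"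
      using ab G by (simp flip: m_assoc)
    then have "inv x = inv a \<otimes> (inv (inv a) \<otimes> inv b \<otimes> inv a)"
      using ab G by (simp add: inv_mult_group m_assoc)
    ultimately show ?thesis
      using a'(1) unfolding set_mult_def by blast
  qed
qed

context profinite_group
begin

text \<open>The group \<open>K\<close> acts through \<open>K / P\<close> on the \<open>P\<close>-fixed functions on \<open>P \ G\<close>, so that
  eigenvectors exist; \<open>x\<close> moves the indicator function of \<open>P\<close>.\<close>

lemma smooth_char_separation:
  assumes K: "open_subgroup K G T" and P: "open_subgroup P G T" "P \<subseteq> K" "derived G K \<subseteq> P"
    and x: "x \<in> K" "x \<notin> P"
  obtains \<theta> where "\<theta> \<in> smooth_chars G T K" "\<And>p. p \<in> P \<Longrightarrow> \<theta> p = 1" "\<theta> x \<noteq> 1"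
proof -
  have K': "subgroup K G" and P': "subgroup P G" "openin T P"
    using K P by (auto simp: open_subgroup_def)
  have KG: "k \<in> carrier G" if "k \<in> K" for k
    using subgroup.mem_carrier[OF K' that] .
  have PG: "p \<in> carrier G" if "p \<in> P" for p
    using subgroup.mem_carrier[OF P'(1) that] .
  \<comment> \<open>The indicator function of \<open>P\<close> has two roles: it is the trivial
    character of \<open>P\<close>, extended by 0, and a \<open>P\<close>-fixed vector in the
    representation induced from that character.\<close>
  define f1 where "f1 g = (if g \<in> P then 1 else 0 :: complex)" for g
  have "{k \<in> P. f1 k = 1} = P"
    by (auto simp: f1_def)
  then have f1: "f1 \<in> smooth_chars G T P"
    using P' subgroup.m_closed by (auto simp: smooth_chars_def f1_def)
  let ?M = "Ind G T P (char_rep f1)"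
  have M_sm: "smooth G T ?M"
    by (rule smooth_Ind[OF P'(1) representation_char_rep[OF P'(1) f1]])
  interpret M: fd_rep G ?M
    by (rule Ind_char_rep_fd[OF P(1) f1])
  interpret KM: fd_rep "G\<lparr>carrier := K\<rparr>" ?M
    by (rule M.fd_rep_subgroup[OF K'])
  \<comment> \<open>On \<open>P\<close>-fixed vectors the operators of \<open>K\<close> commute,
    because commutators of \<open>K\<close> lie in \<open>P\<close>.\<close>
  define U where "U = {f \<in> M.V. \<forall>p\<in>P. M.act p f = f}"
  have U_act: "M.act k f \<in> U" if k: "k \<in> K" and f: "f \<in> U" for k f
  proof -
    have "M.act p (M.act k f) = M.act k f" if p: "p \<in> P" for p
    proof -
      have c: "inv k \<otimes> p \<otimes> k \<in> P"
        using conjugate_mem_if_derived_subset[OF K' P'(1) P(2,3) k p] .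
      have "k \<otimes> (inv k \<otimes> (p \<otimes> k)) = p \<otimes> k"
        using KG[OF k] PG[OF p] by (simp flip: m_assoc)
      then have "M.act p (M.act k f) = M.act (k \<otimes> (inv k \<otimes> p \<otimes> k)) f"
        using M.act_mult[of p k f] f KG[OF k] PG[OF p] by (simp add: U_def m_assoc del: Ind_simps)
      also have "\<dots> = M.act k (M.act (inv k \<otimes> p \<otimes> k) f)"
        using f KG[OF k] PG[OF c] by (intro M.act_mult) (auto simp: U_def)
      also have "M.act (inv k \<otimes> p \<otimes> k) f = f"
        using f c by (simp add: U_def del: Ind_simps)
      finally show ?thesis .
    qed
    then show ?thesis
      using f KG[OF k] M.act_closed by (simp add: U_def del: Ind_simps)
  qed
  have U_comm: "M.act a (M.act b f) = M.act b (M.act a f)" if a: "a \<in> K" and b: "b \<in> K" and f: "f \<in> U" for a b f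
  proof -
    let ?c = "inv a \<otimes> inv b \<otimes> inv (inv a) \<otimes> inv (inv b)"
    have c: "?c \<in> P"
      using commutator_in_derived[of "inv a" K "inv b"] subgroup.m_inv_closed[OF K'] a b P(3) by blast
    have "a \<otimes> (inv a \<otimes> (inv b \<otimes> (a \<otimes> b))) = inv b \<otimes> (a \<otimes> b)" "b \<otimes> (inv b \<otimes> (a \<otimes> b)) = a \<otimes> b"
      using KG a b by (simp_all flip: m_assoc)
    then have "a \<otimes> b = b \<otimes> a \<otimes> ?c"
      using KG a b by (simp add: m_assoc)
    then have "M.act a (M.act b f) = M.act (b \<otimes> a \<otimes> ?c) f"
      using M.act_mult[of a b f] f KG a b by (simp add: U_def del: Ind_simps)
    also have "\<dots> = M.act (b \<otimes> a) (M.act ?c f)"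
      using f KG a b PG[OF c] by (intro M.act_mult) (auto simp: U_def)
    also have "M.act ?c f = f"
      using f c by (simp add: U_def del: Ind_simps)
    also have "M.act (b \<otimes> a) f = M.act b (M.act a f)"
      using f KG a b by (intro M.act_mult) (auto simp: U_def)
    finally show ?thesis .
  qed
  have "M.vs.subspace U"
    unfolding M.vs.subspace_def U_def using PG M.act_zero M.act_add M.act_scale
    by (auto simp del: Ind_simps)
  then have U: "invariant_subspace (G\<lparr>carrier := K\<rparr>) ?M U"
    using U_act by (auto simp: invariant_subspace_def U_def simp del: Ind_simps)
  interpret U: fd_rep "G\<lparr>carrier := K\<rparr>" "?M\<lparr>rep_space := U\<rparr>"
    by (rule KM.fd_rep_subrep[OF U])
  \<comment> \<open>The eigenvector must not be fixed by \<open>x\<close>, so it is sought in an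
    invariant complement \<open>C\<close> of the \<open>x\<close>-fixed vectors; \<open>C\<close> is
    nonzero because \<open>f1\<close> is not fixed.\<close>
  define U0 where "U0 = {f \<in> U. M.act x f = f}"
  have UV: "f \<in> M.V" if "f \<in> U" for f
    using that by (simp add: U_def)
  have "M.vs.subspace U0"
    unfolding M.vs.subspace_def U0_def
    using \<open>M.vs.subspace U\<close> KG[OF x(1)] M.act_zero M.act_add[OF KG[OF x(1)] UV UV] M.act_scale[OF KG[OF x(1)] UV]
    unfolding M.vs.subspace_def by (auto simp del: Ind_simps)
  then have U0: "invariant_subspace (G\<lparr>carrier := K\<rparr>) (?M\<lparr>rep_space := U\<rparr>) U0"
    using U_act U_comm[OF x(1)] by (auto simp: invariant_subspace_def U0_def simp del: Ind_simps)
  obtain p where p: "\<And>v. v \<in> U \<Longrightarrow> p v \<in> U0" "\<And>u. u \<in> U0 \<Longrightarrow> p u = u"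
    "\<And>v w. v \<in> U \<Longrightarrow> w \<in> U \<Longrightarrow> p (v + w) = p v + p w"
    "\<And>c v. v \<in> U \<Longrightarrow> p (M.scl c v) = M.scl c (p v)"
    "\<And>g v. g \<in> K \<Longrightarrow> v \<in> U \<Longrightarrow> p (M.act g v) = M.act g (p v)"
    using U.equivariant_projection[OF U0] by (auto simp del: Ind_simps)
  define C where "C = {v \<in> U. p v = 0}"
  have U0U: "U0 \<subseteq> U"
    by (auto simp: U0_def)
  have sU: "0 \<in> U" "\<And>v w. v \<in> U \<Longrightarrow> w \<in> U \<Longrightarrow> v + w \<in> U" "\<And>c v. v \<in> U \<Longrightarrow> M.scl c v \<in> U"
    using \<open>M.vs.subspace U\<close> unfolding M.vs.subspace_def by blast+
  have p0: "p 0 = 0"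
    using p(4)[OF sU(1), of 0] M.vs.scale_zero_left by (simp del: Ind_simps)
  have "M.vs.subspace C"
    unfolding M.vs.subspace_def C_def using sU p0 p(3,4) M.vs.scale_zero_right by (auto simp del: Ind_simps)
  then have C: "invariant_subspace (G\<lparr>carrier := K\<rparr>) (?M\<lparr>rep_space := U\<rparr>) C"
    using U_act p(5) KG M.act_zero by (auto simp: invariant_subspace_def C_def simp del: Ind_simps)
  interpret C: fd_rep "G\<lparr>carrier := K\<rparr>" "?M\<lparr>rep_space := U\<rparr>\<lparr>rep_space := C\<rparr>"
    by (rule U.fd_rep_subrep[OF C])
  have f1_mult: "f1 (q \<otimes> y) = f1 y" "f1 (y \<otimes> q) = f1 y" if q: "q \<in> P" and y: "y \<in> carrier G" for q y
  proof -
    have "q \<otimes> y \<in> P \<longleftrightarrow> y \<in> P"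
    proof
      assume "q \<otimes> y \<in> P"
      then have "inv q \<otimes> (q \<otimes> y) \<in> P"
        using q subgroup.m_closed[OF P'(1)] subgroup.m_inv_closed[OF P'(1)] by blast
      then show "y \<in> P"
        using PG[OF q] y by (simp flip: m_assoc)
    qed (use q subgroup.m_closed[OF P'(1)] in blast)
    moreover have "y \<otimes> q \<in> P \<longleftrightarrow> y \<in> P"
    proof
      assume "y \<otimes> q \<in> P"
      then have "(y \<otimes> q) \<otimes> inv q \<in> P"
        using q subgroup.m_closed[OF P'(1)] subgroup.m_inv_closed[OF P'(1)] by blast
      then show "y \<in> P"
        using PG[OF q] y by (simp add: m_assoc)
    qed (use q subgroup.m_closed[OF P'(1)] in blast)
    ultimately show "f1 (q \<otimes> y) = f1 y" "f1 (y \<otimes> q) = f1 y"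
      by (auto simp: f1_def)
  qed
  have "locally_constant_on G T f1"
    unfolding locally_constant_on_def
  proof
    fix y assume y: "y \<in> carrier G"
    have "openin T (carrier G - P)"
      using closedin_open_subgroup[OF P(1)] topspace_eq by (metis closedin_def)
    then show "\<exists>W. openin T W \<and> y \<in> W \<and> (\<forall>z\<in>W. f1 z = f1 y)"
      using P'(2) y by (cases "y \<in> P") (auto simp: f1_def intro: exI[of _ P] exI[of _ "carrier G - P"])
  qed
  then have f1M: "f1 \<in> M.V"
    using f1_mult(1) PG by (auto simp: mem_Ind_iff) (auto simp: f1_def)
  have f1U: "f1 \<in> U"
    unfolding U_def using f1M f1_mult(2) PG by (auto simp: fun_eq_iff f1_def)
  have "M.act x f1 \<one> = 0" "f1 \<one> = 1"
    using x KG[OF x(1)] subgroup.one_closed[OF P'(1)] by (auto simp: f1_def)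
  then have f1U0: "f1 \<notin> U0"
    by (auto simp: U0_def simp del: Ind_simps)
  have pf: "p f1 \<in> U0" "p f1 \<in> U" "f1 - p f1 \<in> U"
    using p(1)[OF f1U] U0U f1U U.V_diff[of f1 "p f1"] by auto
  have "p f1 = p (f1 - p f1) + p (p f1)"
    using p(3)[OF pf(3,2)] by simp
  then have "f1 - p f1 \<in> C"
    using p(2)[OF pf(1)] pf by (simp add: C_def)
  moreover have "f1 - p f1 \<noteq> 0"
    using f1U0 pf by auto
  ultimately have "C \<noteq> {0}"
    by blast
  moreover have "rep_act (?M\<lparr>rep_space := U\<rparr>\<lparr>rep_space := C\<rparr>) a (rep_act (?M\<lparr>rep_space := U\<rparr>\<lparr>rep_space := C\<rparr>) b v) =
      rep_act (?M\<lparr>rep_space := U\<rparr>\<lparr>rep_space := C\<rparr>) b (rep_act (?M\<lparr>rep_space := U\<rparr>\<lparr>rep_space := C\<rparr>) a v)"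
    if "a \<in> K" "b \<in> K" "v \<in> C" for a b v
    using U_comm[of a b v] that by (simp add: C_def del: Ind_simps)
  ultimately have "weights K (?M\<lparr>rep_space := U\<rparr>\<lparr>rep_space := C\<rparr>) \<noteq> {}"
    using C.weights_nonempty by (simp del: Ind_simps)
  then obtain \<theta> f where \<theta>: "\<forall>g. g \<notin> K \<longrightarrow> \<theta> g = 0" and
    f: "f \<in> C" "f \<noteq> 0" "\<And>k. k \<in> K \<Longrightarrow> M.act k f = M.scl (\<theta> k) f"
    by (auto simp: weights_def simp del: Ind_simps)
  have fU: "f \<in> U" "f \<in> M.V"
    using f(1) UV by (auto simp: C_def)
  have "\<theta> \<in> weights K ?M"
    using \<theta> f fU by (auto simp: weights_def simp del: Ind_simps)
  then have "\<theta> \<in> smooth_chars G T K"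
    using weights_smooth_chars[OF K M_sm] by blast
  moreover have "\<theta> q = 1" if "q \<in> P" for q
  proof -
    have "M.scl (\<theta> q) f = M.scl 1 f"
      using f(3)[of q] that P(2) fU(1) M.vs.scale_one[of f] by (auto simp: U_def simp del: Ind_simps)
    then show ?thesis
      using f(2) M.vs.scale_cancel_right by blast
  qed
  moreover have "\<theta> x \<noteq> 1"
  proof
    assume "\<theta> x = 1"
    then have "f \<in> U0"
      using f(3)[OF x(1)] fU M.vs.scale_one[of f] by (simp add: U0_def del: Ind_simps)
    then show False
      using p(2)[of f] f(1,2) by (simp add: C_def)
  qed
  ultimately show ?thesis
    using that by blast
qed

lemma closedin_set_mult:
  assumes "closedin T A" "closedin T B"
  shows "closedin T (A <#> B)"
proof -
  have "compactin (prod_topology T T) (A \<times> B)"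
    using assms closedin_compact_space[OF compact] by (simp add: compactin_Times)
  then have "compactin T ((\<lambda>(x, y). x \<otimes> y) ` (A \<times> B))"
    using continuous_mult by (rule image_compactin)
  also have "(\<lambda>(x, y). x \<otimes> y) ` (A \<times> B) = A <#> B"
    by (auto simp: set_mult_def)
  finally show ?thesis
    using compactin_imp_closedin[OF Hausdorff] by blast
qed

text \<open>The common kernel \<open>L\<close> of the finitely many characters is open, hence of
  finite index. Separation by characters identifies it with the subgroup that is divided
  out.\<close>

lemma FAb_relative_if_finite_chars:
  assumes H: "closed_subgroup H G T"
    and fin: "\<And>K. open_subgroup K G T \<Longrightarrow> finite {\<theta> \<in> smooth_chars G T K. \<forall>a\<in>H \<inter> K. \<theta> a = 1}"
  shows "FAb_relative G T H"
  unfolding FAb_relative_def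
proof (intro allI impI)
  fix K assume K: "open_subgroup K G T"
  have K': "subgroup K G" "openin T K"
    using K by (auto simp: open_subgroup_def)
  have H': "subgroup H G" "closedin T H"
    using H by (auto simp: closed_subgroup_def)
  let ?D = "closed_commutator_subgroup G T K"
  define A where "A = H \<inter> K"
  have A: "subgroup A G" "A \<subseteq> K"
    using subgroups_Inter_pair[OF H'(1) K'(1)] by (auto simp: A_def)
  have "closedin T A"
    unfolding A_def by (rule closedin_Int[OF H'(2) closedin_open_subgroup[OF K]])
  then have closedN: "closedin T (A <#> ?D)"
    by (rule closedin_set_mult) (simp add: closed_commutator_subgroup_def)
  define \<Theta> where "\<Theta> = {\<theta> \<in> smooth_chars G T K. \<forall>a\<in>A. \<theta> a = 1}"
  have fin\<Theta>: "finite \<Theta>"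
    using fin[OF K] by (simp add: \<Theta>_def A_def)
  define L where "L = \<Inter>(insert K ((\<lambda>\<theta>. {k \<in> K. \<theta> k = 1}) ` \<Theta>))"
  have op: "open_subgroup D G T" if "D \<in> insert K ((\<lambda>\<theta>. {k \<in> K. \<theta> k = 1}) ` \<Theta>)" for D
    using that K open_subgroup_char_kernel[OF K'(1)] by (auto simp: \<Theta>_def)
  have "openin T L"
    unfolding L_def by (rule openin_Inter) (use op fin\<Theta> in \<open>auto simp: open_subgroup_def\<close>)
  moreover have "subgroup L G"
    unfolding L_def by (rule subgroups_Inter) (use op in \<open>auto simp: open_subgroup_def\<close>)
  ultimately have L: "open_subgroup L G T"
    by (simp add: open_subgroup_def)
  have dD: "derived G K \<subseteq> ?D"
    unfolding closed_commutator_subgroup_def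
    using closure_of_subset derived_in_carrier[OF subgroup.subset[OF K'(1)]] topspace_eq by metis
  have dK: "derived G K \<subseteq> K"
    using derived_incl[OF _ K'(1)] by blast
  have dsub: "subgroup (derived G K) G"
    using derived_is_subgroup[OF subgroup.subset[OF K'(1)]] .
  have "A <#> ?D = L"
  proof (intro equalityI subsetI)
    fix n assume "n \<in> A <#> ?D"
    then obtain a d where ad: "a \<in> A" "d \<in> ?D" "n = a \<otimes> d"
      by (auto simp: set_mult_def)
    have "?D \<subseteq> K"
      unfolding closed_commutator_subgroup_def
      by (rule closure_of_minimal[OF dK closedin_open_subgroup[OF K]])
    then have nK: "a \<in> K" "d \<in> K" "n \<in> K"
      using ad A(2) subgroup.m_closed[OF K'(1)] by auto
    moreover have "\<theta> n = 1" if "\<theta> \<in> \<Theta>" for \<theta>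
    proof -
      have "\<theta> d = 1" "\<theta> a = 1" "\<theta> n = \<theta> a * \<theta> d"
        using smooth_char_commutator[OF K'(1) _ ad(2)] that ad nK by (auto simp: \<Theta>_def smooth_chars_def)
      then show ?thesis by simp
    qed
    ultimately show "n \<in> L"
      by (auto simp: L_def)
  next
    fix x assume x: "x \<in> L"
    then have xK: "x \<in> K"
      by (auto simp: L_def)
    have xG: "x \<in> carrier G"
      using subgroup.mem_carrier[OF K'(1) xK] .
    show "x \<in> A <#> ?D"
    proof (rule ccontr)
      assume xN: "x \<notin> A <#> ?D"
      have "openin T (carrier G - (A <#> ?D))"
        using closedN topspace_eq by (metis closedin_def)
      then obtain U where U: "open_subgroup U G T" "\<And>u. u \<in> U \<Longrightarrow> x \<otimes> u \<in> carrier G - (A <#> ?D)"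
        using open_subgroup_translate_subset[of "carrier G - (A <#> ?D)" x] xN xG by blast
      define N0 where "N0 = A <#> derived G K"
      have N0: "subgroup N0 G"
        unfolding N0_def by (rule subgroup_set_mult_derived[OF K'(1) A dsub dK order_refl])
      have N0K: "N0 \<subseteq> K"
        using A(2) dK subgroup.m_closed[OF K'(1)] unfolding N0_def set_mult_def by blast
      have "\<one> \<otimes> d \<in> N0" if "d \<in> derived G K" for d
        using that subgroup.one_closed[OF A(1)] unfolding N0_def set_mult_def by blast
      then have dN0: "derived G K \<subseteq> N0"
        using subgroup.mem_carrier[OF dsub] by fastforce
      have UK: "subgroup (U \<inter> K) G" "U \<inter> K \<subseteq> K"
        using subgroups_Inter_pair[OF _ K'(1)] U(1) by (auto simp: open_subgroup_def)
      \<comment> \<open>Thickening \<open>N0\<close> by \<open>U \<inter> K\<close> gives an open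
        subgroup that contains \<open>A\<close> and all commutators; \<open>x\<close> stays outside
        because \<open>x U\<close> avoids \<open>A <#> ?D\<close>.\<close>
      define P where "P = (U \<inter> K) <#> N0"
      have P: "subgroup P G"
        unfolding P_def by (rule subgroup_set_mult_derived[OF K'(1) UK N0 N0K dN0])
      have PK: "P \<subseteq> K"
        using UK(2) N0K subgroup.m_closed[OF K'(1)] unfolding P_def set_mult_def by blast
      have "u \<otimes> \<one> \<in> P" if "u \<in> U \<inter> K" for u
        using that subgroup.one_closed[OF N0] unfolding P_def set_mult_def by blast
      then have UP: "U \<inter> K \<subseteq> P"
        using subgroup.mem_carrier[OF UK(1)] by fastforce
      have "\<one> \<otimes> n \<in> P" if "n \<in> N0" for n
        using that subgroup.one_closed[OF UK(1)] unfolding P_def set_mult_def by blast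
      then have N0P: "N0 \<subseteq> P"
        using subgroup.mem_carrier[OF N0] by fastforce
      have "a \<otimes> \<one> \<in> N0" if "a \<in> A" for a
        using that subgroup.one_closed[OF dsub] unfolding N0_def set_mult_def by blast
      then have AN0: "A \<subseteq> N0"
        using subgroup.mem_carrier[OF A(1)] by fastforce
      have "openin T (U \<inter> K)" "\<one> \<in> U \<inter> K"
        using U(1) K'(2) subgroup.one_closed[OF UK(1)] by (auto simp: open_subgroup_def)
      then have opP: "open_subgroup P G T"
        using open_subgroupI[OF P _ _ UP] by blast
      have "x \<notin> P"
      proof
        assume "x \<in> P"
        \<comment> \<open>Inverting brings the factor \<open>u\<close> to the right of
          \<open>x\<close>, as in the choice of \<open>U\<close>.\<close>
        then have "inv x \<in> P"
          by (rule subgroup.m_inv_closed[OF P])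
        then obtain u n where un: "u \<in> U" "u \<in> K" "n \<in> N0" "inv x = u \<otimes> n"
          unfolding P_def set_mult_def by blast
        have G: "u \<in> carrier G" "n \<in> carrier G"
          using un subgroup.mem_carrier[OF K'(1)] N0K by auto
        have "x = inv n \<otimes> inv u"
          using un(4) xG G by (metis inv_inv inv_mult_group)
        then have "x \<otimes> u = inv n"
          using G by (simp add: m_assoc)
        moreover have "inv n \<in> A <#> ?D"
          using subgroup.m_inv_closed[OF N0 un(3)] dD unfolding N0_def set_mult_def by blast
        ultimately show False
          using U(2)[OF un(1)] by simp
      qed
      then obtain \<theta> where \<theta>: "\<theta> \<in> smooth_chars G T K" "\<And>p. p \<in> P \<Longrightarrow> \<theta> p = 1" "\<theta> x \<noteq> 1"
        using smooth_char_separation[OF K opP PK _ xK] dN0 N0P by blast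
      then have "\<theta> \<in> \<Theta>"
        using AN0 N0P by (auto simp: \<Theta>_def)
      then show False
        using x \<theta>(3) by (auto simp: L_def)
    qed
  qed
  moreover have "(\<lambda>x. L #> x) ` K \<subseteq> rcosets L"
    using rcosetsI[OF subgroup.subset[OF \<open>subgroup L G\<close>]] subgroup.mem_carrier[OF K'(1)] by blast
  then have "finite ((\<lambda>x. L #> x) ` K)"
    using finite_rcosets_open_subgroup[OF L] finite_subset by blast
  ultimately show "finite (carrier (G\<lparr>carrier := K\<rparr> Mod ((H \<inter> K) <#> ?D)))"
    by (simp add: carrier_FactGroup A_def)
qed

end

section \<open>Representations with trivial action on a line\<close>

text \<open>For \<open>w \<noteq> 0\<close> a copy of the trivial representation inside any given
  complex vector space, so that one argument covers \<open>trivial_rep\<close> and the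
  representations on \<open>'w\<close>.\<close>

definition line_rep :: "(complex \<Rightarrow> 'w \<Rightarrow> 'w) \<Rightarrow> 'w::ab_group_add \<Rightarrow> ('g, 'w) rep" where
  "line_rep s w = \<lparr>rep_scale = s, rep_space = module.span s {w}, rep_act = (\<lambda>g v. v)\<rparr>"

lemma line_rep_simps [simp]:
  "rep_scale (line_rep s w) = s" "rep_space (line_rep s w) = module.span s {w}" "rep_act (line_rep s w) g v = v"
  by (simp_all add: line_rep_def)

lemma trivial_rep_eq_line_rep: "trivial_rep = line_rep (*) 1"
proof -
  have "module.span (*) {1 :: complex} = UNIV"
    using module.span_singleton[of "(*)" "1 :: complex"] vector_space_complex
    by (auto simp: module_iff_vector_space)
  then show ?thesis
    by (simp add: trivial_rep_def line_rep_def)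
qed

lemma representation_line_rep:
  assumes "vector_space s"
  shows "representation G (line_rep s w)"
proof -
  interpret vector_space s by fact
  show ?thesis
    using vector_space_axioms by (simp add: Defs.representation_def)
qed

lemma irreducible_line_rep:
  assumes "vector_space s" "w \<noteq> 0"
  shows "irreducible_rep G (line_rep s w)"
proof -
  interpret vector_space s by fact
  have "U = {0} \<or> U = span {w}" if U: "subspace U" "U \<subseteq> span {w}" for U
  proof (cases "U = {0}")
    case False
    then obtain u where u: "u \<in> U" "u \<noteq> 0"
      using subspace_0[OF U(1)] by blast
    then obtain c where c: "u = s c w"
      using U(2) by (auto simp: span_singleton)
    then have "w = s (inverse c) u"
      using u by auto
    then have "w \<in> U"
      using u U(1) subspace_scale by metis
    then show ?thesis
      using span_minimal[of "{w}" U] U by blast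
  qed simp
  moreover have "span {w} \<noteq> {0}"
    using span_base[of w "{w}"] assms(2) by auto
  ultimately show ?thesis
    using representation_line_rep[OF assms(1)] by (simp add: irreducible_rep_def)
qed

text \<open>An equivariant map from an irreducible representation is injective or zero, so its value
  at one nonzero \<open>v\<close> determines it, and the Hom spaces to a line have dimension at most
  1. By Schur's lemma only the class of the line occurs.\<close>

lemma strongly_admissible_line_rep:
  assumes G: "group G" and T: "topspace T = carrier G" and s: "vector_space s" and w: "w \<noteq> 0"
  shows "strongly_admissible G T (line_rep s w)"
proof -
  interpret s: vector_space s by (rule s)
  let ?L = "line_rep s w :: ('a, 'c) rep"
  have L: "representation G ?L"
    by (rule representation_line_rep[OF s])
  have irr: "irreducible_rep G (representative c)" if "c \<in> Irr G T" for c
    using Irr_representative[OF G that] by (simp add: smooth_irreps_def)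
  have sm: "smooth G T ?L"
    using L T openin_topspace[of T] by (simp add: smooth_def)
  have mult: "multiplicity_rep G \<pi> ?L < \<infinity>" if irr: "irreducible_rep G \<pi>" for \<pi> :: "('a, nat \<Rightarrow> complex) rep"
  proof -
    interpret lin_rep G \<pi>
      using irr G by (simp add: lin_rep_iff irreducible_rep_def)
    interpret ps: vector_space "pointwise_scale s :: complex \<Rightarrow> ((nat \<Rightarrow> complex) \<Rightarrow> 'c) \<Rightarrow> _"
      by (rule vector_space_pointwise_scale[OF s])
    obtain v where v: "v \<in> V" "v \<noteq> 0"
      using irr V_zero by (auto simp: irreducible_rep_iff)
    have zero: "f = 0" if f: "f \<in> hom_rep G \<pi> ?L" "f v = 0" for f
    proof (rule ccontr)
      assume "f \<noteq> 0"
      then have "inj_on f V"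
        using hom_rep_irreducible_inj_on[OF G irr L f(1)] by blast
      moreover have "f 0 = 0"
        using hom_rep_0[OF rep _ f(1)] s by simp
      ultimately show False
        using f(2) v V_zero by (metis inj_onD)
    qed
    have "\<exists>F. finite F \<and> hom_rep G \<pi> ?L \<subseteq> ps.span F"
    proof (cases "hom_rep G \<pi> ?L \<subseteq> {0}")
      case True
      then show ?thesis
        using ps.span_zero by (intro exI[of _ "{}"]) auto
    next
      case False
      then obtain f where f: "f \<in> hom_rep G \<pi> ?L" "f v \<noteq> 0"
        using zero by blast
      have "h \<in> ps.span {f}" if h: "h \<in> hom_rep G \<pi> ?L" for h
      proof -
        obtain a b where ab: "f v = s a w" "h v = s b w"
          using hom_repD(1)[OF f(1) v(1)] hom_repD(1)[OF h v(1)] by (auto simp: s.span_singleton)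
        then have "a \<noteq> 0"
          using f(2) by auto
        then have hv: "h v = s (b / a) (f v)"
          using ab by simp
        \<comment> \<open>The coefficient \<open>b / a\<close> is chosen so that the difference
          vanishes at \<open>v\<close>.\<close>
        have "(\<lambda>u. h u - s (b / a) (f u)) \<in> hom_rep G \<pi> ?L"
          using hom_repD[OF f(1)] hom_repD[OF h] s.span_diff s.span_scale
          by (auto simp: hom_rep_def s.scale_right_distrib s.scale_right_diff_distrib mult.commute)
        from zero[OF this] hv have "h u = s (b / a) (f u)" for u
          by (simp add: fun_eq_iff)
        then have "h = pointwise_scale s (b / a) f"
          by (simp add: pointwise_scale_def fun_eq_iff)
        then show ?thesis
          using ps.span_scale ps.span_base by auto
      qed
      then show ?thesis
        by (intro exI[of _ "{f}"]) auto
    qed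
    then show ?thesis
      unfolding multiplicity_rep_def edim_less_infinity_iff by simp
  qed
  have iso: "iso_rep G (representative c) ?L" if "c \<in> Irr G T" "\<not> hom_rep G (representative c) ?L \<subseteq> {0}" for c
    using that Schur[OF G irr irreducible_line_rep[OF s w]] by blast
  have "finite {c \<in> Irr G T. degree_rep (representative c) \<le> enat d \<and> \<not> hom_rep G (representative c) ?L \<subseteq> {0}}"
    (is "finite ?C") for d
  proof (cases "?C = {}")
    case False
    then obtain c0 where c0: "c0 \<in> ?C"
      by blast
    have "c = c0" if c: "c \<in> ?C" for c
    proof (rule Irr_iso_unique[OF G, of c T])
      have reps: "representation G (representative c)" "representation G (representative c0)"
        using irr c c0 by (auto simp: irreducible_rep_def)
      have "iso_rep G (representative c) ?L" "iso_rep G (representative c0) ?L"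
        using iso c c0 by blast+
      then show "iso_rep G (representative c) (representative c0)"
        by (intro iso_rep_trans[OF reps(1) L reps(2)] iso_rep_sym[OF reps(2)])
    qed (use c c0 in auto)
    then have "?C \<subseteq> {c0}"
      by blast
    then show ?thesis
      by (rule finite_subset) simp
  qed (simp only: finite.emptyI)
  then show ?thesis
    unfolding strongly_admissible_iff[OF G] using sm mult irr by blast
qed

section \<open>From strong admissibility to finite relative abelian quotients\<close>

context profinite_group
begin

text \<open>The function on \<open>H K\<close> given by \<open>h k \<mapsto> \<theta> k\<close> is a \<open>K\<close>-eigenvector of weight \<open>\<theta>\<close>; its
  orbit spans a subrepresentation of dimension at most the index of \<open>K\<close>.\<close>

lemma weight_in_Ind_line_rep:
  assumes H: "subgroup H G" and K: "open_subgroup K G T" and s: "vector_space s" and w: "w \<noteq> 0"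
    and \<theta>: "\<theta> \<in> smooth_chars G T K" "\<And>a. a \<in> H \<inter> K \<Longrightarrow> \<theta> a = 1"
  obtains c where "c \<in> Irr G T" "degree_rep (representative c) \<le> enat (card (rcosets K))"
    "\<not> hom_rep G (representative c) (Ind G T H (line_rep s w)) \<subseteq> {0}" "\<theta> \<in> weights K (representative c)"
proof -
  interpret s: vector_space s by (rule s)
  let ?L = "line_rep s w"
  let ?M = "Ind G T H ?L"
  have K': "subgroup K G"
    using K by (simp add: open_subgroup_def)
  have HG: "h \<in> carrier G" if "h \<in> H" for h
    using subgroup.mem_carrier[OF H that] .
  have KG: "k \<in> carrier G" if "k \<in> K" for k
    using subgroup.mem_carrier[OF K' that] .
  note Hm = subgroup.m_closed[OF H] and Hi = subgroup.m_inv_closed[OF H]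
  note Km = subgroup.m_closed[OF K'] and Ki = subgroup.m_inv_closed[OF K']
  have M_sm: "smooth G T ?M"
    by (rule smooth_Ind[OF H representation_line_rep[OF s]])
  interpret M: lin_rep G ?M
    using M_sm is_group by (simp add: lin_rep_iff smooth_def)
  have \<theta>_mult: "\<theta> (k \<otimes> l) = \<theta> k * \<theta> l" if "k \<in> K" "l \<in> K" for k l
    using \<theta>(1) that by (simp add: smooth_chars_def)
  \<comment> \<open>The factor \<open>k\<close> of \<open>x = h \<otimes> k\<close> is unique up to
    left multiplication by \<open>H \<inter> K\<close>, where \<open>\<theta>\<close> is 1; so the
    choice does not affect the value, as \<open>f_val\<close> states.\<close>
  define f where "f x = (if x \<in> H <#> K then s (\<theta> (SOME k. k \<in> K \<and> (\<exists>h\<in>H. x = h \<otimes> k))) w else 0)" for x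
  have f_val: "f (h \<otimes> k) = s (\<theta> k) w" if h: "h \<in> H" and k: "k \<in> K" for h k
  proof -
    let ?k = "SOME k'. k' \<in> K \<and> (\<exists>h'\<in>H. h \<otimes> k = h' \<otimes> k')"
    have "?k \<in> K \<and> (\<exists>h'\<in>H. h \<otimes> k = h' \<otimes> ?k)"
      by (rule someI[of _ k]) (use h k in auto)
    then obtain h' where h': "?k \<in> K" "h' \<in> H" "h \<otimes> k = h' \<otimes> ?k"
      by blast
    have "inv h' \<otimes> (h \<otimes> k) \<otimes> inv k = inv h' \<otimes> (h' \<otimes> ?k) \<otimes> inv k"
      using h'(3) by simp
    moreover have "inv h' \<otimes> (h \<otimes> k) \<otimes> inv k = inv h' \<otimes> h"
      using HG[OF h] HG[OF h'(2)] KG[OF k] by (simp add: m_assoc)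
    moreover have "inv h' \<otimes> (h' \<otimes> ?k) = ?k"
      using HG[OF h'(2)] KG[OF h'(1)] by (simp flip: m_assoc)
    ultimately have "inv h' \<otimes> h = ?k \<otimes> inv k"
      by simp
    moreover have "inv h' \<otimes> h \<in> H"
      using h h'(2) by (intro Hm Hi)
    moreover have kk: "?k \<otimes> inv k \<in> K" "inv k \<in> K"
      by (rule Km[OF h'(1) Ki[OF k]], rule Ki[OF k])
    ultimately have "\<theta> (?k \<otimes> inv k) = 1"
      using \<theta>(2) by simp
    then have "\<theta> ((?k \<otimes> inv k) \<otimes> k) = \<theta> k"
      using \<theta>_mult[OF kk(1) k] by simp
    moreover have "(?k \<otimes> inv k) \<otimes> k = ?k"
      using KG[OF h'(1)] KG[OF k] by (simp add: m_assoc)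
    ultimately have "\<theta> ?k = \<theta> k"
      by simp
    moreover have "h \<otimes> k \<in> H <#> K"
      using h k unfolding set_mult_def by blast
    ultimately show ?thesis
      by (simp add: f_def)
  qed
  have HK_cases: "\<exists>h\<in>H. \<exists>k\<in>K. x = h \<otimes> k" if "x \<in> H <#> K" for x
    using that unfolding set_mult_def by blast
  have f_right: "f (x \<otimes> k) = s (\<theta> k) (f x)" if x: "x \<in> carrier G" and k: "k \<in> K" for x k
  proof (cases "x \<in> H <#> K")
    case True
    then obtain h l where hl: "h \<in> H" "l \<in> K" "x = h \<otimes> l"
      using HK_cases by blast
    then have "x \<otimes> k = h \<otimes> (l \<otimes> k)" "l \<otimes> k \<in> K"
      using HG KG k subgroup.m_closed[OF K'] by (auto simp: m_assoc)
    then have "f (x \<otimes> k) = s (\<theta> l * \<theta> k) w"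
      using f_val[OF hl(1)] \<theta>_mult hl(2) k by simp
    then show ?thesis
      using f_val[OF hl(1,2)] hl(3) by (simp add: mult.commute)
  next
    case False
    have "x \<otimes> k \<notin> H <#> K"
    proof
      assume "x \<otimes> k \<in> H <#> K"
      then obtain h l where hl: "h \<in> H" "l \<in> K" "x \<otimes> k = h \<otimes> l"
        using HK_cases by blast
      then have "x \<otimes> k \<otimes> inv k = h \<otimes> (l \<otimes> inv k)"
        using HG KG k by (simp add: m_assoc)
      then have "x = h \<otimes> (l \<otimes> inv k)"
        using x KG[OF k] by (simp add: m_assoc)
      moreover have "l \<otimes> inv k \<in> K"
        using hl(2) k by (intro Km Ki)
      ultimately show False
        using False hl(1) unfolding set_mult_def by blast
    qed
    then show ?thesis
      using False by (simp add: f_def)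
  qed
  have f_left: "f (h \<otimes> x) = f x" if h: "h \<in> H" and x: "x \<in> carrier G" for h x
  proof (cases "x \<in> H <#> K")
    case True
    then obtain h' l where hl: "h' \<in> H" "l \<in> K" "x = h' \<otimes> l"
      using HK_cases by blast
    then have "h \<otimes> x = (h \<otimes> h') \<otimes> l" "h \<otimes> h' \<in> H"
      using HG KG h subgroup.m_closed[OF H] by (auto simp: m_assoc)
    then show ?thesis
      using f_val[of "h \<otimes> h'" l] f_val[OF hl(1,2)] hl by simp
  next
    case False
    have "h \<otimes> x \<notin> H <#> K"
    proof
      assume "h \<otimes> x \<in> H <#> K"
      then obtain h' l where hl: "h' \<in> H" "l \<in> K" "h \<otimes> x = h' \<otimes> l"
        using HK_cases by blast
      then have "inv h \<otimes> (h \<otimes> x) = (inv h \<otimes> h') \<otimes> l"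
        using HG KG h by (simp add: m_assoc)
      then have "x = (inv h \<otimes> h') \<otimes> l"
        using x HG[OF h] by (simp flip: m_assoc)
      moreover have "inv h \<otimes> h' \<in> H"
        using hl(1) h by (intro Hm Hi)
      ultimately show False
        using False hl(2) unfolding set_mult_def by blast
    qed
    then show ?thesis
      using False by (simp add: f_def)
  qed
  have "locally_constant_on G T f"
    unfolding locally_constant_on_def
  proof
    fix x assume x: "x \<in> carrier G"
    \<comment> \<open>\<open>x\<close> times the kernel of \<open>\<theta>\<close>, on which
      \<open>f\<close> is constant by \<open>f_right\<close>.\<close>
    let ?W = "{y \<in> carrier G. inv x \<otimes> y \<in> {k \<in> K. \<theta> k = 1}}"
    have "openin T ?W"
      using open_subgroup_char_kernel[OF K' \<theta>(1)] x by (intro openin_left_preimage) (auto simp: open_subgroup_def)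
    moreover have "x \<in> ?W"
      using x smooth_chars_one[OF K' \<theta>(1)] subgroup.one_closed[OF K'] by simp
    moreover have "f y = f x" if y: "y \<in> ?W" for y
    proof -
      have "y = x \<otimes> (inv x \<otimes> y)"
        using x y by (simp flip: m_assoc)
      then show ?thesis
        using f_right[OF x, of "inv x \<otimes> y"] y by simp
    qed
    ultimately show "\<exists>W. openin T W \<and> x \<in> W \<and> (\<forall>y\<in>W. f y = f x)"
      by blast
  qed
  moreover have "f x \<in> s.span {w}" for x
    using s.span_scale[OF s.span_base[of w "{w}"]] s.span_zero by (simp add: f_def)
  moreover have "H <#> K \<subseteq> carrier G"
    using subgroup.subset[OF H] subgroup.subset[OF K'] by (rule setmult_subset_G)
  then have f_out: "f x = 0" if "x \<notin> carrier G" for x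
    using that by (auto simp: f_def)
  ultimately have fM: "f \<in> M.V"
    using f_left by (simp add: mem_Ind_iff)
  have f_act: "M.act k f = M.scl (\<theta> k) f" if "k \<in> K" for k
    using f_right that f_out by (auto simp: fun_eq_iff pointwise_scale_def)
  have "f (\<one> \<otimes> \<one>) = s (\<theta> \<one>) w"
    using f_val subgroup.one_closed[OF H] subgroup.one_closed[OF K'] by blast
  then have "f \<one> \<noteq> 0"
    using w smooth_chars_one[OF K' \<theta>(1)] by simp
  then have f0: "f \<noteq> 0"
    by auto
  let ?O = "(\<lambda>g. M.act g f) ` carrier G"
  define E where "E = M.vs.span ?O"
  have E: "invariant_subspace G ?M E"
    unfolding E_def by (rule M.invariant_subspace_span_orbit[OF fM])
  have ex: "\<exists>c. M.act k f = M.scl c f" if "k \<in> K" for k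
    using f_act[OF that] by blast
  obtain F where F: "finite F" "card F \<le> card (rcosets K)" "\<And>g. g \<in> carrier G \<Longrightarrow> \<exists>c. \<exists>x\<in>F. M.act g f = M.scl c x"
    by (rule M.orbit_in_span[OF K' finite_rcosets_open_subgroup[OF K] fM ex]) (assumption, rule that)
  have "?O \<subseteq> M.vs.span F"
  proof (rule image_subsetI)
    fix g assume "g \<in> carrier G"
    then obtain c x where x: "x \<in> F" "M.act g f = M.scl c x"
      using F(3) by blast
    show "M.act g f \<in> M.vs.span F"
      unfolding x(2) by (intro M.vs.span_scale M.vs.span_base x(1))
  qed
  then have EF: "E \<subseteq> M.vs.span F"
    unfolding E_def by (rule M.vs.span_minimal[OF _ M.vs.subspace_span])
  have "smooth G T (?M\<lparr>rep_space := E\<rparr>)"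
    by (rule smooth_subrep[OF is_group M_sm E])
  then interpret E: fd_rep G "?M\<lparr>rep_space := E\<rparr>"
    by (rule fd_rep_smooth) (use EF F(1) in \<open>auto simp del: Ind_simps\<close>)
  have "M.act \<one> f \<in> E"
    unfolding E_def by (rule M.vs.span_base) blast
  then have fE: "f \<in> E"
    using M.act_one[OF fM] by (simp del: Ind_simps)
  have "rep_space (?M\<lparr>rep_space := E\<rparr>) \<noteq> {0}"
    using fE f0 by auto
  then obtain W where "invariant_subspace G (?M\<lparr>rep_space := E\<rparr>) W" "W \<noteq> {0}"
    "irreducible_rep G (?M\<lparr>rep_space := E\<rparr>\<lparr>rep_space := W\<rparr>)"
    by (rule E.irreducible_subrep_exists)
  then have W: "invariant_subspace G (?M\<lparr>rep_space := E\<rparr>) W" "W \<noteq> {0}" "irreducible_rep G (?M\<lparr>rep_space := W\<rparr>)"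
    by simp_all
  obtain p where p: "\<And>v. v \<in> E \<Longrightarrow> p v \<in> W" "\<And>u. u \<in> W \<Longrightarrow> p u = u"
    "\<And>v w. v \<in> E \<Longrightarrow> w \<in> E \<Longrightarrow> p (v + w) = p v + p w"
    "\<And>c v. v \<in> E \<Longrightarrow> p (M.scl c v) = M.scl c (p v)"
    "\<And>g v. g \<in> carrier G \<Longrightarrow> v \<in> E \<Longrightarrow> p (M.act g v) = M.act g (p v)"
    using E.equivariant_projection[OF W(1)] by (auto simp del: Ind_simps)
  have WE: "W \<subseteq> E" and EM: "E \<subseteq> M.V"
    using W(1) E by (auto simp: invariant_subspace_def)
  have Winv: "invariant_subspace G ?M W"
    using W(1) EM by (auto simp: invariant_subspace_def)
  have sE: "M.vs.subspace E"
    unfolding E_def by (rule M.vs.subspace_span)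
  \<comment> \<open>If \<open>p\<close> killed \<open>f\<close>, it would by equivariance kill the
    orbit and so all of \<open>E\<close>, but it is the identity on the nonzero
    \<open>W\<close>.\<close>
  have pf0: "p f \<noteq> 0"
  proof
    assume pf: "p f = 0"
    have p0: "p 0 = 0"
      using p(4)[OF fE, of 0] M.vs.scale_zero_left by (simp del: Ind_simps)
    have "M.vs.subspace {v \<in> E. p v = 0}"
      using sE p0 p(3,4) M.vs.scale_zero_right unfolding M.vs.subspace_def by (auto simp del: Ind_simps)
    moreover have "?O \<subseteq> {v \<in> E. p v = 0}"
      using p(5)[OF _ fE] pf M.act_zero E fE by (auto simp: invariant_subspace_def simp del: Ind_simps)
    ultimately have "E \<subseteq> {v \<in> E. p v = 0}"
      using M.vs.span_minimal unfolding E_def by blast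
    then have "u = 0" if "u \<in> W" for u
      using that WE p(2) by force
    then show False
      using W(2) M.vs.subspace_0 Winv by (auto simp: invariant_subspace_def)
  qed
  have "M.act k (p f) = M.scl (\<theta> k) (p f)" if k: "k \<in> K" for k
    using p(5)[OF KG[OF k] fE] p(4)[OF fE, of "\<theta> k"] f_act[OF k] by simp
  then have \<theta>W: "\<theta> \<in> weights K (?M\<lparr>rep_space := W\<rparr>)"
    using pf0 p(1)[OF fE] \<theta>(1) by (auto simp: weights_def smooth_chars_def simp del: Ind_simps)
  let ?N = "?M\<lparr>rep_space := W\<rparr>"
  interpret N: lin_rep G ?N
    by (rule M.lin_rep_subrep[OF Winv])
  \<comment> \<open>\<open>Irr\<close> consists of representations on
    \<open>nat \<Rightarrow> complex\<close>, whereas \<open>?N\<close> is a space of functions on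
    the group; coordinates connect the two.\<close>
  have "\<exists>F. finite F \<and> N.V \<subseteq> N.vs.span F"
    using WE EF F(1) by (auto simp del: Ind_simps)
  then obtain \<pi> :: "('a, nat \<Rightarrow> complex) rep" where \<pi>: "representation G \<pi>" "iso_rep G \<pi> ?N"
    by (rule N.coordinate_rep_exists)
  have "\<pi> \<in> smooth_irreps G T"
    using smooth_iso[OF \<pi>(1) smooth_subrep[OF is_group M_sm Winv] \<pi>(2)]
      irreducible_iso[OF is_group \<pi>(1) W(3) \<pi>(2)] by (simp add: smooth_irreps_def)
  then obtain c where c: "c \<in> Irr G T" "iso_rep G (representative c) \<pi>"
    using Irr_cover[OF is_group] by blast
  have rc: "representation G (representative c)"
    using Irr_representative[OF is_group c(1)] by (simp add: smooth_irreps_def smooth_def)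
  have iso: "iso_rep G (representative c) ?N" "iso_rep G ?N (representative c)"
    using iso_rep_trans[OF rc \<pi>(1) N.rep c(2) \<pi>(2)] iso_rep_sym[OF rc] by blast+
  have "degree_rep ?N \<le> enat (card (rcosets K))"
    unfolding degree_rep_def edim_le_iff[OF N.vs.vector_space_axioms] using WE EF F(1,2)
    by (intro exI[of _ F]) (auto simp del: Ind_simps)
  then have "degree_rep (representative c) \<le> enat (card (rcosets K))"
    by (rule degree_rep_le_iso[OF N.rep rc iso(2)])
  moreover have "\<not> hom_rep G ?N ?M \<subseteq> {0}"
  proof
    assume "hom_rep G ?N ?M \<subseteq> {0}"
    then have "(\<lambda>v. if v \<in> W then v else 0) = 0"
      using M.hom_rep_inclusion[OF Winv] by blast
    then have "p f = 0"
      using p(1)[OF fE] fun_cong[of "\<lambda>v. if v \<in> W then v else 0" 0 "p f"] by simp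
    then show False
      using pf0 by simp
  qed
  then have "\<not> hom_rep G (representative c) ?M \<subseteq> {0}"
    using hom_rep_trivial_iso[OF rc N.rep M.rep iso(1)] by blast
  moreover obtain \<phi> where "\<phi> \<in> hom_rep G ?N (representative c)" "inj_on \<phi> (rep_space ?N)"
    using iso(2) by (auto simp: iso_rep_def bij_betw_def)
  then have "\<theta> \<in> weights K (representative c)"
    using weights_mono_hom[OF _ _ N.rep _ subgroup.subset[OF K']] \<theta>W rc
    unfolding Defs.representation_def by blast
  ultimately show ?thesis
    using that c(1) by blast
qed

text \<open>The degree bound to use is the index of \<open>K\<close>. It leaves finitely many
  classes from \<open>weight_in_Ind_line_rep\<close>, each of them finite-dimensional and so with
  finitely many weights.\<close>

lemma FAb_if_strongly_admissible_Ind_line_rep: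
  assumes H: "closed_subgroup H G T" and s: "vector_space s" and w: "w \<noteq> 0"
    and adm: "strongly_admissible G T (Ind G T H (line_rep s w))"
  shows "FAb_relative G T H"
proof (rule FAb_relative_if_finite_chars[OF H])
  fix K assume K: "open_subgroup K G T"
  have H': "subgroup H G" and K': "K \<subseteq> carrier G"
    using H K subgroup.subset by (auto simp: closed_subgroup_def open_subgroup_def)
  let ?C = "{c \<in> Irr G T. degree_rep (representative c) \<le> enat (card (rcosets K)) \<and>
    \<not> hom_rep G (representative c) (Ind G T H (line_rep s w)) \<subseteq> {0}}"
  have "finite ?C"
    using adm unfolding strongly_admissible_iff[OF is_group] by blast
  moreover have "finite (weights K (representative c))" if c: "c \<in> ?C" for c
  proof -
    have "smooth G T (representative c)" "irreducible_rep G (representative c)"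
      using Irr_representative[OF is_group, of c T] c by (auto simp: smooth_irreps_def)
    then interpret R: fd_rep G "representative c"
      by (rule smooth_irreducible_fd)
    show ?thesis
      by (rule R.finite_weights[OF R.fin_dim K'])
  qed
  ultimately have "finite (\<Union>c\<in>?C. weights K (representative c))"
    by blast
  moreover have "{\<theta> \<in> smooth_chars G T K. \<forall>a\<in>H \<inter> K. \<theta> a = 1} \<subseteq> (\<Union>c\<in>?C. weights K (representative c))"
  proof
    fix \<theta> assume "\<theta> \<in> {\<theta> \<in> smooth_chars G T K. \<forall>a\<in>H \<inter> K. \<theta> a = 1}"
    then have \<theta>: "\<theta> \<in> smooth_chars G T K" "\<And>a. a \<in> H \<inter> K \<Longrightarrow> \<theta> a = 1"
      by auto
    obtain c where "c \<in> Irr G T" "degree_rep (representative c) \<le> enat (card (rcosets K))"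
      "\<not> hom_rep G (representative c) (Ind G T H (line_rep s w)) \<subseteq> {0}" "\<theta> \<in> weights K (representative c)"
      by (rule weight_in_Ind_line_rep[OF H' K s w \<theta>]) (assumption, rule that)
    then show "\<theta> \<in> (\<Union>c\<in>?C. weights K (representative c))"
      by blast
  qed
  ultimately show "finite {\<theta> \<in> smooth_chars G T K. \<forall>a\<in>H \<inter> K. \<theta> a = 1}"
    by (rule finite_subset[rotated])
qed

end

theorem theoremA:
  fixes G :: "('g, 'm) monoid_scheme" and T :: "'g topology" and H :: "'g set"
  assumes "profinite_group G T"
    and "topologically_fg G T"
    and "closed_subgroup H G T"
    and "\<exists>s :: complex \<Rightarrow> 'w::ab_group_add \<Rightarrow> 'w. vector_space s"
    and "\<exists>w :: 'w. w \<noteq> 0"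
  shows "(FAb_relative G T H \<longleftrightarrow>
            (\<forall>\<sigma> :: ('g, 'w) rep.
               strongly_admissible (G\<lparr>carrier := H\<rparr>) (subtopology T H) \<sigma> \<longrightarrow>
               strongly_admissible G T (Ind G T H \<sigma>)))
       \<and> (FAb_relative G T H \<longleftrightarrow> strongly_admissible G T (Ind G T H trivial_rep))"
proof -
  interpret profinite_group G T by fact
  have H: "subgroup H G"
    using assms(3) by (simp add: closed_subgroup_def)
  \<comment> \<open>Stated over an arbitrary type \<open>'x\<close>, to serve for the complex
    numbers in (c) and for \<open>'w\<close> in (b).\<close>
  have line: "strongly_admissible (G\<lparr>carrier := H\<rparr>) (subtopology T H) (line_rep s w)"
    if "vector_space s" "w \<noteq> 0" for s :: "complex \<Rightarrow> 'x::ab_group_add \<Rightarrow> 'x" and w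
  proof (rule strongly_admissible_line_rep[OF subgroup_imp_group[OF H] _ that])
    show "topspace (subtopology T H) = carrier (G\<lparr>carrier := H\<rparr>)"
      using subgroup.subset[OF H] topspace_eq by auto
  qed
  obtain s :: "complex \<Rightarrow> 'w \<Rightarrow> 'w" and w :: 'w where sw: "vector_space s" "w \<noteq> 0"
    using assms(4,5) by blast
  have one: "(1 :: complex) \<noteq> 0"
    by simp
  note forward = FAb_imp_strongly_admissible_Ind[OF assms(2) H]
  note backward = FAb_if_strongly_admissible_Ind_line_rep[OF assms(3)]
  have "FAb_relative G T H \<longleftrightarrow> strongly_admissible G T (Ind G T H trivial_rep)"
    unfolding trivial_rep_eq_line_rep
    using forward[OF _ line[OF vector_space_complex one]] backward[OF vector_space_complex one] by blast
  \<comment> \<open>From (b) to (a), \<open>\<sigma>\<close> is taken to be the line spanned by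
    \<open>w\<close>.\<close>
  moreover have "FAb_relative G T H \<longleftrightarrow> (\<forall>\<sigma> :: ('g, 'w) rep.
      strongly_admissible (G\<lparr>carrier := H\<rparr>) (subtopology T H) \<sigma> \<longrightarrow> strongly_admissible G T (Ind G T H \<sigma>))"
    using forward line[OF sw] backward[OF sw] by blast
  ultimately show ?thesis
    by blast
qed

end
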